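(* Let $X$ be a bounded geometry metric space (distances equal to $+\infty$ are allowed). If $X$ does not have property A, then the uniform Roe algebra $C^*_u(X)$ contains a ghost operator that is not compact. Consequently, $X$ has property A if and only if every ghost operator in $C^*_u(X)$ is compact.
   Context: A metric space $X$ (possibly with some distances $+\infty$) has bounded geometry if for each $R>0$ there is $N$ such that every ball of radius $R$ contains at most $N$ points. Let $\ell^2(X)$ have orthonormal basis $\{\delta_x\}_{x\in X}$ and write $T_{xy}=\langle\delta_x,T\delta_y\rangle$ for a bounded operator $T$. The propagation of $T$ is $\sup\{d(x,y): T_{xy}\neq 0\}$; $\mathbb{C}_R[X]$ denotes the bounded operators of propagation at most $R$, $\mathbb{C}_u[X]=\bigcup_{R\ge 0}\mathbb{C}_R[X]$, and the uniform Roe algebra $C^*_u(X)$ is the norm closure of $\mathbb{C}_u[X]$ in $\mathfrak{B}(\ell^2(X))$. An operator $T\in C^*_u(X)$ is a ghost if $T_{xy}\to 0$ as $x,y\to\infty$ in $X$ (i.e. for every $\epsilon>0$ there is a finite $F\subseteq X$ with $|T_{xy}|<\epsilon$ whenever $x\notin F$ or $y\notin F$). $X$ has property A if there is a sequence $(k_n)$ of positive definite kernels on $X\times X$ such that (a) for each $n$ there is $r$ with $k_n(x,y)=0$ whenever $d(x,y)>r$, and (b) for every $s>0$ and $\epsilon>0$ there is $N$ such that $1-\epsilon\le k_n(x,y)\le 1$ for all $n>N$ and all $x,y$ with $d(x,y)<s$. *)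

theory Defs
  imports "HOL-Analysis.Analysis"
begin

text \<open>The space X is the universe of the type 'a; distances take values in ereal
 (nonnegative, possibly +infinity).\<close>

definition ext_metric :: "('a \<Rightarrow> 'a \<Rightarrow> ereal) \<Rightarrow> bool" where
  "ext_metric d \<longleftrightarrow>
     (\<forall>x y. 0 \<le> d x y) \<and> (\<forall>x y. d x y = 0 \<longleftrightarrow> x = y) \<and>
     (\<forall>x y. d x y = d y x) \<and> (\<forall>x y z. d x z \<le> d x y + d y z)"

definition bounded_geometry :: "('a \<Rightarrow> 'a \<Rightarrow> ereal) \<Rightarrow> bool" where
  "bounded_geometry d \<longleftrightarrow>
     (\<forall>R::real. R > 0 \<longrightarrow> (\<exists>N::nat. \<forall>x.
        finite {y. d x y \<le> ereal R} \<and> card {y. d x y \<le> ereal R} \<le> N))"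

definition l2 :: "('a \<Rightarrow> complex) set" where
  "l2 = {f. (\<lambda>x. (cmod (f x))\<^sup>2) summable_on UNIV}"

definition l2norm :: "('a \<Rightarrow> complex) \<Rightarrow> real" where
  "l2norm f = sqrt (\<Sum>\<^sub>\<infinity>x. (cmod (f x))\<^sup>2)"

definition delta :: "'a \<Rightarrow> 'a \<Rightarrow> complex" where
  "delta y = (\<lambda>z. if z = y then 1 else 0)"

text \<open>An operator is represented by a function on 'a \<Rightarrow> complex; only its
 values on l2 matter.\<close>

definition bounded_op :: "(('a \<Rightarrow> complex) \<Rightarrow> ('a \<Rightarrow> complex)) \<Rightarrow> bool" where
  "bounded_op T \<longleftrightarrow>
     (\<forall>f\<in>l2. T f \<in> l2) \<and>
     (\<forall>f\<in>l2. \<forall>g\<in>l2. T (\<lambda>x. f x + g x) = (\<lambda>x. T f x + T g x)) \<and>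
     (\<forall>f\<in>l2. \<forall>c. T (\<lambda>x. c * f x) = (\<lambda>x. c * T f x)) \<and>
     (\<exists>C. \<forall>f\<in>l2. l2norm (T f) \<le> C * l2norm f)"

definition op_norm :: "(('a \<Rightarrow> complex) \<Rightarrow> ('a \<Rightarrow> complex)) \<Rightarrow> real" where
  "op_norm T = Sup {l2norm (T f) | f. f \<in> l2 \<and> l2norm f \<le> 1}"

text \<open>Matrix coefficient T_xy = <delta_x, T delta_y>.\<close>
definition matrix_coeff :: "(('a \<Rightarrow> complex) \<Rightarrow> ('a \<Rightarrow> complex)) \<Rightarrow> 'a \<Rightarrow> 'a \<Rightarrow> complex" where
  "matrix_coeff T x y = T (delta y) x"

definition prop_le :: "('a \<Rightarrow> 'a \<Rightarrow> ereal) \<Rightarrow> real \<Rightarrow> (('a \<Rightarrow> complex) \<Rightarrow> ('a \<Rightarrow> complex)) \<Rightarrow> bool" where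
  "prop_le d R T \<longleftrightarrow> (\<forall>x y. matrix_coeff T x y \<noteq> 0 \<longrightarrow> d x y \<le> ereal R)"

definition finite_prop_op :: "('a \<Rightarrow> 'a \<Rightarrow> ereal) \<Rightarrow> (('a \<Rightarrow> complex) \<Rightarrow> ('a \<Rightarrow> complex)) \<Rightarrow> bool" where
  "finite_prop_op d T \<longleftrightarrow> bounded_op T \<and> (\<exists>R\<ge>0. prop_le d R T)"

definition uniform_roe :: "('a \<Rightarrow> 'a \<Rightarrow> ereal) \<Rightarrow> (('a \<Rightarrow> complex) \<Rightarrow> ('a \<Rightarrow> complex)) \<Rightarrow> bool" where
  "uniform_roe d T \<longleftrightarrow> bounded_op T \<and>
     (\<forall>\<epsilon>>0. \<exists>S. finite_prop_op d S \<and> op_norm (\<lambda>f. \<lambda>x. T f x - S f x) < \<epsilon>)"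

definition ghost :: "('a \<Rightarrow> 'a \<Rightarrow> ereal) \<Rightarrow> (('a \<Rightarrow> complex) \<Rightarrow> ('a \<Rightarrow> complex)) \<Rightarrow> bool" where
  "ghost d T \<longleftrightarrow> uniform_roe d T \<and>
     (\<forall>\<epsilon>>0. \<exists>F. finite F \<and> (\<forall>x y. (x \<notin> F \<or> y \<notin> F) \<longrightarrow> cmod (matrix_coeff T x y) < \<epsilon>))"

text \<open>Compact operator: bounded, and the image of the closed unit ball is
 relatively compact, i.e. (l2 being complete) totally bounded.\<close>
definition compact_op :: "(('a \<Rightarrow> complex) \<Rightarrow> ('a \<Rightarrow> complex)) \<Rightarrow> bool" where
  "compact_op T \<longleftrightarrow> bounded_op T \<and>
     (\<forall>\<epsilon>>0. \<exists>G. finite G \<and> G \<subseteq> l2 \<and>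
        (\<forall>f\<in>l2. l2norm f \<le> 1 \<longrightarrow> (\<exists>g\<in>G. l2norm (\<lambda>x. T f x - g x) < \<epsilon>)))"

definition pos_def_kernel :: "('a \<Rightarrow> 'a \<Rightarrow> real) \<Rightarrow> bool" where
  "pos_def_kernel k \<longleftrightarrow> (\<forall>x y. k x y = k y x) \<and>
     (\<forall>F (c::'a \<Rightarrow> real). finite F \<longrightarrow> (\<Sum>x\<in>F. \<Sum>y\<in>F. c x * c y * k x y) \<ge> 0)"

definition property_A :: "('a \<Rightarrow> 'a \<Rightarrow> ereal) \<Rightarrow> bool" where
  "property_A d \<longleftrightarrow> (\<exists>k :: nat \<Rightarrow> 'a \<Rightarrow> 'a \<Rightarrow> real.
     (\<forall>n. pos_def_kernel (k n)) \<and>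
     (\<forall>n. \<exists>r::real. \<forall>x y. d x y > ereal r \<longrightarrow> k n x y = 0) \<and>
     (\<forall>s::real. \<forall>\<epsilon>::real. s > 0 \<longrightarrow> \<epsilon> > 0 \<longrightarrow> (\<exists>N::nat. \<forall>n>N. \<forall>x y.
        d x y < ereal s \<longrightarrow> 1 - \<epsilon> \<le> k n x y \<and> k n x y \<le> 1)))"

end

theory Submission
  imports Defs
begin

text \<open>
  If property A fails, then for some \<open>R\<close> and \<open>e\<close> there are disjoint finite sets \<open>F n\<close> on which no positive
  definite kernel with diagonal at most 1 and propagation \<open>S n\<close> (with \<open>S n\<close> growing as fast as we like)
  is at least \<open>1 - e\<close> on pairs at distance at most \<open>R\<close>. Convex duality turns each such failure into
  a positive contraction on \<open>F n\<close> of propagation \<open>R\<close> which has an eigenvalue at least \<open>k2\<close>, but whose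
  quadratic form is at most \<open>k0 < k2\<close> on unit vectors supported in sets of diameter at most \<open>S n\<close>;
  \<open>k0\<close> and \<open>k2\<close> do not depend on \<open>n\<close>. For a continuous \<open>\<phi>\<close> that vanishes below some \<open>k1 > k0\<close> and equals 1
  above \<open>k2\<close>, apply \<open>\<phi>\<close> to the direct sum of these contractions. The result is a norm limit of
  polynomials, hence in the uniform Roe algebra; it fixes a unit vector in every block, hence is not
  compact; and it is a ghost because the powers of the contraction decay geometrically on point masses
  as long as they stay localised.

  Conversely, under property A a ghost is a norm limit of its Schur products with finite propagation
  kernels, and each of these is a norm limit of finite matrices.
\<close>

text \<open>Failure of property A only says that no single kernel works on all of the space.
  Compactness of the kernels with diagonal at most 1 moves the failure to finite sets; and since a
  kernel can be glued across any finite set at an arbitrarily small cost, deleting finitely many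
  points does not repair it. This is what allows the sets \<open>F n\<close> to be disjoint. The gap
  \<open>k0 < k2\<close> comes from the dual weights: after normalisation they form a matrix whose
  form is at most 1 on local unit vectors, while its norm is at least
  \<open>1 / (1 - e / 2)\<close>. This matrix need not be positive, but bounded geometry bounds its
  norm by the size \<open>N\<close> of the \<open>R\<close>-balls, so that shifting by
  \<open>N\<close> and dividing by \<open>2 * N\<close> gives a positive contraction and maps the
  two bounds to constants that depend on \<open>N\<close> and \<open>e\<close> only.
  \<open>S n\<close> has to be at least \<open>2 * n * R\<close>, the diameter that a point mass can
  reach under \<open>n\<close> applications of an operator of propagation \<open>R\<close>. The
  \<open>n\<close>-th block then has entries at most \<open>(k0 / k1) ^ (2 * n)\<close>, which tends
  to 0 whatever the sizes of the blocks are.\<close>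

subsection \<open>Diagonalisation of symmetric matrices over a finite set\<close>

lemma continuous_on_apply2: "continuous_on A (\<lambda>k::'a \<Rightarrow> 'b \<Rightarrow> real. k x y)"
  by (rule continuous_on_product_then_coordinatewise)
     (rule continuous_on_subset[OF continuous_on_product_coordinates], simp)

text \<open>Tychonoff, once for each curried argument. The box supplies the maximiser in Jacobi's
  method and later the passage from finite to infinite sets of points.\<close>

lemma compact_unit_box: "compact {k::'a \<Rightarrow> 'b \<Rightarrow> real. \<forall>x y. \<bar>k x y\<bar> \<le> 1}"
proof -
  have c1: "compact (PiE UNIV (\<lambda>_::'b. {-1..1::real}))"
    using compactin_PiE[of "\<lambda>_. euclidean" UNIV "\<lambda>_::'b. {-1..1::real}"]
    by (simp add: euclidean_product_topology)
  have "compact (PiE UNIV (\<lambda>_::'a. PiE UNIV (\<lambda>_::'b. {-1..1::real})))"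
    using compactin_PiE[of "\<lambda>_. euclidean" UNIV "\<lambda>_::'a. PiE UNIV (\<lambda>_::'b. {-1..1::real})"] c1
    by (simp add: euclidean_product_topology)
  also have "PiE UNIV (\<lambda>_::'a. PiE UNIV (\<lambda>_::'b. {-1..1::real})) = {k. \<forall>x y. \<bar>k x y\<bar> \<le> 1}"
    by (auto simp: PiE_def Pi_def abs_le_iff minus_le_iff)
  finally show ?thesis .
qed

text \<open>An orthogonal matrix whose rows, the basis vectors \<open>u i\<close>, are indexed by
  \<open>F\<close> itself. Orthonormality of the columns is completeness; stating it here avoids a
  dimension count.\<close>

definition orthonormal_basis_on :: "'a set \<Rightarrow> ('a \<Rightarrow> 'a \<Rightarrow> real) \<Rightarrow> bool" where
  "orthonormal_basis_on F u \<longleftrightarrow>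
     (\<forall>i\<in>F. \<forall>j\<in>F. (\<Sum>x\<in>F. u i x * u j x) = (if i = j then 1 else 0)) \<and>
     (\<forall>x\<in>F. \<forall>y\<in>F. (\<Sum>i\<in>F. u i x * u i y) = (if x = y then 1 else 0))"

text \<open>The rotation that diagonalises the symmetric matrix with diagonal \<open>p\<close>,
  \<open>q\<close> and off-diagonal entry \<open>r\<close> keeps the trace and enlarges the
  difference of the diagonal entries from \<open>p - q\<close> to \<open>D\<close>. With the sum
  fixed, a larger difference means a larger sum of squares.\<close>

lemma rotation_increases_squares:
  fixes p q r :: real
  assumes "r \<noteq> 0"
  obtains c s where "c\<^sup>2 + s\<^sup>2 = 1"
    "p\<^sup>2 + q\<^sup>2 < (c\<^sup>2 * p + 2 * c * s * r + s\<^sup>2 * q)\<^sup>2 + (s\<^sup>2 * p - 2 * c * s * r + c\<^sup>2 * q)\<^sup>2"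
proof -
  define D where "D = sqrt ((p - q)\<^sup>2 + 4 * r\<^sup>2)"
  have Dpos: "(p - q)\<^sup>2 + 4 * r\<^sup>2 > 0"
    using assms by (simp add: add_nonneg_pos)
  have D0: "D > 0" and D2: "D\<^sup>2 = (p - q)\<^sup>2 + 4 * r\<^sup>2"
    using Dpos by (auto simp: D_def)
  have "((p - q) / D)\<^sup>2 + (2 * r / D)\<^sup>2 = 1"
    using D2 Dpos by (simp add: power_divide power_mult_distrib add_divide_distrib[symmetric])
  then obtain t where t: "(p - q) / D = cos t" "2 * r / D = sin t"
    using sincos_total_2pi by metis
  \<comment> \<open>\<open>t\<close> is the polar angle of the vector with coordinates
    \<open>p - q\<close> and \<open>2 * r\<close>; quadratic expressions in \<open>c\<close> and
    \<open>s\<close> see the double angle.\<close>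
  define c s where "c = cos (t / 2)" and "s = sin (t / 2)"
  have cs: "c\<^sup>2 + s\<^sup>2 = 1" by (simp add: c_def s_def)
  have ct: "c\<^sup>2 - s\<^sup>2 = (p - q) / D"
    using cos_double[of "t/2"] t by (simp add: c_def s_def)
  have st: "2 * c * s = 2 * r / D"
    using sin_double[of "t/2"] t by (simp add: c_def s_def mult_ac)
  let ?P = "c\<^sup>2 * p + 2 * c * s * r + s\<^sup>2 * q" and ?Q = "s\<^sup>2 * p - 2 * c * s * r + c\<^sup>2 * q"
  have sum: "?P + ?Q = p + q"
  proof -
    have "?P + ?Q = (c\<^sup>2 + s\<^sup>2) * (p + q)" by algebra
    then show ?thesis using cs by simp
  qed
  have "?P - ?Q = (c\<^sup>2 - s\<^sup>2) * (p - q) + 2 * (2 * c * s) * r" by algebra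
  also have "\<dots> = ((p - q)\<^sup>2 + 4 * r\<^sup>2) / D"
    unfolding ct st by (simp add: power2_eq_square add_divide_distrib)
  also have "\<dots> = D" using D2 D0 by (simp add: divide_eq_eq power2_eq_square)
  finally have "(?P - ?Q)\<^sup>2 = (p - q)\<^sup>2 + 4 * r\<^sup>2" using D2 by simp
  then have "(p - q)\<^sup>2 < (?P - ?Q)\<^sup>2" using assms by simp
  moreover have "2 * (?P\<^sup>2 + ?Q\<^sup>2) = (?P + ?Q)\<^sup>2 + (?P - ?Q)\<^sup>2" by algebra
  moreover have "2 * (p\<^sup>2 + q\<^sup>2) = (p + q)\<^sup>2 + (p - q)\<^sup>2" by algebra
  ultimately have "p\<^sup>2 + q\<^sup>2 < ?P\<^sup>2 + ?Q\<^sup>2" using sum by auto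
  with cs show ?thesis using that by blast
qed

lemma orthonormal_basis_on_rotate:
  assumes F: "finite F" and u: "orthonormal_basis_on F u" and ij: "i \<in> F" "j \<in> F" "i \<noteq> j"
    and cs: "c\<^sup>2 + s\<^sup>2 = (1::real)"
  shows "orthonormal_basis_on F (\<lambda>k x. if k = i then c * u i x + s * u j x
      else if k = j then c * u j x - s * u i x else u k x)" (is "orthonormal_basis_on F ?v")
proof -
  have r: "(\<Sum>x\<in>F. u k x * u l x) = (if k = l then 1 else 0)" if "k \<in> F" "l \<in> F" for k l
    using u that by (simp add: orthonormal_basis_on_def)
  have col: "(\<Sum>k\<in>F. u k x * u k y) = (if x = y then 1 else 0)" if "x \<in> F" "y \<in> F" for x y
    using u that by (simp add: orthonormal_basis_on_def)
  have lin: "(\<Sum>x\<in>F. (a * u k x + b * u l x) * (a' * u k' x + b' * u l' x))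
      = a * a' * (\<Sum>x\<in>F. u k x * u k' x) + a * b' * (\<Sum>x\<in>F. u k x * u l' x)
      + b * a' * (\<Sum>x\<in>F. u l x * u k' x) + b * b' * (\<Sum>x\<in>F. u l x * u l' x)" for a b a' b' k l k' l'
    by (simp add: sum_distrib_left sum.distrib[symmetric] algebra_simps)
  \<comment> \<open>Every rotated row is written in the single form
    \<open>al k * u (fi k) + be k * u j\<close>, so that one bilinear expansion covers all pairs of
    rows.\<close>
  define al where "al k = (if k = i then c else if k = j then - s else 1)" for k
  define be where "be k = (if k = i then s else if k = j then c else 0)" for k
  define fi where "fi k = (if k = i \<or> k = j then i else k)" for k
  have v: "?v k x = al k * u (fi k) x + be k * u j x" for k x
    by (auto simp: al_def be_def fi_def)
  have rows: "(\<Sum>x\<in>F. ?v k x * ?v l x) = (if k = l then 1 else 0)" if kl: "k \<in> F" "l \<in> F" for k l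
  proof -
    have fF: "fi k \<in> F" "fi l \<in> F" using kl ij by (auto simp: fi_def)
    show ?thesis
      unfolding v lin using fF ij kl cs
      by (simp add: r) (auto simp: fi_def al_def be_def power2_eq_square)
  qed
  have cols: "(\<Sum>k\<in>F. ?v k x * ?v k y) = (if x = y then 1 else 0)" if "x \<in> F" "y \<in> F" for x y
  proof -
    have split: "(\<Sum>k\<in>F. f k) = f i + (f j + (\<Sum>k\<in>F - {i} - {j}. f k))" for f :: "'a \<Rightarrow> real"
      using F ij by (simp add: sum.remove[of F i] sum.remove[of "F - {i}" j])
    have "(\<Sum>k\<in>F. ?v k x * ?v k y) = (c * u i x + s * u j x) * (c * u i y + s * u j y)
        + ((c * u j x - s * u i x) * (c * u j y - s * u i y) + (\<Sum>k\<in>F - {i} - {j}. u k x * u k y))"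
      using ij by (subst split) simp
    also have "\<dots> = (c\<^sup>2 + s\<^sup>2) * (u i x * u i y) + ((c\<^sup>2 + s\<^sup>2) * (u j x * u j y)
        + (\<Sum>k\<in>F - {i} - {j}. u k x * u k y))" by algebra
    also have "\<dots> = (\<Sum>k\<in>F. u k x * u k y)" unfolding cs by (subst split) simp
    finally show ?thesis using col that by simp
  qed
  show ?thesis unfolding orthonormal_basis_on_def using rows cols by blast
qed

text \<open>Jacobi's method: an orthonormal basis maximising the sum of the squared diagonal entries
  of \<open>a\<close> diagonalises \<open>a\<close>, because a plane rotation would otherwise increase that sum.\<close>

lemma symmetric_diagonalization:
  fixes a :: "'a \<Rightarrow> 'a \<Rightarrow> real"
  assumes F: "finite F" and sym: "\<And>x y. x \<in> F \<Longrightarrow> y \<in> F \<Longrightarrow> a x y = a y x"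
  obtains u b where "orthonormal_basis_on F u"
    "\<And>x y. x \<in> F \<Longrightarrow> y \<in> F \<Longrightarrow> a x y = (\<Sum>i\<in>F. b i * u i x * u i y)"
proof -
  define B where "B p q = (\<Sum>x\<in>F. \<Sum>y\<in>F. p x * a x y * q y)" for p q :: "'a \<Rightarrow> real"
  define D where "D u = (\<Sum>k\<in>F. (B (u k) (u k))\<^sup>2)" for u :: "'a \<Rightarrow> 'a \<Rightarrow> real"
  define K where "K = {u. \<forall>x y. \<bar>u x y\<bar> \<le> 1} \<inter> {u. orthonormal_basis_on F u}"
  have "{u. orthonormal_basis_on F u} =
      (\<Inter>i\<in>F. \<Inter>j\<in>F. {u. (\<Sum>x\<in>F. u i x * u j x) = (if i = j then 1 else 0)}) \<inter>
      (\<Inter>x\<in>F. \<Inter>y\<in>F. {u. (\<Sum>i\<in>F. u i x * u i y) = (if x = y then 1 else 0)})"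
    by (auto simp: orthonormal_basis_on_def)
  also have "closed \<dots>"
    by (intro closed_Int closed_INT ballI closed_Collect_eq continuous_intros continuous_on_apply2)
  finally have "closed {u. orthonormal_basis_on F u}" .
  then have "compact K" unfolding K_def by (rule compact_Int_closed[OF compact_unit_box])
  moreover have "(\<lambda>i x. if i = x then 1 else 0) \<in> K"
    using F by (auto simp: K_def orthonormal_basis_on_def of_bool_def[symmetric] intro!: sum.neutral)
  moreover have "continuous_on K D"
    unfolding D_def B_def by (intro continuous_intros continuous_on_apply2)
  ultimately obtain u where uK: "u \<in> K" and umax: "\<And>v. v \<in> K \<Longrightarrow> D v \<le> D u"
    using continuous_attains_sup[of K D] by blast
  have u: "orthonormal_basis_on F u" using uK by (simp add: K_def)
  have max: "D v \<le> D u" if v: "orthonormal_basis_on F v" for v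
  proof -
    \<comment> \<open>\<open>K\<close> bounds all entries, while \<open>v\<close> is arbitrary
      outside \<open>F\<close>. Truncating it there leaves \<open>D\<close> unchanged.\<close>
    define w where "w k x = (if k \<in> F \<and> x \<in> F then v k x else 0)" for k x
    have w: "orthonormal_basis_on F w"
      using v by (simp add: orthonormal_basis_on_def w_def)
    have "\<bar>w k x\<bar> \<le> 1" for k x
    proof (cases "k \<in> F \<and> x \<in> F")
      case True
      have "(v k x)\<^sup>2 \<le> (\<Sum>i\<in>F. (v i x)\<^sup>2)"
        using True F by (intro member_le_sum) auto
      also have "\<dots> = 1" using v True by (simp add: orthonormal_basis_on_def power2_eq_square)
      finally show ?thesis using True by (simp add: w_def abs_square_le_1)
    qed (auto simp: w_def)
    then have "D w \<le> D u" using w by (intro umax) (simp add: K_def)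
    moreover have "D w = D v" unfolding D_def B_def by (simp add: w_def)
    ultimately show ?thesis by simp
  qed
  have Bsym: "B p q = B q p" for p q
    unfolding B_def by (subst sum.swap) (auto intro!: sum.cong simp: sym mult_ac)
  have Blin: "B (\<lambda>x. c * p x + s * q x) (\<lambda>x. c * p x + s * q x)
      = c\<^sup>2 * B p p + 2 * c * s * B p q + s\<^sup>2 * B q q" for p q c s
  proof -
    have "B (\<lambda>x. c * p x + s * q x) (\<lambda>x. c * p x + s * q x)
      = c\<^sup>2 * B p p + c * s * B p q + c * s * B q p + s\<^sup>2 * B q q"
      unfolding B_def
      by (simp add: sum_distrib_left sum.distrib[symmetric] algebra_simps power2_eq_square)
    then show ?thesis by (simp add: Bsym[of q p])
  qed
  have diag: "B (u i) (u j) = 0" if ij: "i \<in> F" "j \<in> F" "i \<noteq> j" for i j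
  proof (rule ccontr)
    assume "B (u i) (u j) \<noteq> 0"
    then obtain c s where cs: "c\<^sup>2 + s\<^sup>2 = 1" and
      gt: "(B (u i) (u i))\<^sup>2 + (B (u j) (u j))\<^sup>2
        < (c\<^sup>2 * B (u i) (u i) + 2 * c * s * B (u i) (u j) + s\<^sup>2 * B (u j) (u j))\<^sup>2
        + (s\<^sup>2 * B (u i) (u i) - 2 * c * s * B (u i) (u j) + c\<^sup>2 * B (u j) (u j))\<^sup>2"
      by (rule rotation_increases_squares)
    define v where "v = (\<lambda>k x. if k = i then c * u i x + s * u j x
      else if k = j then c * u j x - s * u i x else u k x)"
    have "orthonormal_basis_on F v"
      unfolding v_def by (rule orthonormal_basis_on_rotate[OF F u ij cs])
    then have le: "D v \<le> D u" by (rule max)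
    have split: "(\<Sum>k\<in>F. f k) = f i + (f j + (\<Sum>k\<in>F - {i} - {j}. f k))" for f :: "'a \<Rightarrow> real"
      using F ij by (simp add: sum.remove[of F i] sum.remove[of "F - {i}" j])
    have vi: "v i = (\<lambda>x. c * u i x + s * u j x)" and vj: "v j = (\<lambda>x. c * u j x + (- s) * u i x)"
      using ij by (auto simp: v_def)
    have rest: "(\<Sum>k\<in>F - {i} - {j}. (B (v k) (v k))\<^sup>2) = (\<Sum>k\<in>F - {i} - {j}. (B (u k) (u k))\<^sup>2)"
      by (intro sum.cong) (auto simp: v_def)
    have "D u < D v"
      unfolding D_def split[of "\<lambda>k. (B (u k) (u k))\<^sup>2"] split[of "\<lambda>k. (B (v k) (v k))\<^sup>2"] rest
      unfolding vi vj Blin using gt by (simp add: Bsym[of "u j" "u i"] algebra_simps)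
    with le show False by simp
  qed
  have col: "(\<Sum>k\<in>F. u k x * u k y) = (if x = y then 1 else 0)" if "x \<in> F" "y \<in> F" for x y
    using u that by (simp add: orthonormal_basis_on_def)
  have "a x y = (\<Sum>i\<in>F. B (u i) (u i) * u i x * u i y)" if xy: "x \<in> F" "y \<in> F" for x y
  proof -
    \<comment> \<open>The vanishing off-diagonal terms are put back in, so that completeness can
      collapse both basis sums.\<close>
    have "(\<Sum>i\<in>F. B (u i) (u i) * u i x * u i y) = (\<Sum>i\<in>F. \<Sum>j\<in>F. B (u i) (u j) * u i x * u j y)"
    proof (rule sum.cong[OF refl])
      fix i assume i: "i \<in> F"
      have "(\<Sum>j\<in>F. B (u i) (u j) * u i x * u j y)
          = (\<Sum>j\<in>F. if j = i then B (u i) (u i) * u i x * u i y else 0)"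
        using i diag by (intro sum.cong) auto
      then show "B (u i) (u i) * u i x * u i y = (\<Sum>j\<in>F. B (u i) (u j) * u i x * u j y)"
        using F i by simp
    qed
    also have "\<dots> = (\<Sum>i\<in>F. \<Sum>j\<in>F. \<Sum>z\<in>F. \<Sum>w\<in>F. (u i z * u i x) * a z w * (u j w * u j y))"
      unfolding B_def by (simp add: sum_distrib_left sum_distrib_right mult_ac)
    also have "\<dots> = (\<Sum>i\<in>F. \<Sum>z\<in>F. \<Sum>j\<in>F. \<Sum>w\<in>F. (u i z * u i x) * a z w * (u j w * u j y))"
      by (rule sum.cong[OF refl], rule sum.swap)
    also have "\<dots> = (\<Sum>i\<in>F. \<Sum>z\<in>F. \<Sum>w\<in>F. \<Sum>j\<in>F. (u i z * u i x) * a z w * (u j w * u j y))"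
      by (rule sum.cong[OF refl], rule sum.cong[OF refl], rule sum.swap)
    also have "\<dots> = (\<Sum>i\<in>F. \<Sum>z\<in>F. \<Sum>w\<in>F. (u i z * u i x) * a z w * (if w = y then 1 else 0))"
      by (intro sum.cong refl) (simp add: sum_distrib_left[symmetric] col xy)
    also have "\<dots> = (\<Sum>i\<in>F. \<Sum>z\<in>F. (u i z * u i x) * a z y)"
      using F xy by (simp add: if_distrib cong: if_cong)
    also have "\<dots> = (\<Sum>z\<in>F. \<Sum>i\<in>F. (u i z * u i x) * a z y)" by (rule sum.swap)
    also have "\<dots> = (\<Sum>z\<in>F. (if z = x then 1 else 0) * a z y)"
      by (intro sum.cong refl) (simp add: sum_distrib_right[symmetric] col xy)
    also have "\<dots> = a x y" using F xy by (simp add: if_distrib[of "\<lambda>t. t * _"] cong: if_cong)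
    finally show ?thesis by simp
  qed
  with u show ?thesis by (rule that)
qed

subsection \<open>Positive definite kernels and duality\<close>

text \<open>The separating functional is the negative part of a near-minimiser of the squared distance
  to the positive orthant.\<close>

lemma convex_separation_from_orthant:
  fixes C :: "('i \<Rightarrow> real) set"
  assumes I: "finite I" and ne: "C \<noteq> {}"
    and conv: "\<And>c c' t. c \<in> C \<Longrightarrow> c' \<in> C \<Longrightarrow> 0 \<le> t \<Longrightarrow> t \<le> 1 \<Longrightarrow> (\<lambda>i. (1 - t) * c i + t * c' i) \<in> C"
    and bnd: "\<And>c i. c \<in> C \<Longrightarrow> i \<in> I \<Longrightarrow> \<bar>c i\<bar> \<le> B"
    and e: "0 < e" and neg: "\<And>c. c \<in> C \<Longrightarrow> \<exists>i\<in>I. c i < - e"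
  shows "\<exists>w. (\<forall>i. 0 \<le> w i) \<and> (\<forall>c\<in>C. (\<Sum>i\<in>I. w i * c i) < 0)"
proof -
  define \<phi> where "\<phi> c = (\<Sum>i\<in>I. (max 0 (- c i))\<^sup>2)" for c :: "'i \<Rightarrow> real"
  have lower: "e\<^sup>2 \<le> \<phi> c" if c: "c \<in> C" for c
  proof -
    obtain i where i: "i \<in> I" "c i < - e" using neg[OF c] by blast
    have "e\<^sup>2 \<le> (max 0 (- c i))\<^sup>2" using i e by (intro power_mono) auto
    also have "\<dots> \<le> \<phi> c" unfolding \<phi>_def using I i by (intro member_le_sum) auto
    finally show ?thesis .
  qed
  define m where "m = Inf (\<phi> ` C)"
  have bdd: "bdd_below (\<phi> ` C)" using lower by (intro bdd_belowI[of _ "e\<^sup>2"]) auto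
  have "e\<^sup>2 \<le> m" unfolding m_def using ne lower by (intro cInf_greatest) auto
  then have m: "0 < m" using e by (meson less_le_trans zero_less_power)
  have mle: "m \<le> \<phi> c" if "c \<in> C" for c
    unfolding m_def using bdd that by (intro cInf_lower) auto
  define Q where "Q = (\<Sum>i\<in>I. (2 * B)\<^sup>2) + 1"
  have Q: "0 < Q" unfolding Q_def by (simp add: add_nonneg_pos)
  \<comment> \<open>The step size makes the second-order term at most \<open>t * (m / 2)\<close>;
    the near-minimiser \<open>c\<close> below is chosen with the same error.\<close>
  define t where "t = min 1 (m / (2 * Q))"
  have t: "0 < t" "t \<le> 1" "t * Q \<le> m / 2"
    using m Q by (auto simp: t_def min_def field_simps)
  have "Inf (\<phi> ` C) < m + t * m / 2" using m t unfolding m_def by simp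
  then obtain c where c: "c \<in> C" and cm: "\<phi> c < m + t * m / 2"
    using cInf_lessD[of "\<phi> ` C"] ne by blast
  define w where "w i = max 0 (- c i)" for i
  \<comment> \<open>The squared negative part is differentiable with derivative
    \<open>- 2 * max 0 (- a)\<close>, which is Lipschitz with constant 2; this is the resulting
    quadratic upper bound.\<close>
  have pt: "(max 0 (- (a + h)))\<^sup>2 \<le> (max 0 (- a))\<^sup>2 - 2 * max 0 (- a) * h + h\<^sup>2" for a h :: real
  proof (cases "0 \<le> a")
    case True
    then have "(max 0 (- (a + h)))\<^sup>2 \<le> \<bar>h\<bar>\<^sup>2" by (intro power_mono) auto
    with True show ?thesis by simp
  next
    case False
    have "(max 0 (- (a + h)))\<^sup>2 \<le> \<bar>a + h\<bar>\<^sup>2" by (intro power_mono) auto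
    with False show ?thesis by (simp add: power2_eq_square algebra_simps)
  qed
  have "(\<Sum>i\<in>I. w i * c' i) < 0" if c': "c' \<in> C" for c'
  proof -
    let ?v = "\<lambda>i. c' i - c i"
    have v2: "(\<Sum>i\<in>I. (?v i)\<^sup>2) \<le> Q"
    proof -
      have "(\<Sum>i\<in>I. (?v i)\<^sup>2) \<le> (\<Sum>i\<in>I. (2 * B)\<^sup>2)"
      proof (rule sum_mono)
        fix i assume "i \<in> I"
        then have "\<bar>?v i\<bar> \<le> 2 * B" using bnd[OF c, of i] bnd[OF c', of i] by linarith
        then show "(?v i)\<^sup>2 \<le> (2 * B)\<^sup>2" using abs_le_square_iff by fastforce
      qed
      then show ?thesis by (simp add: Q_def)
    qed
    have "(\<lambda>i. (1 - t) * c i + t * c' i) = (\<lambda>i. c i + t * ?v i)" by (auto simp: algebra_simps)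
    then have "m \<le> \<phi> (\<lambda>i. c i + t * ?v i)"
      using mle[OF conv[OF c c', of t]] t by simp
    also have "\<dots> \<le> (\<Sum>i\<in>I. (max 0 (- c i))\<^sup>2 - 2 * max 0 (- c i) * (t * ?v i) + (t * ?v i)\<^sup>2)"
      unfolding \<phi>_def by (intro sum_mono pt)
    also have "\<dots> = \<phi> c - 2 * t * (\<Sum>i\<in>I. w i * ?v i) + t * (t * (\<Sum>i\<in>I. (?v i)\<^sup>2))"
      unfolding \<phi>_def w_def
      by (simp add: sum.distrib sum_subtractf sum_distrib_left power_mult_distrib
          power2_eq_square mult_ac)
    also have "\<dots> \<le> \<phi> c - 2 * t * (\<Sum>i\<in>I. w i * ?v i) + t * (m / 2)"
    proof -
      have "t * (\<Sum>i\<in>I. (?v i)\<^sup>2) \<le> t * Q" using v2 t by (intro mult_left_mono) auto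
      also have "\<dots> \<le> m / 2" by (rule t(3))
      finally have "t * (t * (\<Sum>i\<in>I. (?v i)\<^sup>2)) \<le> t * (m / 2)" using t(1) by (intro mult_left_mono) auto
      then show ?thesis by simp
    qed
    finally have "t * (2 * (\<Sum>i\<in>I. w i * ?v i)) < t * m" using cm by (simp add: algebra_simps)
    then have 1: "2 * (\<Sum>i\<in>I. w i * ?v i) < m" using t by simp
    have "(\<Sum>i\<in>I. w i * c i) = - \<phi> c"
      unfolding \<phi>_def w_def sum_negf[symmetric]
      by (intro sum.cong refl) (auto simp: max_def power2_eq_square)
    moreover have "(\<Sum>i\<in>I. w i * c' i) = (\<Sum>i\<in>I. w i * c i) + (\<Sum>i\<in>I. w i * ?v i)"
      by (simp add: sum.distrib[symmetric] algebra_simps)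
    ultimately show ?thesis using 1 mle[OF c] m by linarith
  qed
  moreover have "\<forall>i. 0 \<le> w i" by (simp add: w_def)
  ultimately show ?thesis by blast
qed

section \<open>Elementary properties of positive definite kernels\<close>

lemma
  assumes "pos_def_kernel k"
  shows pos_def_kernel_sym: "k x y = k y x"
    and pos_def_kernel_form_nonneg: "finite F \<Longrightarrow> 0 \<le> (\<Sum>x\<in>F. \<Sum>y\<in>F. c x * c y * k x y)"
  using assms unfolding pos_def_kernel_def by blast+

lemma pos_def_kernelI:
  assumes "\<And>x y. k x y = k y x"
    and "\<And>F c. finite F \<Longrightarrow> 0 \<le> (\<Sum>x\<in>F. \<Sum>y\<in>F. c x * c y * k x y)"
  shows "pos_def_kernel k"
  using assms unfolding pos_def_kernel_def by blast

lemma pos_def_kernel_add: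
  assumes k: "pos_def_kernel k" and l: "pos_def_kernel l"
  shows "pos_def_kernel (\<lambda>x y. k x y + l x y)"
proof (rule pos_def_kernelI)
  show "k x y + l x y = k y x + l y x" for x y
    using pos_def_kernel_sym[OF k] pos_def_kernel_sym[OF l] by metis
  show "0 \<le> (\<Sum>x\<in>F. \<Sum>y\<in>F. c x * c y * (k x y + l x y))" if "finite F" for F c
    using pos_def_kernel_form_nonneg[OF k that, of c] pos_def_kernel_form_nonneg[OF l that, of c]
    by (simp add: distrib_left sum.distrib)
qed

lemma pos_def_kernel_conjugate:
  assumes k: "pos_def_kernel k"
  shows "pos_def_kernel (\<lambda>x y. f x * f y * k x y)"
proof (rule pos_def_kernelI)
  show "f x * f y * k x y = f y * f x * k y x" for x y
    using pos_def_kernel_sym[OF k] by (metis mult.commute)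
  show "0 \<le> (\<Sum>x\<in>F. \<Sum>y\<in>F. c x * c y * (f x * f y * k x y))" if "finite F" for F c
    using pos_def_kernel_form_nonneg[OF k that, of "\<lambda>x. c x * f x"] by (simp only: mult_ac)
qed

lemma pos_def_kernel_one: "pos_def_kernel (\<lambda>x y. 1)"
  by (rule pos_def_kernelI) (simp_all add: sum_product[symmetric])

lemma pos_def_kernel_rank_one: "pos_def_kernel (\<lambda>x y. f x * f y)"
  using pos_def_kernel_conjugate[OF pos_def_kernel_one, of f] by simp

lemma pos_def_kernel_diag_nonneg:
  assumes "pos_def_kernel k" shows "0 \<le> k x x"
proof -
  have "0 \<le> (\<Sum>x'\<in>{x}. \<Sum>y\<in>{x}. 1 * 1 * k x' y)"
    by (rule pos_def_kernel_form_nonneg[OF assms]) simp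
  then show ?thesis by simp
qed

text \<open>Evaluate the form at the vectors with coordinates 1, 1 and 1, -1 on the two
  points.\<close>

lemma pos_def_kernel_le_diag:
  assumes k: "pos_def_kernel k" shows "2 * \<bar>k x y\<bar> \<le> k x x + k y y"
proof (cases "x = y")
  case True then show ?thesis using pos_def_kernel_diag_nonneg[OF k, of y] by simp
next
  case False
  have sym: "k y x = k x y" by (rule pos_def_kernel_sym[OF k])
  have *: "0 \<le> (\<Sum>x'\<in>{x,y}. \<Sum>y'\<in>{x,y}. c x' * c y' * k x' y')" for c
    by (rule pos_def_kernel_form_nonneg[OF k]) simp
  show ?thesis
    using *[of "\<lambda>_. 1"] *[of "\<lambda>z. if z = x then 1 else -1"] False sym by simp
qed

section \<open>Kernels generated by vectors of small support\<close>

definition local_vec :: "('a \<Rightarrow> 'a \<Rightarrow> ereal) \<Rightarrow> 'a set \<Rightarrow> real \<Rightarrow> ('a \<Rightarrow> real) \<Rightarrow> bool" where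
  "local_vec d F S v \<longleftrightarrow> (\<forall>x. v x \<noteq> 0 \<longrightarrow> x \<in> F) \<and>
     (\<forall>x y. v x \<noteq> 0 \<longrightarrow> v y \<noteq> 0 \<longrightarrow> d x y \<le> ereal S)"

text \<open>The convex cone spanned by the rank one kernels of local vectors. It consists of
  positive definite kernels of propagation \<open>S\<close>, so if no such kernel solves the
  problem, none in the cone does; and the dual condition over this cone can be tested on single
  vectors.\<close>

inductive_set local_kernels :: "('a \<Rightarrow> 'a \<Rightarrow> ereal) \<Rightarrow> 'a set \<Rightarrow> real \<Rightarrow> ('a \<Rightarrow> 'a \<Rightarrow> real) set"
  for d F S where
  zero: "(\<lambda>_ _. 0) \<in> local_kernels d F S"
| add_rank_one: "k \<in> local_kernels d F S \<Longrightarrow> local_vec d F S v \<Longrightarrow>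
    (\<lambda>x y. k x y + v x * v y) \<in> local_kernels d F S"

lemma local_kernels_pos_def: "k \<in> local_kernels d F S \<Longrightarrow> pos_def_kernel k"
proof (induction rule: local_kernels.induct)
  case zero
  then show ?case by (simp add: pos_def_kernel_def)
next
  case (add_rank_one k v)
  then show ?case by (intro pos_def_kernel_add pos_def_kernel_rank_one)
qed

lemma local_kernels_support:
  assumes "k \<in> local_kernels d F S" "k x y \<noteq> 0"
  shows "x \<in> F \<and> y \<in> F \<and> d x y \<le> ereal S"
  using assms
proof (induction rule: local_kernels.induct)
  case (add_rank_one k v)
  then show ?case by (cases "k x y = 0") (auto simp: local_vec_def)
qed simp

lemma local_vec_scale: "local_vec d F S v \<Longrightarrow> local_vec d F S (\<lambda>x. c * v x)"
  by (auto simp: local_vec_def)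

lemma local_kernels_add:
  assumes "k \<in> local_kernels d F S" "l \<in> local_kernels d F S"
  shows "(\<lambda>x y. k x y + l x y) \<in> local_kernels d F S"
  using assms(2)
proof (induction rule: local_kernels.induct)
  case zero
  then show ?case using assms(1) by simp
next
  case (add_rank_one l v)
  then show ?case using local_kernels.add_rank_one[OF add_rank_one.IH] by (simp add: add.assoc)
qed

lemma local_kernels_scale:
  assumes "k \<in> local_kernels d F S" "0 \<le> c"
  shows "(\<lambda>x y. c * k x y) \<in> local_kernels d F S"
  using assms(1)
proof (induction rule: local_kernels.induct)
  case zero
  then show ?case using local_kernels.zero by simp
next
  case (add_rank_one k v)
  have "(\<lambda>x y. c * k x y + (sqrt c * v x) * (sqrt c * v y)) \<in> local_kernels d F S"
    using add_rank_one by (intro local_kernels.add_rank_one local_vec_scale)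
  moreover have "(sqrt c * v x) * (sqrt c * v y) = c * (v x * v y)" for x y
  proof -
    have "(sqrt c * v x) * (sqrt c * v y) = (sqrt c * sqrt c) * (v x * v y)" by (simp only: mult_ac)
    then show ?thesis using assms(2) by simp
  qed
  ultimately show ?case by (simp add: distrib_left)
qed

text \<open>Only the lower bound refers to \<open>Y\<close>, so a kernel for \<open>Y\<close> also
  serves every subset. Positivity and the diagonal bound force all values into the interval from -1
  to 1, and every condition is convex and closed in \<open>k\<close>.\<close>

definition almost_unit_kernel ::
  "('a \<Rightarrow> 'a \<Rightarrow> ereal) \<Rightarrow> 'a set \<Rightarrow> real \<Rightarrow> real \<Rightarrow> real \<Rightarrow> ('a \<Rightarrow> 'a \<Rightarrow> real) \<Rightarrow> bool" where
  "almost_unit_kernel d Y S R e k \<longleftrightarrow> pos_def_kernel k \<and>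
     (\<forall>x y. ereal S < d x y \<longrightarrow> k x y = 0) \<and> (\<forall>x. k x x \<le> 1) \<and>
     (\<forall>x\<in>Y. \<forall>y\<in>Y. d x y \<le> ereal R \<longrightarrow> 1 - e \<le> k x y)"

text \<open>Duality for the convex problem of finding an almost unit kernel: \<open>lam\<close> is dual to the diagonal
  constraint and \<open>w\<close> to the lower bound near the diagonal. Separation needs a bounded convex set, so
  kernels are restricted to trace at most \<open>M\<close>; the price is the extra term \<open>(1 - e) * W / M\<close> in
  \<open>lam\<close>, which also makes \<open>lam\<close> strictly positive.\<close>

lemma weights_of_no_kernel:
  fixes d :: "'a \<Rightarrow> 'a \<Rightarrow> ereal"
  assumes F: "finite F" and e: "0 < e" "e < 1" and sym: "\<And>x y. d x y = d y x"
    and no: "\<nexists>k. almost_unit_kernel d F S R (2 * e) k"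
  obtains lam w where "F \<noteq> {}" "\<And>x. x \<in> F \<Longrightarrow> 0 < lam x" "\<And>x y. 0 \<le> w x y" "\<And>x y. w x y = w y x"
    "\<And>x y. w x y \<noteq> 0 \<Longrightarrow> d x y \<le> ereal R"
    "(\<Sum>x\<in>F. lam x) \<le> (1 - e / 2) * (\<Sum>x\<in>F. \<Sum>y\<in>F. w x y)"
    "\<And>v. local_vec d F S v \<Longrightarrow>
      (\<Sum>x\<in>F. \<Sum>y\<in>F. w x y * v x * v y) \<le> (\<Sum>x\<in>F. lam x * (v x)\<^sup>2)"
proof -
  let ?K = "local_kernels d F S"
  define E where "E = {p \<in> F \<times> F. d (fst p) (snd p) \<le> ereal R}"
  have finE: "finite E" using F by (simp add: E_def)
  have Fne: "F \<noteq> {}"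
  proof
    assume "F = {}"
    then have "almost_unit_kernel d F S R (2 * e) (\<lambda>_ _. 0)"
      by (simp add: almost_unit_kernel_def pos_def_kernel_def)
    with no show False by blast
  qed
  then have cF: "real (card F) \<ge> 1" using F by (simp add: Suc_leI card_gt_0_iff)
  \<comment> \<open>With this \<open>M\<close> the extra term in \<open>lam\<close>, summed over
    \<open>F\<close>, is the fraction \<open>e / 2\<close> of \<open>(1 - e) * W\<close>; and
    \<open>(1 - e) * (1 + e / 2)\<close> is still below \<open>1 - e / 2\<close>.\<close>
  define M where "M = 2 * real (card F) / e"
  have M: "0 < M" using cF e by (simp add: M_def)
  \<comment> \<open>The slacks of the constraints: one coordinate per point for the diagonal and one
    per close pair for the lower bound.\<close>
  define ev where "ev k = (\<lambda>i. case i of Inl x \<Rightarrow> 1 - k x x | Inr p \<Rightarrow> k (fst p) (snd p) - (1 - e))"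
    for k :: "'a \<Rightarrow> 'a \<Rightarrow> real"
  define KM where "KM = {k \<in> ?K. (\<Sum>x\<in>F. k x x) \<le> M}"
  have KMpd: "pos_def_kernel k" if "k \<in> KM" for k
    using that by (auto simp: KM_def intro: local_kernels_pos_def)
  have conv: "(\<lambda>i. (1 - t) * c i + t * c' i) \<in> ev ` KM"
    if "c \<in> ev ` KM" "c' \<in> ev ` KM" "0 \<le> t" "t \<le> 1" for c c' t
  proof -
    obtain k k' where k: "k \<in> KM" "c = ev k" and k': "k' \<in> KM" "c' = ev k'" using \<open>c \<in> _\<close> \<open>c' \<in> _\<close> by blast
    let ?l = "\<lambda>x y. (1 - t) * k x y + t * k' x y"
    have "?l \<in> ?K" using k k' that by (intro local_kernels_add local_kernels_scale) (auto simp: KM_def)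
    moreover have "(\<Sum>x\<in>F. ?l x x) \<le> M"
    proof -
      have "(\<Sum>x\<in>F. ?l x x) = (1 - t) * (\<Sum>x\<in>F. k x x) + t * (\<Sum>x\<in>F. k' x x)"
        by (simp add: sum.distrib sum_distrib_left)
      also have "\<dots> \<le> (1 - t) * M + t * M"
        using k k' that by (intro add_mono mult_left_mono) (auto simp: KM_def)
      finally show ?thesis by (simp add: algebra_simps)
    qed
    moreover have "(\<lambda>i. (1 - t) * c i + t * c' i) = ev ?l"
      by (auto simp: k k' ev_def algebra_simps split: sum.splits)
    ultimately show ?thesis by (auto simp: KM_def)
  qed
  have dg: "0 \<le> k x x" "k x x \<le> M" if "k \<in> KM" "x \<in> F" for k x
  proof -
    show "0 \<le> k x x" by (rule pos_def_kernel_diag_nonneg[OF KMpd[OF \<open>k \<in> KM\<close>]])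
    have "k x x \<le> (\<Sum>x\<in>F. k x x)"
      using F that pos_def_kernel_diag_nonneg[OF KMpd[OF \<open>k \<in> KM\<close>]] by (intro member_le_sum) auto
    then show "k x x \<le> M" using that by (auto simp: KM_def)
  qed
  have bnd: "\<bar>c i\<bar> \<le> 1 + M" if c: "c \<in> ev ` KM" and i: "i \<in> F <+> E" for c i
  proof -
    obtain k where k: "k \<in> KM" "c = ev k" using c by blast
    show ?thesis
    proof (cases i)
      case (Inl x)
      then have "x \<in> F" using i by auto
      then show ?thesis using dg[OF k(1), of x] Inl k by (simp add: ev_def)
    next
      case (Inr p)
      then have "fst p \<in> F" "snd p \<in> F" using i by (auto simp: E_def)
      then have "\<bar>k (fst p) (snd p)\<bar> \<le> M"
        using pos_def_kernel_le_diag[OF KMpd[OF k(1)], of "fst p" "snd p"] dg[OF k(1), of "fst p"] dg[OF k(1), of "snd p"]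
        by linarith
      then show ?thesis using Inr k e by (simp add: ev_def)
    qed
  qed
  \<comment> \<open>If all constraints held up to \<open>e / 2\<close>, division by
    \<open>1 + e / 2\<close> would restore the diagonal bound and still leave the lower bound
    \<open>1 - 2 * e\<close>. Hence the factor 2 in the hypothesis \<open>no\<close>.\<close>
  have neg: "\<exists>i\<in>F <+> E. c i < - (e / 2)" if c: "c \<in> ev ` KM" for c
  proof (rule ccontr)
    assume "\<not> ?thesis"
    then have ge: "\<And>i. i \<in> F <+> E \<Longrightarrow> - (e / 2) \<le> c i" by force
    obtain k where k: "k \<in> KM" "c = ev k" using c by blast
    then have kK: "k \<in> ?K" by (simp add: KM_def)
    define l where "l = (\<lambda>x y. 1 / (1 + e / 2) * k x y)"
    have l: "l \<in> ?K" unfolding l_def using kK e by (intro local_kernels_scale) auto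
    have "l x x \<le> 1" for x
    proof (cases "x \<in> F")
      case True
      then have "k x x \<le> 1 + e / 2" using ge[OF InlI[OF True]] k by (simp add: ev_def)
      then show ?thesis using e by (simp add: l_def divide_le_eq)
    next
      case False
      then have "l x x = 0" using local_kernels_support[OF l] by blast
      then show ?thesis by simp
    qed
    moreover have "1 - 2 * e \<le> l x y" if "x \<in> F" "y \<in> F" "d x y \<le> ereal R" for x y
    proof -
      have kxy: "1 - e - e / 2 \<le> k x y"
        using ge[OF InrI, of "(x, y)"] k that by (simp add: ev_def E_def)
      have "(1 - 2 * e) * (1 + e / 2) = 1 - e - e / 2 - e * e"
        by (simp add: field_simps)
      also have "\<dots> \<le> k x y" using kxy e by (smt (verit) mult_nonneg_nonneg)
      finally show ?thesis using e by (simp add: l_def le_divide_eq)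
    qed
    moreover have "\<forall>x y. ereal S < d x y \<longrightarrow> l x y = 0"
      using local_kernels_support[OF l] by (meson not_le)
    ultimately have "almost_unit_kernel d F S R (2 * e) l"
      using local_kernels_pos_def[OF l] by (simp add: almost_unit_kernel_def)
    with no show False by blast
  qed
  have KM0: "(\<lambda>_ _. 0) \<in> KM" using M by (simp add: KM_def local_kernels.zero)
  have finFE: "finite (F <+> E)" using F finE by simp
  have ne: "ev ` KM \<noteq> {}" using KM0 by blast
  have e2: "0 < e / 2" using e by simp
  have "\<exists>w. (\<forall>i. 0 \<le> w i) \<and> (\<forall>c\<in>ev ` KM. (\<Sum>i\<in>F <+> E. w i * c i) < 0)"
  proof (rule convex_separation_from_orthant)
    show "finite (F <+> E)" "ev ` KM \<noteq> {}" "0 < e / 2" by fact+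
  qed (fact conv bnd neg)+
  then obtain u where u0: "\<And>i. 0 \<le> u i" and u: "\<And>c. c \<in> ev ` KM \<Longrightarrow> (\<Sum>i\<in>F <+> E. u i * c i) < 0"
    by blast
  define w0 where "w0 x y = (if (x, y) \<in> E then u (Inr (x, y)) else 0)" for x y
  define l0 where "l0 x = u (Inl x)" for x
  define W where "W = (\<Sum>x\<in>F. \<Sum>y\<in>F. w0 x y)"
  have Esum: "(\<Sum>p\<in>E. u (Inr p) * g (fst p) (snd p)) = (\<Sum>x\<in>F. \<Sum>y\<in>F. w0 x y * g x y)" for g
  proof -
    have "(\<Sum>p\<in>E. u (Inr p) * g (fst p) (snd p))
        = (\<Sum>p\<in>F \<times> F. if p \<in> E then u (Inr p) * g (fst p) (snd p) else 0)"
      using F by (simp add: sum.If_cases E_def Int_def conj_commute)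
    also have "\<dots> = (\<Sum>p\<in>F \<times> F. w0 (fst p) (snd p) * g (fst p) (snd p))"
      by (intro sum.cong) (auto simp: w0_def)
    finally show ?thesis by (simp add: sum.cartesian_product case_prod_beta)
  qed
  have key: "(\<Sum>x\<in>F. l0 x) - (\<Sum>x\<in>F. l0 x * k x x) + (\<Sum>x\<in>F. \<Sum>y\<in>F. w0 x y * k x y) - (1 - e) * W < 0"
    if k: "k \<in> KM" for k
  proof -
    have "(\<Sum>i\<in>F <+> E. u i * ev k i)
        = (\<Sum>x\<in>F. l0 x * (1 - k x x)) + (\<Sum>p\<in>E. u (Inr p) * (k (fst p) (snd p) - (1 - e)))"
      using F finE by (simp add: sum.Plus ev_def l0_def)
    also have "(\<Sum>p\<in>E. u (Inr p) * (k (fst p) (snd p) - (1 - e)))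
       = (\<Sum>x\<in>F. \<Sum>y\<in>F. w0 x y * (k x y - (1 - e)))"
      by (rule Esum)
    also have "\<dots> = (\<Sum>x\<in>F. \<Sum>y\<in>F. w0 x y * k x y) - (1 - e) * W"
      by (simp add: W_def right_diff_distrib sum_subtractf sum_distrib_left sum.distrib algebra_simps)
    also have "(\<Sum>x\<in>F. l0 x * (1 - k x x)) = (\<Sum>x\<in>F. l0 x) - (\<Sum>x\<in>F. l0 x * k x x)"
      by (simp add: right_diff_distrib sum_subtractf)
    finally show ?thesis using u[of "ev k"] k by simp
  qed
  have l0: "0 \<le> l0 x" for x by (simp add: l0_def u0)
  have w0: "0 \<le> w0 x y" for x y by (simp add: w0_def u0)
  \<comment> \<open>The zero kernel compares the total masses of the two families of
    weights.\<close>
  have 0: "(\<Sum>x\<in>F. l0 x) < (1 - e) * W" using key[OF KM0] by simp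
  have "0 < (1 - e) * W" using 0 sum_nonneg[of F l0] l0 by force
  then have W: "0 < W" using e by (simp add: zero_less_mult_iff)
  define lam where "lam x = l0 x + (1 - e) * W / M" for x
  define w where "w x y = (w0 x y + w0 y x) / 2" for x y
  have wsum: "(\<Sum>x\<in>F. \<Sum>y\<in>F. w x y * g x y) = (\<Sum>x\<in>F. \<Sum>y\<in>F. w0 x y * g x y)"
    if g: "\<And>x y. g x y = g y x" for g
  proof -
    have "(\<Sum>x\<in>F. \<Sum>y\<in>F. w0 y x * g x y) = (\<Sum>x\<in>F. \<Sum>y\<in>F. w0 x y * g x y)"
      by (subst sum.swap, intro sum.cong refl, simp add: g)
    moreover have "(\<Sum>x\<in>F. \<Sum>y\<in>F. w x y * g x y)
        = ((\<Sum>x\<in>F. \<Sum>y\<in>F. w0 x y * g x y) + (\<Sum>x\<in>F. \<Sum>y\<in>F. w0 y x * g x y)) / 2"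
      by (simp add: w_def sum.distrib[symmetric] sum_divide_distrib add_divide_distrib distrib_right)
    ultimately show ?thesis by simp
  qed
  show ?thesis
  proof (rule that[OF Fne, of lam w])
    show "0 < lam x" for x using l0[of x] W M e by (simp add: lam_def add_nonneg_pos)
    show "0 \<le> w x y" for x y using w0 by (simp add: w_def)
    show "w x y = w y x" for x y by (simp add: w_def)
    show "d x y \<le> ereal R" if "w x y \<noteq> 0" for x y
    proof -
      have "(x, y) \<in> E \<or> (y, x) \<in> E" using that by (auto simp: w_def w0_def split: if_splits)
      then show ?thesis by (auto simp: E_def sym)
    qed
    show "(\<Sum>x\<in>F. lam x) \<le> (1 - e / 2) * (\<Sum>x\<in>F. \<Sum>y\<in>F. w x y)"
    proof -
      have "(\<Sum>x\<in>F. lam x) = (\<Sum>x\<in>F. l0 x) + real (card F) * ((1 - e) * W / M)"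
        by (simp add: lam_def sum.distrib)
      also have "real (card F) * ((1 - e) * W / M) = e / 2 * ((1 - e) * W)"
        using cF e by (simp add: M_def)
      also have "(\<Sum>x\<in>F. l0 x) + e / 2 * ((1 - e) * W) \<le> (1 - e) * W + e / 2 * ((1 - e) * W)"
        using 0 by simp
      also have "\<dots> = ((1 - e / 2) - e * e / 2) * W" by (simp add: field_simps)
      also have "\<dots> \<le> (1 - e / 2) * W" using W e by (intro mult_right_mono) auto
      finally show ?thesis using wsum[of "\<lambda>_ _. 1"] by (simp add: W_def)
    qed
    fix v assume v: "local_vec d F S v"
    define q where "q = (\<Sum>x\<in>F. (v x)\<^sup>2)"
    have w_eq: "(\<Sum>x\<in>F. \<Sum>y\<in>F. w x y * v x * v y) = (\<Sum>x\<in>F. \<Sum>y\<in>F. w0 x y * (v x * v y))"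
      using wsum[of "\<lambda>x y. v x * v y"] by (simp add: mult_ac)
    have lam_eq: "(\<Sum>x\<in>F. lam x * (v x)\<^sup>2) = (\<Sum>x\<in>F. l0 x * (v x)\<^sup>2) + (1 - e) * W / M * q"
      by (simp add: lam_def q_def distrib_right sum.distrib sum_distrib_left)
    show "(\<Sum>x\<in>F. \<Sum>y\<in>F. w x y * v x * v y) \<le> (\<Sum>x\<in>F. lam x * (v x)\<^sup>2)"
    proof (cases "q = 0")
      case True
      then have "\<forall>x\<in>F. v x = 0" using F by (simp add: q_def sum_nonneg_eq_0_iff)
      then show ?thesis by simp
    next
      case False
      then have q: "0 < q" unfolding q_def by (simp add: sum_nonneg less_le)
      \<comment> \<open>Scaling \<open>v\<close> until its rank one kernel has trace exactly
        \<open>M\<close> makes the constant \<open>(1 - e) * W\<close> proportional to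
        \<open>q\<close>, so that it can be absorbed into \<open>lam\<close>.\<close>
      define c where "c = sqrt (M / q)"
      have c2: "(c * a) * (c * b) = M / q * (a * b)" for a b
      proof -
        have "(c * a) * (c * b) = c\<^sup>2 * (a * b)" by (simp add: power2_eq_square mult_ac)
        then show ?thesis using M q by (simp add: c_def)
      qed
      let ?k = "\<lambda>x y. M / q * (v x * v y)"
      have "?k \<in> ?K"
        using local_kernels.add_rank_one[OF local_kernels.zero local_vec_scale[OF v, of c]]
        by (simp add: c2)
      moreover have "(\<Sum>x\<in>F. ?k x x) = M"
      proof -
        have "(\<Sum>x\<in>F. ?k x x) = M / q * (\<Sum>x\<in>F. v x * v x)" by (rule sum_distrib_left[symmetric])
        also have "(\<Sum>x\<in>F. v x * v x) = q" by (simp add: q_def power2_eq_square)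
        finally show ?thesis using q by simp
      qed
      ultimately have "?k \<in> KM" by (simp add: KM_def)
      from key[OF this] have "(\<Sum>x\<in>F. \<Sum>y\<in>F. w0 x y * (M / q * (v x * v y)))
          < (\<Sum>x\<in>F. l0 x * (M / q * (v x * v x))) + (1 - e) * W"
        using sum_nonneg[of F l0] l0 by force
      then have "M / q * (\<Sum>x\<in>F. \<Sum>y\<in>F. w0 x y * (v x * v y))
          < M / q * (\<Sum>x\<in>F. l0 x * (v x)\<^sup>2) + (1 - e) * W"
        by (simp add: sum_distrib_left power2_eq_square mult_ac)
      also have "(1 - e) * W = M / q * ((1 - e) * W / M * q)" using M q by simp
      finally have "M / q * (\<Sum>x\<in>F. \<Sum>y\<in>F. w0 x y * (v x * v y))
          < M / q * (\<Sum>x\<in>F. lam x * (v x)\<^sup>2)" by (simp add: lam_eq distrib_left)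
      moreover have "0 < M / q" using M q by simp
      ultimately have "(\<Sum>x\<in>F. \<Sum>y\<in>F. w0 x y * (v x * v y)) < (\<Sum>x\<in>F. lam x * (v x)\<^sup>2)"
        by (simp only: mult_less_cancel_left_pos)
      then show ?thesis by (simp add: w_eq)
    qed
  qed
qed

subsection \<open>Localised spectral estimates\<close>

lemma
  assumes "ext_metric d"
  shows ext_metric_refl: "d x x = 0" and ext_metric_sym: "d x y = d y x"
    and ext_metric_triangle: "d x z \<le> d x y + d y z"
  using assms unfolding ext_metric_def by blast+

lemma spectral_quadratic_form:
  fixes a :: "'a \<Rightarrow> 'a \<Rightarrow> real"
  assumes "\<And>x y. x \<in> F \<Longrightarrow> y \<in> F \<Longrightarrow> a x y = (\<Sum>i\<in>F. b i * u i x * u i y)"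
  shows "(\<Sum>x\<in>F. \<Sum>y\<in>F. a x y * v x * v y) = (\<Sum>i\<in>F. b i * (\<Sum>x\<in>F. u i x * v x)\<^sup>2)"
proof -
  have "(\<Sum>x\<in>F. \<Sum>y\<in>F. a x y * v x * v y)
      = (\<Sum>x\<in>F. \<Sum>y\<in>F. \<Sum>i\<in>F. b i * ((u i x * v x) * (u i y * v y)))"
    by (intro sum.cong refl) (simp add: assms sum_distrib_left sum_distrib_right mult_ac)
  also have "\<dots> = (\<Sum>x\<in>F. \<Sum>i\<in>F. \<Sum>y\<in>F. b i * ((u i x * v x) * (u i y * v y)))"
    by (rule sum.cong[OF refl], rule sum.swap)
  also have "\<dots> = (\<Sum>i\<in>F. \<Sum>x\<in>F. \<Sum>y\<in>F. b i * ((u i x * v x) * (u i y * v y)))"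
    by (rule sum.swap)
  also have "\<dots> = (\<Sum>i\<in>F. b i * (\<Sum>x\<in>F. u i x * v x)\<^sup>2)"
    unfolding power2_eq_square sum_product by (simp only: sum_distrib_left)
  finally show ?thesis .
qed

lemma orthonormal_basis_on_row:
  "orthonormal_basis_on F u \<Longrightarrow> i \<in> F \<Longrightarrow> j \<in> F \<Longrightarrow> (\<Sum>x\<in>F. u i x * u j x) = (if i = j then 1 else 0)"
  by (simp add: orthonormal_basis_on_def)

lemma orthonormal_basis_on_col:
  "orthonormal_basis_on F u \<Longrightarrow> x \<in> F \<Longrightarrow> y \<in> F \<Longrightarrow> (\<Sum>i\<in>F. u i x * u i y) = (if x = y then 1 else 0)"
  by (simp add: orthonormal_basis_on_def)

lemma orthonormal_basis_on_parseval:
  assumes F: "finite F" and u: "orthonormal_basis_on F u"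
  shows "(\<Sum>i\<in>F. (\<Sum>x\<in>F. u i x * v x)\<^sup>2) = (\<Sum>x\<in>F. (v x)\<^sup>2)"
proof -
  have "(\<Sum>i\<in>F. 1 * (\<Sum>x\<in>F. u i x * v x)\<^sup>2) = (\<Sum>x\<in>F. \<Sum>y\<in>F. (if x = y then 1 else 0) * v x * v y)"
    by (rule spectral_quadratic_form[symmetric]) (simp add: orthonormal_basis_on_col[OF u])
  also have "\<dots> = (\<Sum>x\<in>F. (v x)\<^sup>2)"
  proof (rule sum.cong[OF refl])
    fix x assume "x \<in> F"
    have "(\<Sum>y\<in>F. (if x = y then 1 else 0) * v x * v y) = (\<Sum>y\<in>F. if x = y then v x * v y else 0)"
      by (intro sum.cong) auto
    then show "(\<Sum>y\<in>F. (if x = y then 1 else 0) * v x * v y) = (v x)\<^sup>2"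
      using F \<open>x \<in> F\<close> by (simp add: power2_eq_square)
  qed
  finally show ?thesis by simp
qed

lemma orthonormal_basis_on_coeff:
  assumes F: "finite F" and u: "orthonormal_basis_on F u" and i: "i \<in> F"
  shows "(\<Sum>y\<in>F. u i y * (\<Sum>j\<in>F. g j * u j y)) = g i"
proof -
  have "(\<Sum>y\<in>F. u i y * (\<Sum>j\<in>F. g j * u j y)) = (\<Sum>y\<in>F. \<Sum>j\<in>F. g j * (u i y * u j y))"
    by (simp add: sum_distrib_left mult_ac)
  also have "\<dots> = (\<Sum>j\<in>F. \<Sum>y\<in>F. g j * (u i y * u j y))" by (rule sum.swap)
  also have "\<dots> = (\<Sum>j\<in>F. if i = j then g j else 0)"
    by (intro sum.cong refl)
       (simp add: sum_distrib_left[symmetric] orthonormal_basis_on_row[OF u i])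
  also have "\<dots> = g i" using F i by simp
  finally show ?thesis .
qed

text \<open>The sum with \<open>b i ^ j\<close> is the matrix of the \<open>j\<close>-th power. The
  zeroth power is the identity by completeness, and each further factor moves the support by at most
  \<open>R\<close>.\<close>

lemma spectral_power_support:
  assumes F: "finite F" and u: "orthonormal_basis_on F u" and d: "ext_metric d"
    and supp: "\<And>x y. x \<in> F \<Longrightarrow> y \<in> F \<Longrightarrow> (\<Sum>i\<in>F. b i * u i x * u i y) \<noteq> 0 \<Longrightarrow> d x y \<le> ereal R"
    and xy: "x \<in> F" "y \<in> F" "(\<Sum>i\<in>F. b i ^ j * u i x * u i y) \<noteq> 0"
  shows "d x y \<le> ereal (real j * R)"
  using xy
proof (induction j arbitrary: y)
  case 0
  then have "x = y" using orthonormal_basis_on_col[OF u, of x y] by (auto split: if_splits)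
  then show ?case by (simp add: ext_metric_refl[OF d])
next
  case (Suc j)
  have "(\<Sum>i\<in>F. b i ^ Suc j * u i x * u i y)
      = (\<Sum>i\<in>F. b i ^ j * u i x * (\<Sum>z\<in>F. u i z * (\<Sum>k\<in>F. (b k * u k y) * u k z)))"
  proof (rule sum.cong[OF refl])
    fix i assume i: "i \<in> F"
    show "b i ^ Suc j * u i x * u i y
        = b i ^ j * u i x * (\<Sum>z\<in>F. u i z * (\<Sum>k\<in>F. (b k * u k y) * u k z))"
      unfolding orthonormal_basis_on_coeff[OF F u i, of "\<lambda>k. b k * u k y"] by simp
  qed
  also have "\<dots> = (\<Sum>i\<in>F. \<Sum>z\<in>F. (b i ^ j * u i x * u i z) * (\<Sum>k\<in>F. b k * u k z * u k y))"
    by (simp add: sum_distrib_left mult_ac)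
  also have "\<dots> = (\<Sum>z\<in>F. \<Sum>i\<in>F. (b i ^ j * u i x * u i z) * (\<Sum>k\<in>F. b k * u k z * u k y))"
    by (rule sum.swap)
  also have "\<dots> = (\<Sum>z\<in>F. (\<Sum>i\<in>F. b i ^ j * u i x * u i z) * (\<Sum>k\<in>F. b k * u k z * u k y))"
    by (simp add: sum_distrib_right)
  finally have "(\<Sum>z\<in>F. (\<Sum>i\<in>F. b i ^ j * u i x * u i z) * (\<Sum>k\<in>F. b k * u k z * u k y)) \<noteq> 0"
    using Suc.prems(3) by simp
  then obtain z where z: "z \<in> F" "(\<Sum>i\<in>F. b i ^ j * u i x * u i z) * (\<Sum>k\<in>F. b k * u k z * u k y) \<noteq> 0"
    by (rule sum.not_neutral_contains_not_neutral)
  then have "d x z \<le> ereal (real j * R)" "d z y \<le> ereal R"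
    using Suc.IH[of z] supp[of z y] Suc.prems by auto
  then have "d x z + d z y \<le> ereal (real j * R) + ereal R" by (rule add_mono)
  moreover have "d x y \<le> d x z + d z y" by (rule ext_metric_triangle[OF d])
  ultimately show ?case by (simp add: algebra_simps)
qed

text \<open>The moments \<open>m j\<close> of the spectral measure at \<open>z\<close> satisfy \<open>m (2*j+1) \<le> \<kappa> * m (2*j)\<close> as long as the
  \<open>j\<close>-th power of the matrix applied to the point mass at \<open>z\<close> is a local vector; log-convexity then
  gives \<open>m (2*j) \<le> \<kappa> ^ (2*j)\<close>.\<close>

lemma spectral_tail_bound:
  fixes d :: "'a \<Rightarrow> 'a \<Rightarrow> ereal"
  assumes F: "finite F" and u: "orthonormal_basis_on F u" and d: "ext_metric d"
    and b: "\<And>i. i \<in> F \<Longrightarrow> 0 \<le> b i"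
    and supp: "\<And>x y. x \<in> F \<Longrightarrow> y \<in> F \<Longrightarrow> (\<Sum>i\<in>F. b i * u i x * u i y) \<noteq> 0 \<Longrightarrow> d x y \<le> ereal R"
    and loc: "\<And>v. local_vec d F S v \<Longrightarrow>
      (\<Sum>i\<in>F. b i * (\<Sum>x\<in>F. u i x * v x)\<^sup>2) \<le> \<kappa> * (\<Sum>x\<in>F. (v x)\<^sup>2)"
    and S: "2 * (real J * R) \<le> S" and R: "0 \<le> R" and \<kappa>: "0 \<le> \<kappa>" and z: "z \<in> F" and s: "0 < s"
  shows "(\<Sum>i | i \<in> F \<and> s \<le> b i. (u i z)\<^sup>2) \<le> (\<kappa> / s) ^ (2 * J)"
proof -
  define m where "m j = (\<Sum>i\<in>F. b i ^ j * (u i z)\<^sup>2)" for j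
  have m0: "0 \<le> m j" for j unfolding m_def using b by (intro sum_nonneg) auto
  have odd: "m (2 * j + 1) \<le> \<kappa> * m (2 * j)" if j: "j \<le> J" for j
  proof -
    \<comment> \<open>The \<open>j\<close>-th power applied to the point mass at \<open>z\<close>.
      It lives within distance \<open>j * R\<close> of \<open>z\<close>, hence on a set of diameter
      at most \<open>S\<close>.\<close>
    define v where "v y = (if y \<in> F then (\<Sum>i\<in>F. (b i ^ j * u i z) * u i y) else 0)" for y
    have near: "d z y \<le> ereal (real j * R)" if "v y \<noteq> 0" for y
      using that spectral_power_support[OF F u d supp z, where y = y and j = j]
      by (auto simp: v_def split: if_splits)
    have "local_vec d F S v"
      unfolding local_vec_def
    proof (intro conjI allI impI)
      fix x y assume xy: "v x \<noteq> 0" "v y \<noteq> 0"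
      have "d x y \<le> d x z + d z y" by (rule ext_metric_triangle[OF d])
      also have "d x z = d z x" by (rule ext_metric_sym[OF d])
      also have "d z x + d z y \<le> ereal (real j * R) + ereal (real j * R)"
        using near[OF xy(1)] near[OF xy(2)] by (rule add_mono)
      also have "\<dots> \<le> ereal S"
      proof -
        have "real j * R \<le> real J * R" using j R by (intro mult_right_mono) auto
        then have "real j * R + real j * R \<le> S" using S by linarith
        then show ?thesis by simp
      qed
      finally show "d x y \<le> ereal S" .
    qed (auto simp: v_def split: if_splits)
    note loc[OF this]
    moreover have c: "(\<Sum>x\<in>F. u i x * v x) = b i ^ j * u i z" if "i \<in> F" for i
      using orthonormal_basis_on_coeff[OF F u that, of "\<lambda>i. b i ^ j * u i z"] by (simp add: v_def)
    moreover have "(\<Sum>x\<in>F. (v x)\<^sup>2) = m (2 * j)"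
    proof -
      have "(\<Sum>x\<in>F. (v x)\<^sup>2) = (\<Sum>i\<in>F. (\<Sum>x\<in>F. u i x * v x)\<^sup>2)"
        by (rule orthonormal_basis_on_parseval[OF F u, symmetric])
      also have "\<dots> = m (2 * j)"
        unfolding m_def by (intro sum.cong refl) (simp add: c power_mult_distrib power_even_eq)
      finally show ?thesis .
    qed
    moreover have "(\<Sum>i\<in>F. b i * (\<Sum>x\<in>F. u i x * v x)\<^sup>2) = m (2 * j + 1)"
      unfolding m_def
      by (intro sum.cong refl) (simp add: c power_mult_distrib power_even_eq)
    ultimately show ?thesis by simp
  qed
  have even: "m (2 * j) \<le> \<kappa> ^ (2 * j)" if "j \<le> J" for j
    using that
  proof (induction j)
    case 0
    then show ?case using orthonormal_basis_on_col[OF u z z] by (simp add: m_def power2_eq_square)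
  next
    case (Suc j)
    \<comment> \<open>Half-integral powers of the eigenvalues let Cauchy-Schwarz bound the square of
      an even moment by the product of its two odd neighbours, to which \<open>odd\<close>
      applies.\<close>
    let ?r = "\<lambda>i. sqrt (b i)"
    have r: "?r i ^ (2 * k) = b i ^ k" if "i \<in> F" for i k
      using b[OF that] by (simp add: power_mult)
    have "(m (2 * Suc j))\<^sup>2 = (\<Sum>i\<in>F. (?r i ^ (2 * j + 1) * u i z) * (?r i ^ (2 * j + 3) * u i z))\<^sup>2"
    proof -
      have "b i ^ (2 * Suc j) * (u i z)\<^sup>2 = (?r i ^ (2 * j + 1) * u i z) * (?r i ^ (2 * j + 3) * u i z)"
        if "i \<in> F" for i
      proof -
        have "?r i ^ (2 * j + 1) * ?r i ^ (2 * j + 3) = ?r i ^ (2 * (2 * Suc j))"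
          by (subst power_add[symmetric]) (rule arg_cong[where f = "\<lambda>n. ?r i ^ n"], simp)
        also have "\<dots> = b i ^ (2 * Suc j)" by (rule r[OF that])
        finally have "b i ^ (2 * Suc j) * (u i z)\<^sup>2 = (?r i ^ (2 * j + 1) * ?r i ^ (2 * j + 3)) * (u i z)\<^sup>2"
          by (simp only:)
        then show ?thesis by (simp only: power2_eq_square mult_ac)
      qed
      then show ?thesis unfolding m_def by (simp cong: sum.cong)
    qed
    also have "\<dots> \<le> (\<Sum>i\<in>F. (?r i ^ (2 * j + 1) * u i z)\<^sup>2) * (\<Sum>i\<in>F. (?r i ^ (2 * j + 3) * u i z)\<^sup>2)"
      by (rule Cauchy_Schwarz_ineq_sum)
    also have "\<dots> = m (2 * j + 1) * m (2 * Suc j + 1)"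
    proof -
      have "(?r i ^ k * u i z)\<^sup>2 = b i ^ k * (u i z)\<^sup>2" if "i \<in> F" for i k
        using r[OF that, of k] by (simp add: power_mult_distrib power_even_eq)
      then have eq: "(\<Sum>i\<in>F. (?r i ^ k * u i z)\<^sup>2) = m k" for k
        unfolding m_def by (intro sum.cong refl)
      have "2 * Suc j + 1 = 2 * j + 3" by simp
      then show ?thesis by (simp only: eq)
    qed
    also have "\<dots> \<le> (\<kappa> * m (2 * j)) * (\<kappa> * m (2 * Suc j))"
      using odd[of j] odd[of "Suc j"] Suc.prems m0 \<kappa> by (intro mult_mono) auto
    also have "\<dots> \<le> (\<kappa> * \<kappa> ^ (2 * j)) * (\<kappa> * m (2 * Suc j))"
      using Suc m0 \<kappa> by (intro mult_right_mono mult_left_mono) auto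
    also have "\<dots> = \<kappa> ^ (2 * Suc j) * m (2 * Suc j)" by simp
    finally have "m (2 * Suc j) * m (2 * Suc j) \<le> \<kappa> ^ (2 * Suc j) * m (2 * Suc j)"
      by (simp add: power2_eq_square)
    then show ?case
      using m0[of "2 * Suc j"] \<kappa> by (cases "m (2 * Suc j) = 0") (auto simp: mult_le_cancel_right)
  qed
  \<comment> \<open>Markov's inequality for the moment of order \<open>2 * J\<close>.\<close>
  have "s ^ (2 * J) * (\<Sum>i | i \<in> F \<and> s \<le> b i. (u i z)\<^sup>2)
      \<le> (\<Sum>i | i \<in> F \<and> s \<le> b i. b i ^ (2 * J) * (u i z)\<^sup>2)"
    unfolding sum_distrib_left using s by (intro sum_mono mult_right_mono power_mono) auto
  also have "\<dots> \<le> m (2 * J)" unfolding m_def using F b by (intro sum_mono2) auto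
  also have "\<dots> \<le> \<kappa> ^ (2 * J)" by (rule even) simp
  finally show ?thesis using s by (simp add: power_divide pos_le_divide_eq mult.commute)
qed

text \<open>The two constants are the images of \<open>1 / (1 - e / 2)\<close>, the global lower
  bound, and of 1, the local upper bound, under the map \<open>t\<close> to
  \<open>(t + N) / (2 * N)\<close> that turns \<open>a\<close> into a positive contraction.\<close>

lemma spectral_block_of_no_kernel:
  fixes d :: "'a \<Rightarrow> 'a \<Rightarrow> ereal" and N :: real
  assumes F: "finite F" and d: "ext_metric d" and e: "0 < e" "e < 1" and R: "0 \<le> R" "R \<le> S"
    and N: "1 \<le> N" "\<And>x. real (card {y \<in> F. d x y \<le> ereal R}) \<le> N"
    and J: "2 * (real J * R) \<le> S"
    and no: "\<nexists>k. almost_unit_kernel d F S R (2 * e) k"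
  obtains u b where "orthonormal_basis_on F u" "\<And>i. i \<in> F \<Longrightarrow> 0 \<le> b i \<and> b i \<le> 1"
    "\<And>x y. x \<in> F \<Longrightarrow> y \<in> F \<Longrightarrow> (\<Sum>i\<in>F. b i * u i x * u i y) \<noteq> 0 \<Longrightarrow> d x y \<le> ereal R"
    "\<exists>i\<in>F. (N + 1 / (1 - e / 2)) / (2 * N) \<le> b i"
    "\<And>x s. x \<in> F \<Longrightarrow> 0 < s \<Longrightarrow>
      (\<Sum>i | i \<in> F \<and> s \<le> b i. (u i x)\<^sup>2) \<le> ((N + 1) / (2 * N) / s) ^ (2 * J)"
proof -
  have dsym: "d x y = d y x" and d0: "d x x = 0" for x y
    using ext_metric_sym[OF d] ext_metric_refl[OF d] by auto
  obtain lam w where Fne: "F \<noteq> {}" and lam: "\<And>x. x \<in> F \<Longrightarrow> 0 < lam x" and w0: "\<And>x y. 0 \<le> w x y"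
    and wsym: "\<And>x y. w x y = w y x" and wsupp: "\<And>x y. w x y \<noteq> 0 \<Longrightarrow> d x y \<le> ereal R"
    and lamW: "(\<Sum>x\<in>F. lam x) \<le> (1 - e / 2) * (\<Sum>x\<in>F. \<Sum>y\<in>F. w x y)"
    and wloc: "\<And>v. local_vec d F S v \<Longrightarrow>
      (\<Sum>x\<in>F. \<Sum>y\<in>F. w x y * v x * v y) \<le> (\<Sum>x\<in>F. lam x * (v x)\<^sup>2)"
    by (rule weights_of_no_kernel[OF F e dsym no]) blast
  \<comment> \<open>Normalising by \<open>lam\<close> turns the local inequality into a local norm bound \<open>1\<close> for \<open>a\<close>, while the
    vector \<open>s\<close> witnesses a global norm of at least \<open>1 / (1 - e / 2)\<close>. Adding \<open>N\<close> makes it positive.\<close>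
  define s where "s x = sqrt (lam x)" for x
  have s: "0 < s x" "s x * s x = lam x" if "x \<in> F" for x
    using lam[OF that] by (auto simp: s_def)
  define a where "a x y = w x y / (s x * s y)" for x y
  define T where "T x y = (a x y + (if x = y then N else 0)) / (2 * N)" for x y
  have asym: "a x y = a y x" for x y by (simp add: a_def wsym[of x y] mult.commute)
  have a0: "0 \<le> a x y" if "x \<in> F" "y \<in> F" for x y
    using s(1)[OF that(1)] s(1)[OF that(2)] w0 by (simp add: a_def)
  have asupp: "d x y \<le> ereal R" if "a x y \<noteq> 0" for x y
    using wsupp[of x y] that by (auto simp: a_def)
  \<comment> \<open>The local inequality at the vector \<open>1 / s\<close> on the set
    \<open>{x, y}\<close>: its right side is the number of points, and since the weights are
    nonnegative all other terms on the left may be dropped.\<close>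
  have a1: "a x y \<le> 1" if xy: "x \<in> F" "y \<in> F" for x y
  proof (cases "a x y = 0")
    case False
    then have dxy: "d x y \<le> ereal S" using asupp[OF False] R(2) by (meson ereal_less_eq(3) order_trans)
    define v where "v z = (if z \<in> {x, y} then 1 / s z else 0)" for z
    have S0: "0 \<le> S" using R by simp
    have "local_vec d F S v"
      using xy dxy dsym[of y x] d0 S0 by (auto simp: local_vec_def v_def split: if_splits)
    note wloc[OF this]
    also have "(\<Sum>z\<in>F. lam z * (v z)\<^sup>2) = (\<Sum>z\<in>F. if z \<in> {x, y} then 1 else 0)"
      using s lam by (intro sum.cong refl) (auto simp: v_def power2_eq_square less_imp_neq[symmetric])
    also have "\<dots> = real (card {x, y})"
    proof -
      have "F \<inter> {z. z \<in> {x, y}} = {x, y}" using xy by auto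
      then show ?thesis using F by (simp only: sum.If_cases) simp
    qed
    finally have up: "(\<Sum>z\<in>F. \<Sum>z'\<in>F. w z z' * v z * v z') \<le> real (card {x, y})" .
    have v0: "0 \<le> v z" if "z \<in> F" for z using s(1)[OF that] by (simp add: v_def)
    have "(\<Sum>p\<in>{(x, y), (y, x)}. w (fst p) (snd p) * v (fst p) * v (snd p))
      \<le> (\<Sum>p\<in>F \<times> F. w (fst p) (snd p) * v (fst p) * v (snd p))"
      using F xy w0 v0 by (intro sum_mono2) auto
    also have "\<dots> = (\<Sum>z\<in>F. \<Sum>z'\<in>F. w z z' * v z * v z')"
      by (simp add: sum.cartesian_product case_prod_beta)
    also note up
    finally have "(\<Sum>p\<in>{(x, y), (y, x)}. w (fst p) (snd p) * v (fst p) * v (snd p)) \<le> real (card {x, y})" .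
    moreover have "w x y * v x * v y = a x y" by (simp add: v_def a_def)
    moreover have "w y x * v y * v x = a x y" by (simp add: v_def a_def wsym[of y x])
    ultimately show ?thesis by (cases "x = y") auto
  qed simp
  have rowsum: "(\<Sum>y\<in>F. a x y) \<le> N" if x: "x \<in> F" for x
  proof -
    have "(\<Sum>y\<in>F. a x y) \<le> (\<Sum>y\<in>F. if d x y \<le> ereal R then 1 else 0)"
      using a1[OF x] asupp[of x] by (intro sum_mono) force
    also have "\<dots> = real (card {y \<in> F. d x y \<le> ereal R})"
      using F by (simp add: sum.If_cases Int_def)
    finally show ?thesis using N(2)[of x] by simp
  qed
  \<comment> \<open>Schur test: the matrix is symmetric and nonnegative with row sums at most
    \<open>N\<close>.\<close>
  have schur: "\<bar>\<Sum>x\<in>F. \<Sum>y\<in>F. a x y * v x * v y\<bar> \<le> N * (\<Sum>x\<in>F. (v x)\<^sup>2)" for v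
  proof -
    have A: "(\<Sum>x\<in>F. \<Sum>y\<in>F. a x y * (v x)\<^sup>2) \<le> N * (\<Sum>x\<in>F. (v x)\<^sup>2)"
      unfolding sum_distrib_left sum_distrib_right[symmetric]
      using rowsum by (intro sum_mono mult_right_mono) auto
    have B: "(\<Sum>x\<in>F. \<Sum>y\<in>F. a x y * (v y)\<^sup>2) \<le> N * (\<Sum>x\<in>F. (v x)\<^sup>2)"
      using A by (subst sum.swap) (simp add: asym)
    have "\<bar>\<Sum>x\<in>F. \<Sum>y\<in>F. a x y * v x * v y\<bar> \<le> (\<Sum>x\<in>F. \<Sum>y\<in>F. \<bar>a x y * v x * v y\<bar>)"
      by (rule order_trans[OF sum_abs]) (intro sum_mono sum_abs)
    also have "\<dots> \<le> (\<Sum>x\<in>F. \<Sum>y\<in>F. (a x y * (v x)\<^sup>2 + a x y * (v y)\<^sup>2) / 2)"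
    proof (intro sum_mono)
      fix x y assume xy: "x \<in> F" "y \<in> F"
      have "2 * \<bar>v x * v y\<bar> \<le> (v x)\<^sup>2 + (v y)\<^sup>2"
        using sum_squares_bound[of "\<bar>v x\<bar>" "\<bar>v y\<bar>"] by (simp add: abs_mult)
      then have "a x y * (2 * \<bar>v x * v y\<bar>) \<le> a x y * ((v x)\<^sup>2 + (v y)\<^sup>2)"
        using a0[OF xy] by (rule mult_left_mono)
      then show "\<bar>a x y * v x * v y\<bar> \<le> (a x y * (v x)\<^sup>2 + a x y * (v y)\<^sup>2) / 2"
        using a0[OF xy] by (simp add: abs_mult distrib_left mult_ac)
    qed
    also have "\<dots> = ((\<Sum>x\<in>F. \<Sum>y\<in>F. a x y * (v x)\<^sup>2) + (\<Sum>x\<in>F. \<Sum>y\<in>F. a x y * (v y)\<^sup>2)) / 2"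
      by (simp add: sum.distrib sum_divide_distrib add_divide_distrib)
    also have "\<dots> \<le> (N * (\<Sum>x\<in>F. (v x)\<^sup>2) + N * (\<Sum>x\<in>F. (v x)\<^sup>2)) / 2"
      using A B by (intro divide_right_mono add_mono) auto
    finally show ?thesis by simp
  qed
  have Tform: "(\<Sum>x\<in>F. \<Sum>y\<in>F. T x y * v x * v y)
      = ((\<Sum>x\<in>F. \<Sum>y\<in>F. a x y * v x * v y) + N * (\<Sum>x\<in>F. (v x)\<^sup>2)) / (2 * N)" for v
  proof -
    have "(\<Sum>y\<in>F. T x y * v x * v y) = ((\<Sum>y\<in>F. a x y * v x * v y) + N * (v x)\<^sup>2) / (2 * N)"
      if "x \<in> F" for x
    proof -
      have "T x y * v x * v y = a x y * v x * v y / (2 * N) + (if x = y then N * (v x)\<^sup>2 / (2 * N) else 0)" for y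
        by (simp add: T_def add_divide_distrib distrib_right power2_eq_square)
      then show ?thesis using F that by (simp add: sum.distrib sum_divide_distrib add_divide_distrib)
    qed
    then show ?thesis by (simp add: sum.distrib sum_divide_distrib add_divide_distrib sum_distrib_left)
  qed
  have Tsym: "T x y = T y x" for x y by (simp add: T_def asym[of x y])
  obtain u b where u: "orthonormal_basis_on F u"
    and T: "\<And>x y. x \<in> F \<Longrightarrow> y \<in> F \<Longrightarrow> T x y = (\<Sum>i\<in>F. b i * u i x * u i y)"
    by (rule symmetric_diagonalization[OF F, of T]) (use Tsym in blast)+
  have quad: "(\<Sum>x\<in>F. \<Sum>y\<in>F. T x y * v x * v y) = (\<Sum>i\<in>F. b i * (\<Sum>x\<in>F. u i x * v x)\<^sup>2)" for v
    by (rule spectral_quadratic_form) (rule T)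
  \<comment> \<open>An eigenvalue is the value of the form at its eigenvector, and there the form of
    \<open>a\<close> lies between \<open>- N\<close> and \<open>N\<close>.\<close>
  have b: "0 \<le> b i \<and> b i \<le> 1" if i: "i \<in> F" for i
  proof -
    have "(\<Sum>x\<in>F. \<Sum>y\<in>F. T x y * u i x * u i y) = (\<Sum>j\<in>F. if i = j then b j else 0)"
      unfolding quad using orthonormal_basis_on_row[OF u _ i] by (intro sum.cong) auto
    then have "b i = (\<Sum>x\<in>F. \<Sum>y\<in>F. T x y * u i x * u i y)" using F i by simp
    also have "\<dots> = ((\<Sum>x\<in>F. \<Sum>y\<in>F. a x y * u i x * u i y) + N) / (2 * N)"
      using orthonormal_basis_on_row[OF u i i] by (simp add: Tform power2_eq_square)
    finally have bi: "b i = ((\<Sum>x\<in>F. \<Sum>y\<in>F. a x y * u i x * u i y) + N) / (2 * N)" .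
    have "\<bar>\<Sum>x\<in>F. \<Sum>y\<in>F. a x y * u i x * u i y\<bar> \<le> N"
      using schur[of "u i"] orthonormal_basis_on_row[OF u i i] by (simp add: power2_eq_square)
    then show ?thesis using N(1) by (simp add: bi divide_le_eq)
  qed
  have supp: "d x y \<le> ereal R" if "x \<in> F" "y \<in> F" "(\<Sum>i\<in>F. b i * u i x * u i y) \<noteq> 0" for x y
  proof -
    have "x = y \<or> a x y \<noteq> 0" using that T[of x y] by (auto simp: T_def split: if_splits)
    then show ?thesis using asupp[of x y] d0[of x] R by auto
  qed
  have sN: "0 < 1 - e / 2" using e by simp
  \<comment> \<open>Rayleigh quotient at \<open>s\<close>: there the form of \<open>a\<close> is the
    total weight, and the squared norm is the sum of \<open>lam\<close>. If all eigenvalues were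
    below the bound, \<open>s\<close> would have to vanish.\<close>
  have top: "\<exists>i\<in>F. (N + 1 / (1 - e / 2)) / (2 * N) \<le> b i"
  proof (rule ccontr)
    let ?k = "(N + 1 / (1 - e / 2)) / (2 * N)"
    let ?c = "\<lambda>i. \<Sum>x\<in>F. u i x * s x"
    assume "\<not> ?thesis"
    then have lt: "b i < ?k" if "i \<in> F" for i using that by force
    have lamsum: "(\<Sum>x\<in>F. (s x)\<^sup>2) = (\<Sum>x\<in>F. lam x)"
      using s by (intro sum.cong) (auto simp: power2_eq_square)
    have W: "(\<Sum>x\<in>F. \<Sum>y\<in>F. a x y * s x * s y) = (\<Sum>x\<in>F. \<Sum>y\<in>F. w x y)"
      using s(1) by (intro sum.cong refl) (simp add: a_def less_imp_neq[symmetric])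
    have "(\<Sum>x\<in>F. lam x) / (1 - e / 2) \<le> (\<Sum>x\<in>F. \<Sum>y\<in>F. w x y)"
      using lamW sN by (simp add: pos_divide_le_eq mult.commute)
    then have "((\<Sum>x\<in>F. lam x) / (1 - e / 2) + N * (\<Sum>x\<in>F. lam x)) / (2 * N)
        \<le> ((\<Sum>x\<in>F. \<Sum>y\<in>F. w x y) + N * (\<Sum>x\<in>F. lam x)) / (2 * N)"
      using N(1) by (intro divide_right_mono add_right_mono) auto
    moreover have "?k * (\<Sum>x\<in>F. lam x) = ((\<Sum>x\<in>F. lam x) / (1 - e / 2) + N * (\<Sum>x\<in>F. lam x)) / (2 * N)"
      by (simp only: times_divide_eq_left distrib_right) simp
    ultimately have "?k * (\<Sum>x\<in>F. lam x) \<le> ((\<Sum>x\<in>F. \<Sum>y\<in>F. w x y) + N * (\<Sum>x\<in>F. lam x)) / (2 * N)"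
      by (simp only:)
    also have "\<dots> = (\<Sum>i\<in>F. b i * (?c i)\<^sup>2)"
      unfolding quad[symmetric] Tform W lamsum ..
    finally have "?k * (\<Sum>i\<in>F. (?c i)\<^sup>2) \<le> (\<Sum>i\<in>F. b i * (?c i)\<^sup>2)"
      by (simp only: orthonormal_basis_on_parseval[OF F u] lamsum)
    then have le0: "(\<Sum>i\<in>F. (?k - b i) * (?c i)\<^sup>2) \<le> 0"
      by (simp add: left_diff_distrib sum_subtractf sum_distrib_left)
    have nn: "0 \<le> (?k - b i) * (?c i)\<^sup>2" if "i \<in> F" for i
      using lt[OF that] by (intro mult_nonneg_nonneg) auto
    have "(\<Sum>i\<in>F. (?k - b i) * (?c i)\<^sup>2) = 0"
      using le0 sum_nonneg[of F "\<lambda>i. (?k - b i) * (?c i)\<^sup>2"] nn by force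
    then have "\<forall>i\<in>F. (?k - b i) * (?c i)\<^sup>2 = 0"
      using sum_nonneg_eq_0_iff[OF F, of "\<lambda>i. (?k - b i) * (?c i)\<^sup>2"] nn by blast
    then have "\<forall>i\<in>F. ?c i = 0" using lt by force
    then have "(\<Sum>x\<in>F. lam x) = 0"
      using orthonormal_basis_on_parseval[OF F u, of s] lamsum by simp
    moreover have "0 < (\<Sum>x\<in>F. lam x)" using F Fne lam by (intro sum_pos) auto
    ultimately show False by simp
  qed
  have loc: "(\<Sum>i\<in>F. b i * (\<Sum>x\<in>F. u i x * v x)\<^sup>2) \<le> (N + 1) / (2 * N) * (\<Sum>x\<in>F. (v x)\<^sup>2)"
    if v: "local_vec d F S v" for v
  proof -
    let ?v = "\<lambda>x. v x / s x"
    have "local_vec d F S ?v" using v by (simp add: local_vec_def)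
    note wloc[OF this]
    also have "(\<Sum>x\<in>F. lam x * (v x / s x)\<^sup>2) = (\<Sum>x\<in>F. (v x)\<^sup>2)"
      using s lam by (intro sum.cong refl)
        (simp add: power_divide power2_eq_square[of "s _"] less_imp_neq[symmetric])
    also have "(\<Sum>x\<in>F. \<Sum>y\<in>F. w x y * (v x / s x) * (v y / s y))
        = (\<Sum>x\<in>F. \<Sum>y\<in>F. a x y * v x * v y)"
      by (simp add: a_def)
    finally have "(\<Sum>x\<in>F. \<Sum>y\<in>F. a x y * v x * v y) \<le> (\<Sum>x\<in>F. (v x)\<^sup>2)" .
    then show ?thesis
      unfolding quad[symmetric] Tform using N(1) by (simp add: field_simps)
  qed
  show ?thesis
  proof (rule that[OF u b supp top])
    fix x :: 'a and t :: real assume "x \<in> F" "0 < t"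
    then show "(\<Sum>i | i \<in> F \<and> t \<le> b i. (u i x)\<^sup>2) \<le> ((N + 1) / (2 * N) / t) ^ (2 * J)"
      using N(1) b by (intro spectral_tail_bound[OF F u d _ supp loc J R(1)]) auto
  qed
qed

subsection \<open>Obstructions to property A on disjoint finite sets\<close>

lemma ext_metric_nonneg: "ext_metric d \<Longrightarrow> 0 \<le> d x y"
  unfolding ext_metric_def by blast

text \<open>A tent of slope \<open>1 / L\<close>. The case distinction also guards against infinite
  distances, which \<open>real_of_ereal\<close> sends to 0 and which would otherwise get the value
  1.\<close>

definition bump :: "('a \<Rightarrow> 'a \<Rightarrow> ereal) \<Rightarrow> 'a \<Rightarrow> real \<Rightarrow> 'a \<Rightarrow> real" where
  "bump d z L x = (if d z x \<le> ereal L then 1 - real_of_ereal (d z x) / L else 0)"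

lemma bump_range:
  assumes d: "ext_metric d" and L: "0 < L"
  shows "0 \<le> bump d z L x" "bump d z L x \<le> 1"
proof -
  have "0 \<le> d z x" by (rule ext_metric_nonneg[OF d])
  then show "0 \<le> bump d z L x" "bump d z L x \<le> 1"
    using L by (cases "d z x"; simp add: bump_def)+
qed

lemma bump_lipschitz:
  assumes d: "ext_metric d" and L: "0 < L" and xy: "d x y \<le> ereal R"
  shows "\<bar>bump d z L x - bump d z L y\<bar> \<le> R / L"
proof -
  have *: "bump d z L x - bump d z L y \<le> R / L" if xy: "d x y \<le> ereal R" for x y
  proof -
    have tri: "d z y \<le> d z x + d x y" by (rule ext_metric_triangle[OF d])
    have R0: "0 \<le> R" using xy ext_metric_nonneg[OF d, of x y] by (metis ereal_less_eq(5) order_trans)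
    have nn: "0 \<le> d z x" "0 \<le> d z y" "0 \<le> d x y" by (rule ext_metric_nonneg[OF d])+
    show ?thesis
    proof (cases "d z x \<le> ereal L")
      case False
      then show ?thesis using bump_range(1)[OF d L, of z y] R0 L
        by (simp add: bump_def[of d z L x]) (smt (verit) divide_nonneg_pos)
    next
      case True
      then obtain p where p: "d z x = ereal p" using nn by (cases "d z x") auto
      obtain r where r: "d x y = ereal r" using xy nn by (cases "d x y") auto
      obtain q where q: "d z y = ereal q" using tri p r nn by (cases "d z y") auto
      have "q \<le> p + R" "p \<le> L" using tri True xy by (auto simp: p q r)
      moreover have h: "c / L - p / L \<le> R / L" if "c - p \<le> R" for c
        using L that by (simp add: diff_divide_distrib[symmetric] divide_right_mono)
      ultimately show ?thesis using L h[of q] h[of L] by (auto simp: bump_def p q)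
    qed
  qed
  have "d y x \<le> ereal R" using xy ext_metric_sym[OF d, of y x] by simp
  then show ?thesis using *[OF xy] *[of y x] by linarith
qed

text \<open>A slowly varying partition of unity \<open>f\<^sup>2 + g\<^sup>2 = 1\<close>, with \<open>f\<close> a bump around \<open>z\<close>, glues \<open>k\<close> to the
  rank one kernel of \<open>f\<close>.\<close>

lemma almost_unit_kernel_insert:
  assumes d: "ext_metric d" and R: "0 < R" and e0: "0 \<le> e" and k: "almost_unit_kernel d (Y - {z}) S R e k" and e: "e < e'"
  shows "\<exists>S' k'. almost_unit_kernel d Y S' R e' k'"
proof -
  \<comment> \<open>The second bound limits the loss in the lower bound to \<open>e' - e\<close>;
    the first makes \<open>R / L\<close> at most 1, so that its square may be replaced by
    itself.\<close>
  define L where "L = max R (2 * R / (e' - e))"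
  have L: "0 < L" "R \<le> L" "2 * (R / L) \<le> e' - e"
  proof -
    show "0 < L" "R \<le> L" using R by (auto simp: L_def)
    have "2 * R / (e' - e) \<le> L" by (simp add: L_def)
    then have "2 * R \<le> L * (e' - e)" using e by (simp add: pos_divide_le_eq)
    then show "2 * (R / L) \<le> e' - e" using \<open>0 < L\<close> by (simp add: pos_divide_le_eq mult.commute)
  qed
  define f where "f = bump d z L"
  define g where "g x = sqrt (1 - (f x)\<^sup>2)" for x
  have f: "0 \<le> f x" "f x \<le> 1" for x unfolding f_def by (rule bump_range[OF d L(1)])+
  have f2: "(f x)\<^sup>2 \<le> 1" for x using f[of x] by (simp add: power_le_one)
  have g2: "(g x)\<^sup>2 = 1 - (f x)\<^sup>2" and g0: "0 \<le> g x" for x using f2[of x] by (auto simp: g_def)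
  \<comment> \<open>Nothing is known about \<open>k\<close> near \<open>z\<close>; the factor
    \<open>g z = 0\<close> removes those values.\<close>
  have gz: "g z = 0"
    using L(1) by (simp add: g_def f_def bump_def ext_metric_refl[OF d])
  have kpd: "pos_def_kernel k" and k0: "\<And>x y. ereal S < d x y \<Longrightarrow> k x y = 0"
    and k1: "\<And>x. k x x \<le> 1"
    and kY: "\<And>x y. x \<in> Y - {z} \<Longrightarrow> y \<in> Y - {z} \<Longrightarrow> d x y \<le> ereal R \<Longrightarrow> 1 - e \<le> k x y"
    using k unfolding almost_unit_kernel_def by blast+
  define k' where "k' x y = f x * f y + g x * g y * k x y" for x y
  have "pos_def_kernel k'"
    unfolding k'_def by (intro pos_def_kernel_add pos_def_kernel_rank_one pos_def_kernel_conjugate kpd)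
  moreover have "k' x y = 0" if far: "ereal (max S (2 * L)) < d x y" for x y
  proof -
    have "k x y = 0" using far by (intro k0) (meson le_less_trans ereal_less_eq(3) max.cobounded1)
    moreover have "f x * f y = 0"
    proof (rule ccontr)
      assume "f x * f y \<noteq> 0"
      then have "d z x \<le> ereal L" "d z y \<le> ereal L" by (auto simp: f_def bump_def split: if_splits)
      then have "d z x + d z y \<le> ereal L + ereal L" by (rule add_mono)
      moreover have "d x y \<le> d z x + d z y"
        using ext_metric_triangle[OF d, of x y z] ext_metric_sym[OF d, of x z] by simp
      ultimately have "d x y \<le> ereal (L + L)" by simp
      moreover have "ereal (L + L) < d x y"
        using far by (rule le_less_trans[rotated]) simp
      ultimately show False by simp
    qed
    ultimately show ?thesis by (simp add: k'_def)
  qed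
  moreover have "k' x x \<le> 1" for x
  proof -
    have "g x * g x * k x x \<le> g x * g x * 1" using k1 by (intro mult_left_mono) auto
    then show ?thesis using g2[of x] by (simp add: k'_def power2_eq_square)
  qed
  moreover have "1 - e' \<le> k' x y" if xy: "x \<in> Y" "y \<in> Y" "d x y \<le> ereal R" for x y
  proof -
    have df: "\<bar>f x - f y\<bar> \<le> R / L" unfolding f_def by (rule bump_lipschitz[OF d L(1) xy(3)])
    have RL: "0 \<le> R / L" "R / L \<le> 1" using R L by auto
    have "(f x - f y)\<^sup>2 \<le> (R / L)\<^sup>2" using power_mono[OF df, of 2] by simp
    also have "\<dots> \<le> R / L" using mult_left_le[OF RL(2,1)] by (simp only: power2_eq_square)
    finally have A: "(f x - f y)\<^sup>2 \<le> R / L" .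
    have "\<bar>(f x)\<^sup>2 - (f y)\<^sup>2\<bar> = \<bar>f x - f y\<bar> * \<bar>f x + f y\<bar>"
      by (simp add: power2_eq_square square_diff_square_factored abs_mult mult.commute)
    also have "\<dots> \<le> R / L * 2" using f[of x] f[of y] df RL by (intro mult_mono) auto
    finally have fs: "\<bar>(f x)\<^sup>2 - (f y)\<^sup>2\<bar> \<le> 2 * (R / L)" by (simp add: mult.commute)
    \<comment> \<open>The square root need not be Lipschitz where \<open>f\<close> approaches 1, but
      for nonnegative numbers the squared difference is at most the difference of the
      squares.\<close>
    have "\<bar>g x - g y\<bar> * \<bar>g x - g y\<bar> \<le> \<bar>g x - g y\<bar> * \<bar>g x + g y\<bar>"
      using g0[of x] g0[of y] by (intro mult_left_mono) auto
    also have "\<dots> = \<bar>(g x)\<^sup>2 - (g y)\<^sup>2\<bar>"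
      by (simp add: power2_eq_square square_diff_square_factored abs_mult mult.commute)
    also have "\<dots> = \<bar>(f x)\<^sup>2 - (f y)\<^sup>2\<bar>" by (simp add: g2)
    finally have B: "(g x - g y)\<^sup>2 \<le> 2 * (R / L)" using fs by (simp add: power2_eq_square)
    have "2 * (f x * f y + g x * g y) = 2 - (f x - f y)\<^sup>2 - (g x - g y)\<^sup>2"
      using g2[of x] g2[of y] by (simp add: power2_eq_square algebra_simps)
    moreover have "1 - \<delta> \<le> s" if "2 * s = 2 - a - b" "a \<le> r" "b \<le> 2 * r" "2 * r \<le> \<delta>" "0 \<le> r"
      for s a b r \<delta> :: real
      using that by linarith
    ultimately have C: "1 - (e' - e) \<le> f x * f y + g x * g y" using A B L(3) RL(1) by blast
    have gg: "0 \<le> g x * g y" "g x * g y \<le> 1"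
    proof -
      show "0 \<le> g x * g y" using g0 by simp
      have "g x \<le> 1" for x unfolding g_def by simp
      then show "g x * g y \<le> 1" using g0 by (intro mult_le_one) auto
    qed
    have "g x * g y * (1 - k x y) \<le> e"
    proof (cases "x = z \<or> y = z")
      case True then show ?thesis using gz e0 by auto
    next
      case False
      then have "1 - k x y \<le> e" using kY[of x y] xy by auto
      then have "g x * g y * (1 - k x y) \<le> g x * g y * e" using gg by (intro mult_left_mono) auto
      also have "\<dots> \<le> e" using gg e0 by (simp add: mult_left_le_one_le)
      finally show ?thesis .
    qed
    moreover have "k' x y = f x * f y + g x * g y - g x * g y * (1 - k x y)"
      by (simp add: k'_def algebra_simps)
    ultimately show ?thesis using C by linarith
  qed
  ultimately have "almost_unit_kernel d Y (max S (2 * L)) R e' k'"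
    by (simp add: almost_unit_kernel_def)
  then show ?thesis by blast
qed

text \<open>Every point costs some of the slack between \<open>e\<close> and \<open>e'\<close>;
  going only to the midpoint leaves a positive amount for the remaining points.\<close>

lemma almost_unit_kernel_union_finite:
  assumes d: "ext_metric d" and R: "0 < R" and Z: "finite Z"
  shows "almost_unit_kernel d (Y - Z) S R e k \<Longrightarrow> 0 \<le> e \<Longrightarrow> e < e' \<Longrightarrow>
    \<exists>S' k'. almost_unit_kernel d Y S' R e' k'"
  using Z
proof (induction Z arbitrary: S k e)
  case empty
  then have "almost_unit_kernel d Y S R e' k"
    unfolding almost_unit_kernel_def by (auto intro: order_trans[of "1 - e'" "1 - e"])
  then show ?case by blast
next
  case (insert z Z)
  let ?m = "(e + e') / 2"
  have "almost_unit_kernel d ((Y - Z) - {z}) S R e k"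
    using insert.prems(1) by (metis Diff_insert)
  then obtain S1 k1 where "almost_unit_kernel d (Y - Z) S1 R ?m k1"
    using almost_unit_kernel_insert[OF d R, of e "Y - Z" z S k ?m] insert.prems by auto
  then show ?case using insert.IH[of S1 ?m k1] insert.prems by auto
qed

text \<open>Finite intersection property in the compact box: each condition is closed because it
  involves finitely many values of the kernel. It is essential that one \<open>S\<close> serves all
  finite sets.\<close>

lemma almost_unit_kernel_of_finite:
  assumes ex: "\<And>F. finite F \<Longrightarrow> F \<subseteq> Y \<Longrightarrow> \<exists>k. almost_unit_kernel d F S R e k"
  shows "\<exists>k. almost_unit_kernel d Y S R e k"
proof -
  let ?box = "{k::'a \<Rightarrow> 'a \<Rightarrow> real. \<forall>x y. \<bar>k x y\<bar> \<le> 1}"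
  define A where "A F = {k. almost_unit_kernel d F S R e k}" for F
  have A: "A F = {k. \<forall>x y. k x y = k y x}
      \<inter> (\<Inter>G\<in>Collect finite. \<Inter>c. {k. 0 \<le> (\<Sum>x\<in>G. \<Sum>y\<in>G. c x * c y * k x y)})
      \<inter> (\<Inter>p\<in>{p. ereal S < d (fst p) (snd p)}. {k. k (fst p) (snd p) = 0})
      \<inter> (\<Inter>x. {k. k x x \<le> 1})
      \<inter> (\<Inter>p\<in>{p \<in> F \<times> F. d (fst p) (snd p) \<le> ereal R}. {k. 1 - e \<le> k (fst p) (snd p)})" for F
    unfolding A_def almost_unit_kernel_def pos_def_kernel_def by auto
  have clA: "closed (A F)" for F
    unfolding A
    by (intro closed_Int closed_INT ballI closed_Collect_eq closed_Collect_le closed_Collect_all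
        continuous_intros continuous_on_apply2)
  have box: "A F \<subseteq> ?box" for F
  proof
    fix k assume "k \<in> A F"
    then have k: "pos_def_kernel k" "\<And>x. k x x \<le> 1" by (auto simp: A_def almost_unit_kernel_def)
    have "\<bar>k x y\<bar> \<le> 1" for x y
      using pos_def_kernel_le_diag[OF k(1), of x y] k(2)[of x] k(2)[of y] by linarith
    then show "k \<in> ?box" by blast
  qed
  have "?box \<inter> \<Inter> (A ` {F. finite F \<and> F \<subseteq> Y}) \<noteq> {}"
  proof (rule compact_imp_fip[OF compact_unit_box])
    show "closed T" if "T \<in> A ` {F. finite F \<and> F \<subseteq> Y}" for T using that clA by auto
    fix \<F> assume \<F>: "finite \<F>" "\<F> \<subseteq> A ` {F. finite F \<and> F \<subseteq> Y}"
    then obtain \<G> where \<G>: "finite \<G>" "\<G> \<subseteq> {F. finite F \<and> F \<subseteq> Y}" "\<F> = A ` \<G>"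
      by (meson finite_subset_image)
    then have "finite (\<Union>\<G>)" "\<Union>\<G> \<subseteq> Y" by auto
    \<comment> \<open>A kernel for the union of finitely many finite sets serves each of
      them.\<close>
    then obtain k where k: "k \<in> A (\<Union>\<G>)" using ex[of "\<Union>\<G>"] unfolding A_def by blast
    have "k \<in> A F" if "F \<in> \<G>" for F
      using k that unfolding A_def almost_unit_kernel_def mem_Collect_eq by (meson UnionI)
    then have "k \<in> ?box \<inter> \<Inter> \<F>" using subsetD[OF box k] \<G>(3) by simp
    then show "?box \<inter> \<Inter> \<F> \<noteq> {}" by blast
  qed
  then have "\<exists>k. k \<in> ?box \<inter> \<Inter> (A ` {F. finite F \<and> F \<subseteq> Y})" by (simp only: ex_in_conv not_False_eq_True)
  then obtain k where "k \<in> ?box \<inter> \<Inter> (A ` {F. finite F \<and> F \<subseteq> Y})" ..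
  then have "k \<in> \<Inter> (A ` {F. finite F \<and> F \<subseteq> Y})" by (rule IntD2)
  then have k: "k \<in> A F" if "finite F" "F \<subseteq> Y" for F using that by simp
  have "almost_unit_kernel d Y S R e k"
    unfolding almost_unit_kernel_def
  proof (intro conjI ballI impI)
    show "1 - e \<le> k x y" if "x \<in> Y" "y \<in> Y" "d x y \<le> ereal R" for x y
      using k[of "{x, y}"] that by (auto simp: A_def almost_unit_kernel_def)
  qed (use k[of "{}"] in \<open>auto simp: A_def almost_unit_kernel_def\<close>)
  then show ?thesis by blast
qed

lemma property_A_of_almost_unit_kernels:
  assumes "\<And>R e. 0 < R \<Longrightarrow> 0 < e \<Longrightarrow> e < 1 \<Longrightarrow> \<exists>S k. almost_unit_kernel d UNIV S R e k"
  shows "property_A d"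
proof -
  \<comment> \<open>The denominator is \<open>n + 2\<close> because the hypothesis asks for
    \<open>e < 1\<close> also at \<open>n = 0\<close>.\<close>
  have "\<forall>n. \<exists>S k. almost_unit_kernel d UNIV S (real n + 1) (1 / (real n + 2)) k"
    using assms by simp
  then obtain S k where k: "\<And>n. almost_unit_kernel d UNIV (S n) (real n + 1) (1 / (real n + 2)) (k n)"
    by metis
  have "\<exists>N. \<forall>n>N. \<forall>x y. d x y < ereal s \<longrightarrow> 1 - \<epsilon> \<le> k n x y \<and> k n x y \<le> 1"
    if se: "0 < s" "0 < \<epsilon>" for s \<epsilon> :: real
  proof -
    obtain N where N: "max s (1 / \<epsilon>) < real N" using reals_Archimedean2 by blast
    have "1 - \<epsilon> \<le> k n x y \<and> k n x y \<le> 1" if n: "N < n" and xy: "d x y < ereal s" for n x y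
    proof
      have pd: "pos_def_kernel (k n)" and "k n x x \<le> 1" "k n y y \<le> 1"
        using k[of n] by (auto simp: almost_unit_kernel_def)
      then show "k n x y \<le> 1" using pos_def_kernel_le_diag[OF pd, of x y] by linarith
      have "s \<le> real n + 1" using N n by simp
      then have "d x y \<le> ereal (real n + 1)" using xy by (meson ereal_less_eq(3) less_imp_le order_trans)
      then have "1 - 1 / (real n + 2) \<le> k n x y" using k[of n] by (simp add: almost_unit_kernel_def)
      moreover have "1 / (real n + 2) \<le> \<epsilon>"
      proof -
        have "1 / \<epsilon> \<le> real n + 2" using N n by simp
        then show ?thesis using se by (simp add: field_simps)
      qed
      ultimately show "1 - \<epsilon> \<le> k n x y" by simp
    qed
    then show ?thesis by blast
  qed
  moreover have "pos_def_kernel (k n)" "\<forall>x y. d x y > ereal (S n) \<longrightarrow> k n x y = 0" for n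
    using k[of n] by (auto simp: almost_unit_kernel_def)
  ultimately show ?thesis unfolding property_A_def by blast
qed

text \<open>\<open>R\<close> and \<open>e\<close> are fixed before the scales \<open>S\<close>. If,
  for some \<open>S\<close>, every finite set avoiding a finite \<open>Z\<close> had a kernel,
  compactness would give one for the complement of \<open>Z\<close> and gluing one for the whole
  space. So the sets can be picked greedily, each avoiding its predecessors.\<close>

lemma disjoint_finite_obstructions:
  assumes d: "ext_metric d" and no: "\<not> property_A d"
  obtains R e where "0 < R" "0 < e" "e < 1"
    "\<And>S. \<exists>F::nat \<Rightarrow> 'a set. (\<forall>n. finite (F n)) \<and> disjoint_family F \<and>
      (\<forall>n. \<nexists>k. almost_unit_kernel d (F n) (S n) R e k)"
proof -
  obtain R e where R: "0 < R" and e: "0 < e" "e < 1"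
    and none: "\<And>S k. \<not> almost_unit_kernel d UNIV S R e k"
    using property_A_of_almost_unit_kernels no by blast
  \<comment> \<open>Halving \<open>e\<close> pays for the gluing across \<open>Z\<close>.\<close>
  have step: "\<exists>F. finite F \<and> F \<inter> Z = {} \<and> (\<nexists>k. almost_unit_kernel d F S R (e / 2) k)"
    if Z: "finite Z" for Z S
  proof (rule ccontr)
    assume contra: "\<not> ?thesis"
    have "\<exists>k. almost_unit_kernel d (UNIV - Z) S R (e / 2) k"
    proof (rule almost_unit_kernel_of_finite)
      fix F assume "finite F" "F \<subseteq> UNIV - Z"
      then have "finite F \<and> F \<inter> Z = {}" by auto
      with contra show "\<exists>k. almost_unit_kernel d F S R (e / 2) k" by meson
    qed
    then obtain k where "almost_unit_kernel d (UNIV - Z) S R (e / 2) k" ..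
    from almost_unit_kernel_union_finite[OF d R Z this, of e] show False
      using e none by simp
  qed
  define pick where "pick Z s = (SOME F. finite F \<and> F \<inter> Z = {} \<and> (\<nexists>k. almost_unit_kernel d F s R (e / 2) k))"
    for Z s
  have pick: "finite (pick Z s)" "pick Z s \<inter> Z = {}" "\<nexists>k. almost_unit_kernel d (pick Z s) s R (e / 2) k"
    if "finite Z" for Z s
    using someI_ex[OF step[OF that, of s]] unfolding pick_def by blast+
  have "\<exists>F::nat \<Rightarrow> 'a set. (\<forall>n. finite (F n)) \<and> disjoint_family F \<and>
      (\<forall>n. \<nexists>k. almost_unit_kernel d (F n) (S n) R (e / 2) k)" for S
  proof -
    \<comment> \<open>\<open>Z n\<close> is the union of the sets picked before stage
      \<open>n\<close>.\<close>
    define Z where "Z = rec_nat {} (\<lambda>n Z. Z \<union> pick Z (S n))"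
    have Z0: "Z 0 = {}" and ZS: "Z (Suc n) = Z n \<union> pick (Z n) (S n)" for n
      by (simp_all add: Z_def)
    have finZ: "finite (Z n)" for n by (induction n) (auto simp: Z0 ZS pick(1))
    have mono: "Z m \<subseteq> Z n" if "m \<le> n" for m n
      using that by (rule lift_Suc_mono_le[of Z, rotated]) (auto simp: ZS)
    define F where "F n = pick (Z n) (S n)" for n
    have lt: "F m \<inter> F n = {}" if "m < n" for m n
    proof -
      have "F m \<subseteq> Z n" using mono[of "Suc m" n] that by (auto simp: F_def ZS)
      then show ?thesis using pick(2)[OF finZ[of n], of "S n"] by (auto simp: F_def)
    qed
    have "F m \<inter> F n = {}" if "m \<noteq> n" for m n
      using lt[of m n] lt[of n m] that by (cases m n rule: linorder_cases) auto
    then have "disjoint_family F" by (simp add: disjoint_family_on_def)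
    moreover have "finite (F n)" "\<nexists>k. almost_unit_kernel d (F n) (S n) R (e / 2) k" for n
      unfolding F_def by (rule pick[OF finZ])+
    ultimately show ?thesis by blast
  qed
  then show ?thesis using that[OF R, of "e / 2"] e by simp
qed

subsection \<open>The Hilbert space \<open>l2\<close>\<close>

lemma L2_set_cmod_le_l2norm:
  assumes "f \<in> l2" "finite G"
  shows "L2_set (\<lambda>x. cmod (f x)) G \<le> l2norm f"
  using assms unfolding L2_set_def l2norm_def l2_def
  by (intro real_sqrt_le_mono finite_sum_le_infsum) auto

text \<open>Reduces membership and norm bounds to finite sums, where the inequalities for
  \<open>L2_set\<close> apply.\<close>

lemma l2I:
  assumes "\<And>G. finite G \<Longrightarrow> L2_set (\<lambda>x. cmod (f x)) G \<le> C"
  shows "f \<in> l2" "l2norm f \<le> C"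
proof -
  have C: "0 \<le> C" using assms[of "{}"] by simp
  have le: "(\<Sum>x\<in>G. (cmod (f x))\<^sup>2) \<le> C\<^sup>2" if "finite G" for G
    using assms[OF that] C by (simp add: L2_set_def sqrt_le_D)
  have sm: "(\<lambda>x. (cmod (f x))\<^sup>2) summable_on UNIV"
    using le by (intro nonneg_bdd_above_summable_on bdd_aboveI[of _ "C\<^sup>2"]) auto
  then show "f \<in> l2" by (simp add: l2_def)
  have "(\<Sum>\<^sub>\<infinity>x. (cmod (f x))\<^sup>2) \<le> C\<^sup>2" by (rule infsum_le_finite_sums[OF sm le])
  then show "l2norm f \<le> C" unfolding l2norm_def using C by (simp add: real_le_lsqrt infsum_nonneg)
qed

lemma l2norm_nonneg: "0 \<le> l2norm f"
  by (simp add: l2norm_def infsum_nonneg)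

lemma
  assumes f: "f \<in> l2" and g: "g \<in> l2"
  shows l2_add: "(\<lambda>x. f x + g x) \<in> l2"
    and l2norm_triangle: "l2norm (\<lambda>x. f x + g x) \<le> l2norm f + l2norm g"
proof -
  have "L2_set (\<lambda>x. cmod (f x + g x)) G \<le> l2norm f + l2norm g" if "finite G" for G
  proof -
    have "L2_set (\<lambda>x. cmod (f x + g x)) G \<le> L2_set (\<lambda>x. cmod (f x) + cmod (g x)) G"
      by (intro L2_set_mono norm_triangle_ineq) auto
    also have "\<dots> \<le> L2_set (\<lambda>x. cmod (f x)) G + L2_set (\<lambda>x. cmod (g x)) G"
      by (rule L2_set_triangle_ineq)
    also have "\<dots> \<le> l2norm f + l2norm g"
      using that f g by (intro add_mono L2_set_cmod_le_l2norm)
    finally show ?thesis .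
  qed
  from l2I[of "\<lambda>x. f x + g x", OF this] show "(\<lambda>x. f x + g x) \<in> l2"
    "l2norm (\<lambda>x. f x + g x) \<le> l2norm f + l2norm g" by auto
qed

lemma
  assumes f: "f \<in> l2"
  shows l2_scale: "(\<lambda>x. c * f x) \<in> l2"
    and l2norm_scale_le: "l2norm (\<lambda>x. c * f x) \<le> cmod c * l2norm f"
proof -
  have "L2_set (\<lambda>x. cmod (c * f x)) G \<le> cmod c * l2norm f" if "finite G" for G
    using L2_set_cmod_le_l2norm[OF f that]
    by (simp add: norm_mult L2_set_right_distrib[symmetric] mult_left_mono)
  from l2I[of "\<lambda>x. c * f x", OF this] show "(\<lambda>x. c * f x) \<in> l2"
    "l2norm (\<lambda>x. c * f x) \<le> cmod c * l2norm f" by auto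
qed

lemma l2_diff: "f \<in> l2 \<Longrightarrow> g \<in> l2 \<Longrightarrow> (\<lambda>x. f x - g x) \<in> l2"
  using l2_add[OF _ l2_scale[of g "-1"], of f] by simp

lemma l2norm_minus: "l2norm (\<lambda>x. - f x) = l2norm f"
  by (simp add: l2norm_def)

lemma l2norm_diff_triangle:
  assumes "f \<in> l2" "g \<in> l2"
  shows "l2norm (\<lambda>x. f x - g x) \<le> l2norm f + l2norm g"
  using l2norm_triangle[OF assms(1) l2_scale[OF assms(2), of "-1"]] l2norm_minus[of g] by simp

lemma
  assumes G: "finite G" and f: "\<And>x. x \<notin> G \<Longrightarrow> f x = 0"
  shows l2_finite_support: "f \<in> l2"
    and l2norm_finite_support: "l2norm f = L2_set (\<lambda>x. cmod (f x)) G"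
proof -
  have "(\<Sum>\<^sub>\<infinity>x. (cmod (f x))\<^sup>2) = (\<Sum>\<^sub>\<infinity>x\<in>G. (cmod (f x))\<^sup>2)"
    by (rule infsum_cong_neutral) (use f in auto)
  then show "l2norm f = L2_set (\<lambda>x. cmod (f x)) G"
    using G by (simp add: l2norm_def L2_set_def)
  have "(\<lambda>x. (cmod (f x))\<^sup>2) summable_on UNIV \<longleftrightarrow> (\<lambda>x. (cmod (f x))\<^sup>2) summable_on G"
    by (rule summable_on_cong_neutral) (use f in auto)
  then show "f \<in> l2" using G by (simp add: l2_def)
qed

lemma l2_tail_small:
  assumes f: "f \<in> l2" and e: "0 < e"
  obtains G where "finite G" "(\<lambda>x. if x \<in> G then 0 else f x) \<in> l2"
    "l2norm (\<lambda>x. if x \<in> G then 0 else f x) \<le> e"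
proof -
  let ?q = "\<lambda>x. (cmod (f x))\<^sup>2"
  have sm: "?q summable_on UNIV" using f by (simp add: l2_def)
  obtain G where G: "finite G" "dist (sum ?q G) (infsum ?q UNIV) \<le> e\<^sup>2"
    using infsum_finite_approximation[OF sm, of "e\<^sup>2"] e by auto
  have le: "L2_set (\<lambda>x. cmod (if x \<in> G then 0 else f x)) H \<le> e" if H: "finite H" for H
  proof -
    have "(\<Sum>x\<in>H. (cmod (if x \<in> G then 0 else f x))\<^sup>2) = sum ?q (H - G)"
      using H by (intro sum.mono_neutral_cong_right) auto
    also have "\<dots> = sum ?q (G \<union> H) - sum ?q G"
      using G H sum.union_disjoint[of G "H - G" ?q] by simp
    also have "\<dots> \<le> e\<^sup>2"
    proof -
      have "sum ?q (G \<union> H) \<le> infsum ?q UNIV"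
        using G H by (intro finite_sum_le_infsum sm) auto
      then show ?thesis using G(2) by (simp add: dist_real_def)
    qed
    finally show ?thesis unfolding L2_set_def using e by (simp add: real_le_lsqrt)
  qed
  show ?thesis by (rule that[OF G(1) l2I[OF le]])
qed

section \<open>Bounded operators and their matrix coefficients\<close>

lemma bounded_opE:
  assumes "bounded_op T"
  obtains C where "0 \<le> C" "\<And>f. f \<in> l2 \<Longrightarrow> l2norm (T f) \<le> C * l2norm f"
proof -
  obtain C where C: "\<And>f. f \<in> l2 \<Longrightarrow> l2norm (T f) \<le> C * l2norm f"
    using assms unfolding bounded_op_def by blast
  have "l2norm (T f) \<le> max C 0 * l2norm f" if "f \<in> l2" for f
    by (rule order_trans[OF C[OF that]]) (simp add: mult_right_mono l2norm_nonneg)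
  then show ?thesis using that[of "max C 0"] by simp
qed

lemma
  assumes "bounded_op T"
  shows bounded_op_l2: "f \<in> l2 \<Longrightarrow> T f \<in> l2"
    and bounded_op_add: "f \<in> l2 \<Longrightarrow> g \<in> l2 \<Longrightarrow> T (\<lambda>x. f x + g x) = (\<lambda>x. T f x + T g x)"
    and bounded_op_scale: "f \<in> l2 \<Longrightarrow> T (\<lambda>x. c * f x) = (\<lambda>x. c * T f x)"
  using assms unfolding bounded_op_def by blast+

lemma l2_zero: "(\<lambda>x. 0) \<in> l2" and l2norm_zero: "l2norm (\<lambda>x. 0) = 0"
  by (simp_all add: l2_def l2norm_def)

lemma l2_delta: "delta y \<in> l2"
  by (rule l2_finite_support[of "{y}"]) (auto simp: delta_def)

lemma bounded_op_diff:
  assumes T: "bounded_op T" and S: "bounded_op S"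
  shows "bounded_op (\<lambda>f x. T f x - S f x)"
proof -
  obtain A where A: "\<And>f. f \<in> l2 \<Longrightarrow> l2norm (T f) \<le> A * l2norm f" using bounded_opE[OF T] by blast
  obtain B where B: "\<And>f. f \<in> l2 \<Longrightarrow> l2norm (S f) \<le> B * l2norm f" using bounded_opE[OF S] by blast
  have "l2norm (\<lambda>x. T f x - S f x) \<le> (A + B) * l2norm f" if "f \<in> l2" for f
    using l2norm_diff_triangle[OF bounded_op_l2[OF T that] bounded_op_l2[OF S that]] A[OF that] B[OF that]
    by (simp add: distrib_right)
  then show ?thesis
    unfolding bounded_op_def
    using bounded_op_l2[OF T] bounded_op_l2[OF S] bounded_op_add[OF T] bounded_op_add[OF S]
      bounded_op_scale[OF T] bounded_op_scale[OF S]
    by (auto simp: l2_diff right_diff_distrib fun_eq_iff)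
qed

lemma op_norm_bound:
  assumes T: "bounded_op T" and f: "f \<in> l2"
  shows "l2norm (T f) \<le> op_norm T * l2norm f"
proof -
  obtain C where C0: "0 \<le> C" and C: "\<And>f. f \<in> l2 \<Longrightarrow> l2norm (T f) \<le> C * l2norm f"
    using bounded_opE[OF T] by blast
  have bdd: "bdd_above {l2norm (T f) |f. f \<in> l2 \<and> l2norm f \<le> 1}"
  proof (rule bdd_aboveI[of _ C])
    fix r assume "r \<in> {l2norm (T f) |f. f \<in> l2 \<and> l2norm f \<le> 1}"
    then obtain g where g: "g \<in> l2" "l2norm g \<le> 1" "r = l2norm (T g)" by blast
    have "C * l2norm g \<le> C" using g C0 by (simp add: mult_left_le)
    then show "r \<le> C" using C[OF g(1)] g(3) by simp
  qed
  show ?thesis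
  proof (cases "l2norm f = 0")
    case True
    then show ?thesis using C[OF f] by simp
  next
    case False
    then have n: "0 < l2norm f" using l2norm_nonneg[of f] by simp
    let ?c = "complex_of_real (1 / l2norm f)"
    let ?g = "\<lambda>x. ?c * f x"
    have g: "?g \<in> l2" "l2norm ?g \<le> 1"
      using l2_scale[OF f, of ?c] l2norm_scale_le[OF f, of ?c] n by (auto simp: norm_divide)
    have "l2norm (T f) = l2norm (\<lambda>x. complex_of_real (l2norm f) * T ?g x)"
      unfolding bounded_op_scale[OF T f] using n by (simp add: mult.assoc[symmetric])
    also have "\<dots> \<le> cmod (complex_of_real (l2norm f)) * l2norm (T ?g)"
      by (rule l2norm_scale_le[OF bounded_op_l2[OF T g(1)]])
    also have "\<dots> = l2norm (T ?g) * l2norm f" using n by simp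
    also have "\<dots> \<le> op_norm T * l2norm f"
      unfolding op_norm_def using g bdd n by (intro mult_right_mono cSup_upper) auto
    finally show ?thesis .
  qed
qed

lemma op_norm_le:
  assumes "\<And>f. f \<in> l2 \<Longrightarrow> l2norm (T f) \<le> C * l2norm f" "0 \<le> C"
  shows "op_norm T \<le> C"
  unfolding op_norm_def
proof (rule cSup_least)
  show "{l2norm (T f) |f. f \<in> l2 \<and> l2norm f \<le> 1} \<noteq> {}"
    using l2_zero l2norm_zero by (metis (mono_tags, lifting) empty_iff mem_Collect_eq zero_le_one)
  fix r assume "r \<in> {l2norm (T f) |f. f \<in> l2 \<and> l2norm f \<le> 1}"
  then obtain g where g: "g \<in> l2" "l2norm g \<le> 1" "r = l2norm (T g)" by blast
  have "C * l2norm g \<le> C" using g assms(2) by (simp add: mult_left_le)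
  then show "r \<le> C" using assms(1)[OF g(1)] g(3) by simp
qed

lemma bounded_op_finite_support:
  assumes T: "bounded_op T" and "finite G" "\<And>x. x \<notin> G \<Longrightarrow> f x = 0"
  shows "T f = (\<lambda>x. \<Sum>y\<in>G. matrix_coeff T x y * f y)"
  using assms(2,3)
proof (induction G arbitrary: f rule: finite_induct)
  case empty
  then have "f = (\<lambda>x. 0 * f x)" by auto
  moreover have "f \<in> l2" using empty l2_finite_support[of "{}" f] by simp
  ultimately have "T f = (\<lambda>x. 0 * T f x)" using bounded_op_scale[OF T, of f 0] by metis
  then show ?case by simp
next
  case (insert z G)
  let ?g = "\<lambda>x. if x = z then 0 else f x"
  have g: "?g \<in> l2" using insert by (intro l2_finite_support[of G]) auto
  have "f = (\<lambda>x. f z * delta z x + ?g x)" by (auto simp: delta_def)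
  then have "T f = (\<lambda>x. f z * T (delta z) x + T ?g x)"
    using bounded_op_add[OF T l2_scale[OF l2_delta] g] bounded_op_scale[OF T l2_delta] by metis
  also have "T ?g = (\<lambda>x. \<Sum>y\<in>G. matrix_coeff T x y * ?g y)"
    using insert by (intro insert.IH) auto
  also have "\<dots> = (\<lambda>x. \<Sum>y\<in>G. matrix_coeff T x y * f y)"
    using insert by (intro ext sum.cong) auto
  finally show ?case using insert by (simp add: matrix_coeff_def mult.commute)
qed

text \<open>Duality gives the bound on finitely supported vectors, and cutting off a tail extends
  it. The a priori bound of \<open>T\<close> serves only to make the image of the tail small, so it
  does not enter the constant.\<close>

lemma bounded_op_norm_le_of_finite_forms:
  assumes T: "bounded_op T" and c: "0 \<le> c"
    and form: "\<And>G u v. finite G \<Longrightarrow>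
      cmod (\<Sum>x\<in>G. \<Sum>y\<in>G. matrix_coeff T x y * u y * v x)
      \<le> c * L2_set (\<lambda>x. cmod (u x)) G * L2_set (\<lambda>x. cmod (v x)) G"
    and f: "f \<in> l2"
  shows "l2norm (T f) \<le> c * l2norm f"
proof -
  have fin: "l2norm (T u) \<le> c * l2norm u" if G: "finite G" and u: "\<And>x. x \<notin> G \<Longrightarrow> u x = 0" for G u
  proof (rule l2I(2))
    fix H :: "'a set" assume H: "finite H"
    \<comment> \<open>The form is bilinear, so the test vector is the conjugate of
      \<open>T u\<close>, cut down to \<open>H\<close>.\<close>
    let ?K = "G \<union> H" and ?v = "\<lambda>x. if x \<in> H then cnj (T u x) else 0"
    have K: "finite ?K" using G H by simp
    have Tu: "T u = (\<lambda>x. \<Sum>y\<in>?K. matrix_coeff T x y * u y)"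
      using bounded_op_finite_support[OF T K, of u] u by auto
    have vn: "L2_set (\<lambda>x. cmod (?v x)) ?K = L2_set (\<lambda>x. cmod (T u x)) H"
      unfolding L2_set_def using K by (intro arg_cong[where f = sqrt] sum.mono_neutral_cong_right) auto
    have un: "L2_set (\<lambda>x. cmod (u x)) ?K = l2norm u"
      using l2norm_finite_support[OF K, of u] u by auto
    have "(\<Sum>x\<in>?K. \<Sum>y\<in>?K. matrix_coeff T x y * u y * ?v x) = (\<Sum>x\<in>?K. T u x * ?v x)"
      by (subst Tu) (simp only: sum_distrib_right)
    also have "\<dots> = (\<Sum>x\<in>H. T u x * cnj (T u x))"
      using K by (intro sum.mono_neutral_cong_right) auto
    also have "\<dots> = complex_of_real ((L2_set (\<lambda>x. cmod (T u x)) H)\<^sup>2)"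
      by (simp add: L2_set_def sum_nonneg complex_norm_square[symmetric])
    finally have "(L2_set (\<lambda>x. cmod (T u x)) H)\<^sup>2
        \<le> c * l2norm u * L2_set (\<lambda>x. cmod (T u x)) H"
      using form[OF K, of u ?v] unfolding vn un by (simp add: norm_power)
    then show "L2_set (\<lambda>x. cmod (T u x)) H \<le> c * l2norm u"
      using L2_set_nonneg[of "\<lambda>x. cmod (T u x)" H] c l2norm_nonneg[of u]
      by (cases "L2_set (\<lambda>x. cmod (T u x)) H = 0") (auto simp: power2_eq_square)
  qed
  obtain C where C0: "0 \<le> C" and C: "\<And>f. f \<in> l2 \<Longrightarrow> l2norm (T f) \<le> C * l2norm f"
    using bounded_opE[OF T] by blast
  show ?thesis
  proof (rule field_le_epsilon)
    fix e :: real assume e: "0 < e"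
    have "0 < e / (C + 1)" using e C0 by simp
    then obtain G where G: "finite G" and r: "(\<lambda>x. if x \<in> G then 0 else f x) \<in> l2"
      "l2norm (\<lambda>x. if x \<in> G then 0 else f x) \<le> e / (C + 1)"
      using l2_tail_small[OF f] by metis
    let ?r = "\<lambda>x. if x \<in> G then 0 else f x"
    let ?u = "\<lambda>x. if x \<in> G then f x else 0"
    have u: "?u \<in> l2" using G by (intro l2_finite_support) auto
    have "l2norm ?u = L2_set (\<lambda>x. cmod (f x)) G"
      using l2norm_finite_support[OF G, of ?u] by (simp add: L2_set_def)
    then have un: "l2norm ?u \<le> l2norm f" using L2_set_cmod_le_l2norm[OF f G] by simp
    have "f = (\<lambda>x. ?u x + ?r x)" by auto
    then have "T f = (\<lambda>x. T ?u x + T ?r x)" using bounded_op_add[OF T u r(1)] by metis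
    then have split: "l2norm (T f) \<le> l2norm (T ?u) + l2norm (T ?r)"
      using l2norm_triangle[OF bounded_op_l2[OF T u] bounded_op_l2[OF T r(1)]] by simp
    have "l2norm (T ?u) \<le> c * l2norm ?u" by (rule fin[OF G]) simp
    also have "\<dots> \<le> c * l2norm f" by (rule mult_left_mono[OF un c])
    finally have A: "l2norm (T ?u) \<le> c * l2norm f" .
    have "l2norm (T ?r) \<le> C * l2norm ?r" by (rule C[OF r(1)])
    also have "\<dots> \<le> C * (e / (C + 1))" by (rule mult_left_mono[OF r(2) C0])
    also have "\<dots> \<le> e" using C0 e by (simp add: field_simps)
    finally show "l2norm (T f) \<le> c * l2norm f + e" using split A by linarith
  qed
qed

subsection \<open>Block diagonal operators\<close>

text \<open>In the eigenbasis the matrix multiplies the \<open>i\<close>-th coordinate by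
  \<open>\<phi> i\<close>; Parseval translates both sides.\<close>

lemma spectral_norm_bound:
  fixes \<phi> :: "'a \<Rightarrow> real"
  assumes F: "finite F" and u: "orthonormal_basis_on F u" and \<phi>: "\<And>i. i \<in> F \<Longrightarrow> \<bar>\<phi> i\<bar> \<le> C"
  shows "(\<Sum>x\<in>F. (\<Sum>y\<in>F. (\<Sum>i\<in>F. \<phi> i * u i x * u i y) * h y)\<^sup>2) \<le> C\<^sup>2 * (\<Sum>x\<in>F. (h x)\<^sup>2)"
proof -
  define c where "c i = (\<Sum>y\<in>F. u i y * h y)" for i
  have eq: "(\<Sum>y\<in>F. (\<Sum>i\<in>F. \<phi> i * u i x * u i y) * h y) = (\<Sum>i\<in>F. (\<phi> i * c i) * u i x)" for x
  proof -
    have "(\<Sum>y\<in>F. (\<Sum>i\<in>F. \<phi> i * u i x * u i y) * h y) = (\<Sum>y\<in>F. \<Sum>i\<in>F. \<phi> i * u i x * (u i y * h y))"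
      by (simp add: sum_distrib_right mult.assoc)
    also have "\<dots> = (\<Sum>i\<in>F. \<Sum>y\<in>F. \<phi> i * u i x * (u i y * h y))" by (rule sum.swap)
    also have "\<dots> = (\<Sum>i\<in>F. (\<phi> i * c i) * u i x)"
      by (intro sum.cong refl) (simp add: c_def sum_distrib_left sum_distrib_right mult_ac)
    finally show ?thesis .
  qed
  have "(\<Sum>x\<in>F. (\<Sum>i\<in>F. (\<phi> i * c i) * u i x)\<^sup>2)
      = (\<Sum>i\<in>F. (\<Sum>x\<in>F. u i x * (\<Sum>j\<in>F. (\<phi> j * c j) * u j x))\<^sup>2)"
    by (rule orthonormal_basis_on_parseval[OF F u, symmetric])
  also have "\<dots> = (\<Sum>i\<in>F. (\<phi> i * c i)\<^sup>2)"
  proof (rule sum.cong[OF refl])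
    fix i assume "i \<in> F"
    show "(\<Sum>x\<in>F. u i x * (\<Sum>j\<in>F. (\<phi> j * c j) * u j x))\<^sup>2 = (\<phi> i * c i)\<^sup>2"
      unfolding orthonormal_basis_on_coeff[OF F u \<open>i \<in> F\<close>, of "\<lambda>j. \<phi> j * c j"] ..
  qed
  also have "\<dots> \<le> (\<Sum>i\<in>F. C\<^sup>2 * (c i)\<^sup>2)"
  proof (rule sum_mono)
    fix i assume "i \<in> F"
    then have "(\<phi> i)\<^sup>2 \<le> C\<^sup>2" using power_mono[OF \<phi>, of i 2] by simp
    then show "(\<phi> i * c i)\<^sup>2 \<le> C\<^sup>2 * (c i)\<^sup>2"
      by (simp add: power_mult_distrib mult_right_mono)
  qed
  also have "\<dots> = C\<^sup>2 * (\<Sum>x\<in>F. (h x)\<^sup>2)"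
    unfolding sum_distrib_left[symmetric] c_def by (simp only: orthonormal_basis_on_parseval[OF F u])
  finally show ?thesis by (simp only: eq)
qed

text \<open>Only the values of \<open>g\<close> inside a common block are read. A point outside all
  blocks gets the empty sum, so the operator vanishes there.\<close>

definition block_op :: "(nat \<Rightarrow> 'a set) \<Rightarrow> ('a \<Rightarrow> 'a \<Rightarrow> real) \<Rightarrow> ('a \<Rightarrow> complex) \<Rightarrow> 'a \<Rightarrow> complex" where
  "block_op F g f = (\<lambda>x. \<Sum>y | \<exists>n. x \<in> F n \<and> y \<in> F n. complex_of_real (g x y) * f y)"

locale block_family =
  fixes F :: "nat \<Rightarrow> 'a set"
  assumes fin: "\<And>n. finite (F n)" and disj: "disjoint_family F"
begin

lemma index_unique: "x \<in> F m \<Longrightarrow> x \<in> F n \<Longrightarrow> m = n"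
  using disj by (auto simp: disjoint_family_on_def)

lemma block_eq: "x \<in> F n \<Longrightarrow> {y. \<exists>m. x \<in> F m \<and> y \<in> F m} = F n"
  using index_unique by blast

lemma block_op_in: "x \<in> F n \<Longrightarrow> block_op F g f x = (\<Sum>y\<in>F n. complex_of_real (g x y) * f y)"
  unfolding block_op_def by (simp only: block_eq)

lemma block_op_out: "x \<notin> (\<Union>n. F n) \<Longrightarrow> block_op F g f x = 0"
  unfolding block_op_def by (rule sum.neutral) auto

lemma block_finite: "finite {y. \<exists>n. x \<in> F n \<and> y \<in> F n}"
proof (cases "\<exists>n. x \<in> F n")
  case True
  then obtain n where "x \<in> F n" ..
  then show ?thesis using fin[of n] by (simp only: block_eq)
qed simp

lemma matrix_coeff_block_op:
  "matrix_coeff (block_op F g) x y = (if \<exists>n. x \<in> F n \<and> y \<in> F n then complex_of_real (g x y) else 0)"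
proof -
  have "matrix_coeff (block_op F g) x y
      = (\<Sum>z | \<exists>n. x \<in> F n \<and> z \<in> F n. if z = y then complex_of_real (g x y) else 0)"
    unfolding matrix_coeff_def block_op_def delta_def by (intro sum.cong) auto
  then show ?thesis using block_finite[of x] by simp
qed

lemma
  assumes C: "0 \<le> C"
    and bound: "\<And>n h. (\<Sum>x\<in>F n. (\<Sum>y\<in>F n. g x y * h y)\<^sup>2) \<le> C\<^sup>2 * (\<Sum>x\<in>F n. (h x)\<^sup>2)"
    and f: "f \<in> l2"
  shows block_op_l2: "block_op F g f \<in> l2"
    and l2norm_block_op: "l2norm (block_op F g f) \<le> C * l2norm f"
proof -
  let ?T = "block_op F g f"
  \<comment> \<open>The kernel is real, so it acts on real and imaginary parts separately.\<close>
  have block: "(\<Sum>x\<in>F n. (cmod (?T x))\<^sup>2) \<le> C\<^sup>2 * (\<Sum>x\<in>F n. (cmod (f x))\<^sup>2)" for n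
  proof -
    have "(\<Sum>x\<in>F n. (cmod (?T x))\<^sup>2)
        = (\<Sum>x\<in>F n. (\<Sum>y\<in>F n. g x y * Re (f y))\<^sup>2) + (\<Sum>x\<in>F n. (\<Sum>y\<in>F n. g x y * Im (f y))\<^sup>2)"
      unfolding sum.distrib[symmetric]
      by (intro sum.cong refl) (simp add: block_op_in cmod_power2)
    also have "\<dots> \<le> C\<^sup>2 * (\<Sum>x\<in>F n. (Re (f x))\<^sup>2) + C\<^sup>2 * (\<Sum>x\<in>F n. (Im (f x))\<^sup>2)"
      by (intro add_mono bound)
    also have "\<dots> = C\<^sup>2 * (\<Sum>x\<in>F n. (cmod (f x))\<^sup>2)"
      by (simp add: cmod_power2 sum.distrib distrib_left)
    finally show ?thesis .
  qed
  have le: "L2_set (\<lambda>x. cmod (?T x)) G \<le> C * l2norm f" if G: "finite G" for G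
  proof -
    \<comment> \<open>The blocks meeting \<open>G\<close> are finitely many, as each point lies in
      at most one block.\<close>
    define J where "J = {n. F n \<inter> G \<noteq> {}}"
    have "J \<subseteq> (\<Union>x\<in>G. {n. x \<in> F n})" by (auto simp: J_def)
    moreover have "finite {n. x \<in> F n}" for x
    proof (cases "\<exists>n. x \<in> F n")
      case True
      then obtain n where "x \<in> F n" ..
      then have "{n. x \<in> F n} = {n}" using index_unique by blast
      then show ?thesis by simp
    qed simp
    ultimately have J: "finite J" using G by (meson finite_UN finite_subset)
    let ?U = "\<Union>n\<in>J. F n"
    have U: "finite ?U" using J fin by blast
    have split: "(\<Sum>x\<in>?U. h x) = (\<Sum>n\<in>J. \<Sum>x\<in>F n. h x)" for h :: "'a \<Rightarrow> real"
      using J fin disj by (intro sum.UNION_disjoint) (auto simp: disjoint_family_on_def)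
    have "(\<Sum>x\<in>G. (cmod (?T x))\<^sup>2) = (\<Sum>x\<in>G \<inter> ?U. (cmod (?T x))\<^sup>2)"
    proof (rule sum.mono_neutral_right)
      show "\<forall>x\<in>G - G \<inter> ?U. (cmod (?T x))\<^sup>2 = 0"
      proof
        fix x assume "x \<in> G - G \<inter> ?U"
        then have "x \<notin> (\<Union>n. F n)" by (auto simp: J_def)
        then show "(cmod (?T x))\<^sup>2 = 0" by (simp add: block_op_out)
      qed
    qed (use G in auto)
    also have "\<dots> \<le> (\<Sum>x\<in>?U. (cmod (?T x))\<^sup>2)" using U by (intro sum_mono2) auto
    also have "\<dots> = (\<Sum>n\<in>J. \<Sum>x\<in>F n. (cmod (?T x))\<^sup>2)" by (rule split)
    also have "\<dots> \<le> (\<Sum>n\<in>J. C\<^sup>2 * (\<Sum>x\<in>F n. (cmod (f x))\<^sup>2))" by (intro sum_mono block)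
    also have "\<dots> = C\<^sup>2 * (\<Sum>x\<in>?U. (cmod (f x))\<^sup>2)" by (simp only: split sum_distrib_left)
    finally have "(\<Sum>x\<in>G. (cmod (?T x))\<^sup>2) \<le> C\<^sup>2 * (\<Sum>x\<in>?U. (cmod (f x))\<^sup>2)" .
    then have "L2_set (\<lambda>x. cmod (?T x)) G \<le> C * L2_set (\<lambda>x. cmod (f x)) ?U"
      unfolding L2_set_def using C by (metis real_sqrt_abs abs_of_nonneg real_sqrt_le_mono real_sqrt_mult)
    also have "\<dots> \<le> C * l2norm f" by (rule mult_left_mono[OF L2_set_cmod_le_l2norm[OF f U] C])
    finally show ?thesis .
  qed
  show "?T \<in> l2" by (rule l2I(1)[OF le])
  show "l2norm ?T \<le> C * l2norm f" by (rule l2I(2)[OF le])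
qed

lemma bounded_op_block_op:
  assumes C: "0 \<le> C"
    and bound: "\<And>n h. (\<Sum>x\<in>F n. (\<Sum>y\<in>F n. g x y * h y)\<^sup>2) \<le> C\<^sup>2 * (\<Sum>x\<in>F n. (h x)\<^sup>2)"
  shows "bounded_op (block_op F g)"
  unfolding bounded_op_def
proof (intro conjI ballI allI)
  fix f h :: "'a \<Rightarrow> complex" and c
  show "block_op F g (\<lambda>x. f x + h x) = (\<lambda>x. block_op F g f x + block_op F g h x)"
    by (auto simp: block_op_def distrib_left sum.distrib)
  show "block_op F g (\<lambda>x. c * f x) = (\<lambda>x. c * block_op F g f x)"
    by (auto simp: block_op_def sum_distrib_left mult_ac)
  show "f \<in> l2 \<Longrightarrow> block_op F g f \<in> l2" by (rule block_op_l2[OF C bound])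
  show "\<exists>C. \<forall>f\<in>l2. l2norm (block_op F g f) \<le> C * l2norm f"
    using l2norm_block_op[OF C bound] by blast
qed

lemma block_op_diff:
  "(\<lambda>f x. block_op F g f x - block_op F h f x) = block_op F (\<lambda>x y. g x y - h x y)"
  by (auto simp: block_op_def sum_subtractf left_diff_distrib)

end

section \<open>Functional calculus on the blocks\<close>

locale spectral_block_family = block_family F
  for F :: "nat \<Rightarrow> 'a set" +
  fixes u :: "nat \<Rightarrow> 'a \<Rightarrow> 'a \<Rightarrow> real" and b :: "nat \<Rightarrow> 'a \<Rightarrow> real"
  assumes orth: "\<And>n. orthonormal_basis_on (F n) (u n)"
    and spectrum: "\<And>n i. i \<in> F n \<Longrightarrow> 0 \<le> b n i \<and> b n i \<le> 1"
begin

text \<open>Functional calculus on every block; arbitrary (\<open>THE\<close>) when \<open>x\<close> lies in no block.\<close>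

definition calc :: "(real \<Rightarrow> real) \<Rightarrow> 'a \<Rightarrow> 'a \<Rightarrow> real" where
  "calc \<phi> x y = (let n = (THE n. x \<in> F n) in \<Sum>i\<in>F n. \<phi> (b n i) * u n i x * u n i y)"

lemma calc_eq: "x \<in> F n \<Longrightarrow> calc \<phi> x y = (\<Sum>i\<in>F n. \<phi> (b n i) * u n i x * u n i y)"
proof -
  assume x: "x \<in> F n"
  then have "(THE n. x \<in> F n) = n" using index_unique by blast
  then show ?thesis by (simp add: calc_def)
qed

lemma calc_diff: "calc \<phi> x y - calc \<psi> x y = calc (\<lambda>t. \<phi> t - \<psi> t) x y"
  by (simp add: calc_def Let_def sum_subtractf left_diff_distrib)

lemma calc_bound:
  assumes "\<And>t. 0 \<le> t \<Longrightarrow> t \<le> 1 \<Longrightarrow> \<bar>\<phi> t\<bar> \<le> C"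
  shows "(\<Sum>x\<in>F n. (\<Sum>y\<in>F n. calc \<phi> x y * h y)\<^sup>2) \<le> C\<^sup>2 * (\<Sum>x\<in>F n. (h x)\<^sup>2)"
proof -
  have "(\<Sum>x\<in>F n. (\<Sum>y\<in>F n. calc \<phi> x y * h y)\<^sup>2)
      = (\<Sum>x\<in>F n. (\<Sum>y\<in>F n. (\<Sum>i\<in>F n. \<phi> (b n i) * u n i x * u n i y) * h y)\<^sup>2)"
    by (simp add: calc_eq)
  also have "\<dots> \<le> C\<^sup>2 * (\<Sum>x\<in>F n. (h x)\<^sup>2)"
    using assms spectrum by (intro spectral_norm_bound fin orth) auto
  finally show ?thesis .
qed

lemma finite_prop_calc_polynomial:
  assumes d: "ext_metric d" and R: "0 \<le> R"
    and supp: "\<And>n x y. x \<in> F n \<Longrightarrow> y \<in> F n \<Longrightarrow> (\<Sum>i\<in>F n. b n i * u n i x * u n i y) \<noteq> 0 \<Longrightarrow> d x y \<le> ereal R"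
    and p: "p = (\<lambda>t. \<Sum>j\<le>m. a j * t ^ j)" and C: "\<And>t. 0 \<le> t \<Longrightarrow> t \<le> 1 \<Longrightarrow> \<bar>p t\<bar> \<le> C"
  shows "finite_prop_op d (block_op F (calc p))"
  unfolding finite_prop_op_def
proof
  have "0 \<le> C" using C[of 0] by linarith
  then show "bounded_op (block_op F (calc p))" by (rule bounded_op_block_op[OF _ calc_bound[OF C]])
  have "prop_le d (real m * R) (block_op F (calc p))"
    unfolding prop_le_def
  proof (intro allI impI)
    fix x y assume "matrix_coeff (block_op F (calc p)) x y \<noteq> 0"
    then obtain n where n: "x \<in> F n" "y \<in> F n" and nz: "calc p x y \<noteq> 0"
      by (auto simp: matrix_coeff_block_op split: if_splits)
    have "calc p x y = (\<Sum>i\<in>F n. \<Sum>j\<le>m. a j * (b n i ^ j * u n i x * u n i y))"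
      using n by (simp add: calc_eq p sum_distrib_right mult.assoc)
    also have "\<dots> = (\<Sum>j\<le>m. \<Sum>i\<in>F n. a j * (b n i ^ j * u n i x * u n i y))" by (rule sum.swap)
    also have "\<dots> = (\<Sum>j\<le>m. a j * (\<Sum>i\<in>F n. b n i ^ j * u n i x * u n i y))"
      by (simp only: sum_distrib_left)
    finally have "(\<Sum>j\<le>m. a j * (\<Sum>i\<in>F n. b n i ^ j * u n i x * u n i y)) \<noteq> 0" using nz by simp
    then obtain j where j: "j \<in> {..m}" "a j * (\<Sum>i\<in>F n. b n i ^ j * u n i x * u n i y) \<noteq> 0"
      by (rule sum.not_neutral_contains_not_neutral)
    then have "d x y \<le> ereal (real j * R)"
      by (intro spectral_power_support[OF fin orth d supp n]) auto
    also have "\<dots> \<le> ereal (real m * R)" using j R by (simp add: mult_right_mono)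
    finally show "d x y \<le> ereal (real m * R)" .
  qed
  then show "\<exists>R\<ge>0. prop_le d R (block_op F (calc p))" using R by (intro exI[of _ "real m * R"]) simp
qed

text \<open>All spectra lie in the unit interval, so one Weierstrass polynomial approximates on all
  blocks at once: the norm error is the uniform error, and the propagation depends only on the
  degree and \<open>R\<close>.\<close>

lemma uniform_roe_calc:
  assumes d: "ext_metric d" and R: "0 \<le> R"
    and supp: "\<And>n x y. x \<in> F n \<Longrightarrow> y \<in> F n \<Longrightarrow> (\<Sum>i\<in>F n. b n i * u n i x * u n i y) \<noteq> 0 \<Longrightarrow> d x y \<le> ereal R"
    and cont: "continuous_on {0..1} \<phi>" and C: "\<And>t. 0 \<le> t \<Longrightarrow> t \<le> 1 \<Longrightarrow> \<bar>\<phi> t\<bar> \<le> C"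
  shows "uniform_roe d (block_op F (calc \<phi>))"
  unfolding uniform_roe_def
proof (intro conjI allI impI)
  have C0: "0 \<le> C" using C[of 0] by linarith
  then show "bounded_op (block_op F (calc \<phi>))" by (rule bounded_op_block_op[OF _ calc_bound[OF C]])
  fix e :: real assume e: "0 < e"
  then have e2: "0 < e / 2" by simp
  obtain p where "real_polynomial_function p" and p: "\<And>t. t \<in> {0..1} \<Longrightarrow> \<bar>\<phi> t - p t\<bar> < e / 2"
    using Stone_Weierstrass_real_polynomial_function[OF compact_Icc cont e2] by metis
  then obtain a m where am: "p = (\<lambda>t. \<Sum>j\<le>m. a j * t ^ j)"
    using real_polynomial_function_iff_sum by blast
  have pC: "\<bar>p t\<bar> \<le> C + e / 2" if "0 \<le> t" "t \<le> 1" for t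
  proof -
    have "\<bar>\<phi> t - p t\<bar> < e / 2" using p[of t] that by simp
    with C[OF that] show ?thesis by linarith
  qed
  have diff: "\<bar>\<phi> t - p t\<bar> \<le> e / 2" if "0 \<le> t" "t \<le> 1" for t
    using p[of t] that by auto
  have "op_norm (block_op F (calc (\<lambda>t. \<phi> t - p t))) \<le> e / 2"
    using e2 by (intro op_norm_le l2norm_block_op calc_bound diff) auto
  then have "op_norm (\<lambda>f x. block_op F (calc \<phi>) f x - block_op F (calc p) f x) < e"
    using e by (simp add: block_op_diff calc_diff)
  moreover have "finite_prop_op d (block_op F (calc p))"
    by (rule finite_prop_calc_polynomial[OF d R supp am pC])
  ultimately show "\<exists>S. finite_prop_op d S \<and> op_norm (\<lambda>f x. block_op F (calc \<phi>) f x - S f x) < e"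
    by blast
qed

text \<open>Only eigenvectors with eigenvalue at least \<open>s\<close> contribute; Cauchy-Schwarz
  bounds their products by the tails at \<open>x\<close> and \<open>y\<close>.\<close>

lemma calc_entry_bound:
  assumes x: "x \<in> F n" and y: "y \<in> F n" and \<phi>: "\<And>t. \<bar>\<phi> t\<bar> \<le> 1" "\<And>t. t < s \<Longrightarrow> \<phi> t = 0"
    and tail: "\<And>x. x \<in> F n \<Longrightarrow> (\<Sum>i | i \<in> F n \<and> s \<le> b n i. (u n i x)\<^sup>2) \<le> q"
  shows "\<bar>calc \<phi> x y\<bar> \<le> q"
proof -
  let ?I = "{i. i \<in> F n \<and> s \<le> b n i}"
  have q: "0 \<le> q" using tail[OF x] sum_nonneg[of ?I "\<lambda>i. (u n i x)\<^sup>2"] by force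
  have "\<bar>calc \<phi> x y\<bar> = \<bar>\<Sum>i\<in>F n. \<phi> (b n i) * u n i x * u n i y\<bar>" by (simp add: calc_eq[OF x])
  also have "\<dots> = \<bar>\<Sum>i\<in>?I. \<phi> (b n i) * u n i x * u n i y\<bar>"
    using fin[of n] \<phi>(2) by (intro arg_cong[where f = abs] sum.mono_neutral_right) (auto simp: not_le)
  also have "\<dots> \<le> (\<Sum>i\<in>?I. \<bar>\<phi> (b n i) * u n i x * u n i y\<bar>)" by (rule sum_abs)
  also have "\<dots> \<le> (\<Sum>i\<in>?I. \<bar>u n i x\<bar> * \<bar>u n i y\<bar>)"
  proof (rule sum_mono)
    fix i
    have "\<bar>\<phi> (b n i)\<bar> * (\<bar>u n i x\<bar> * \<bar>u n i y\<bar>) \<le> 1 * (\<bar>u n i x\<bar> * \<bar>u n i y\<bar>)"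
      by (intro mult_right_mono \<phi>) simp
    then show "\<bar>\<phi> (b n i) * u n i x * u n i y\<bar> \<le> \<bar>u n i x\<bar> * \<bar>u n i y\<bar>"
      by (simp add: abs_mult mult.assoc)
  qed
  also have "\<dots> \<le> q"
  proof (rule power2_le_imp_le[OF _ q])
    have "(\<Sum>i\<in>?I. \<bar>u n i x\<bar> * \<bar>u n i y\<bar>)\<^sup>2 \<le> (\<Sum>i\<in>?I. \<bar>u n i x\<bar>\<^sup>2) * (\<Sum>i\<in>?I. \<bar>u n i y\<bar>\<^sup>2)"
      by (rule Cauchy_Schwarz_ineq_sum)
    also have "\<dots> \<le> q * q" using tail[OF x] tail[OF y] q by (intro mult_mono) (auto intro: sum_nonneg)
    finally show "(\<Sum>i\<in>?I. \<bar>u n i x\<bar> * \<bar>u n i y\<bar>)\<^sup>2 \<le> q\<^sup>2" by (simp add: power2_eq_square)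
  qed
  finally show ?thesis .
qed

text \<open>Each block contributes a fixed unit vector. Their supports are disjoint, so they are at
  mutual distance at least 1, and no point of a finite net at scale 1/2 can serve two of
  them.\<close>

lemma not_compact_calc:
  assumes top: "\<And>n. \<exists>i\<in>F n. \<phi> (b n i) = 1"
  shows "\<not> compact_op (block_op F (calc \<phi>))"
proof
  assume "compact_op (block_op F (calc \<phi>))"
  then obtain G where G: "finite G" "G \<subseteq> l2"
    and net: "\<And>f. f \<in> l2 \<Longrightarrow> l2norm f \<le> 1 \<Longrightarrow> \<exists>g\<in>G. l2norm (\<lambda>x. block_op F (calc \<phi>) f x - g x) < 1 / 2"
    unfolding compact_op_def by (metis half_gt_zero zero_less_one)
  obtain i where i: "\<And>n. i n \<in> F n" "\<And>n. \<phi> (b n (i n)) = 1" using top by metis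
  define v where "v n x = (if x \<in> F n then complex_of_real (u n (i n) x) else 0)" for n x
  have one: "L2_set (\<lambda>x. cmod (v n x)) (F n) = 1" for n
    using orthonormal_basis_on_row[OF orth i(1) i(1), of n]
    by (simp add: L2_set_def v_def power2_eq_square[symmetric])
  have v: "v n \<in> l2" "l2norm (v n) = 1" for n
    using l2_finite_support[OF fin[of n], of "v n"] l2norm_finite_support[OF fin[of n], of "v n"] one[of n]
    by (auto simp: v_def)
  have fixed: "block_op F (calc \<phi>) (v n) = v n" for n
  proof
    fix x
    consider "x \<in> F n" | m where "x \<in> F m" "m \<noteq> n" | "x \<notin> (\<Union>n. F n)" by blast
    then show "block_op F (calc \<phi>) (v n) x = v n x"
    proof cases
      case 1
      have "(\<Sum>y\<in>F n. calc \<phi> x y * u n (i n) y)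
          = (\<Sum>y\<in>F n. u n (i n) y * (\<Sum>j\<in>F n. (\<phi> (b n j) * u n j x) * u n j y))"
        by (simp add: calc_eq[OF 1] mult.commute)
      also have "\<dots> = u n (i n) x"
        using orthonormal_basis_on_coeff[OF fin orth i(1), of n "\<lambda>j. \<phi> (b n j) * u n j x"] by (simp add: i(2))
      finally have "(\<Sum>y\<in>F n. calc \<phi> x y * u n (i n) y) = u n (i n) x" .
      then have "(\<Sum>y\<in>F n. complex_of_real (calc \<phi> x y) * v n y) = complex_of_real (u n (i n) x)"
        by (simp add: v_def flip: of_real_mult of_real_sum)
      then show ?thesis using 1 by (simp add: block_op_in v_def)
    next
      case 2
      have "y \<notin> F n" if "y \<in> F m" for y using index_unique[of y m n] 2 that by blast
      then show ?thesis using 2 index_unique[of x m n] by (auto simp: block_op_in[OF 2(1)] v_def)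
    next
      case 3
      then show ?thesis using block_op_out[OF 3] by (auto simp: v_def)
    qed
  qed
  have "\<forall>n. \<exists>g\<in>G. l2norm (\<lambda>x. v n x - g x) < 1 / 2"
    using net[OF v(1)] v(2) fixed by simp
  then obtain g where g: "\<And>n. g n \<in> G" "\<And>n. l2norm (\<lambda>x. v n x - g n x) < 1 / 2" by metis
  have "finite (range g)" using G(1) g(1) by (meson finite_subset image_subsetI)
  then have "\<not> inj g" using finite_imageD infinite_UNIV_nat by blast
  then obtain m n where mn: "m \<noteq> n" "g m = g n" by (auto simp: inj_def)
  have dl: "(\<lambda>x. v n x - g n x) \<in> l2" for n using v(1) g(1) G(2) by (intro l2_diff) auto
  have eq: "(\<lambda>x. (v m x - g m x) - (v n x - g n x)) = (\<lambda>x. v m x - v n x)"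
    using mn by (auto simp: algebra_simps)
  have "l2norm (\<lambda>x. v m x - v n x) < 1"
    using l2norm_diff_triangle[OF dl[of m] dl[of n]] g(2)[of m] g(2)[of n] unfolding eq by simp
  moreover have "1 \<le> l2norm (\<lambda>x. v m x - v n x)"
  proof -
    have "L2_set (\<lambda>x. cmod (v m x - v n x)) (F m) = L2_set (\<lambda>x. cmod (v m x)) (F m)"
      using index_unique[of _ m n] mn(1) unfolding L2_set_def
      by (intro arg_cong[where f = sqrt] sum.cong refl) (auto simp: v_def)
    then show ?thesis
      using L2_set_cmod_le_l2norm[OF l2_diff[OF v(1) v(1)] fin, of m n m] one[of m] by simp
  qed
  ultimately show False by simp
qed

end

subsection \<open>The noncompact ghost\<close>

lemma ghost_not_compact_of_not_property_A:
  assumes d: "ext_metric d" and bg: "bounded_geometry d" and no: "\<not> property_A d"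
  shows "\<exists>T. ghost d T \<and> \<not> compact_op T"
proof -
  obtain R e where R: "0 < R" and e: "0 < e" "e < 1"
    and obstr: "\<And>S. \<exists>F::nat \<Rightarrow> 'a set. (\<forall>n. finite (F n)) \<and> disjoint_family F \<and>
      (\<forall>n. \<nexists>k. almost_unit_kernel d (F n) (S n) R e k)"
    using disjoint_finite_obstructions[OF d no] by metis
  obtain N0 :: nat where N0: "\<And>x. finite {y. d x y \<le> ereal R} \<and> card {y. d x y \<le> ereal R} \<le> N0"
    using bg R unfolding bounded_geometry_def by blast
  define N where "N = max 1 (real N0)"
  have N1: "1 \<le> N" by (simp add: N_def)
  have N: "real (card {y \<in> F. d x y \<le> ereal R}) \<le> N" for x F
  proof -
    have "card {y \<in> F. d x y \<le> ereal R} \<le> card {y. d x y \<le> ereal R}"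
      using N0[of x] by (intro card_mono) auto
    also have "\<dots> \<le> N0" using N0[of x] by simp
    finally show ?thesis by (simp add: N_def)
  qed
  \<comment> \<open>Room for the \<open>n\<close>-th power on block \<open>n\<close>; the maximum
    with \<open>R\<close> ensures \<open>R \<le> S 0\<close>.\<close>
  define S where "S n = max R (2 * (real n * R))" for n
  obtain F :: "nat \<Rightarrow> 'a set" where fin: "\<And>n. finite (F n)" and disj: "disjoint_family F"
    and none: "\<And>n. \<nexists>k. almost_unit_kernel d (F n) (S n) R e k"
    using obstr[of S] by auto
  \<comment> \<open>The block lemma is applied with \<open>e / 2\<close>, because it assumes an
    obstruction with twice its own parameter.\<close>
  define k2 where "k2 = (N + 1 / (1 - e / 2 / 2)) / (2 * N)"
  define k0 where "k0 = (N + 1) / (2 * N)"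
  define P where "P n u b \<longleftrightarrow> orthonormal_basis_on (F n) u \<and> (\<forall>i\<in>F n. 0 \<le> b i \<and> b i \<le> 1) \<and>
    (\<forall>x\<in>F n. \<forall>y\<in>F n. (\<Sum>i\<in>F n. b i * u i x * u i y) \<noteq> 0 \<longrightarrow> d x y \<le> ereal R) \<and>
    (\<exists>i\<in>F n. k2 \<le> b i) \<and>
    (\<forall>x\<in>F n. \<forall>s>0. (\<Sum>i | i \<in> F n \<and> s \<le> b i. (u i x)\<^sup>2) \<le> (k0 / s) ^ (2 * n))" for n u b
  have "\<exists>u b. P n u b" for n
  proof -
    have none': "\<nexists>k. almost_unit_kernel d (F n) (S n) R (2 * (e / 2)) k" using none[of n] by simp
    have RS: "R \<le> S n" "2 * (real n * R) \<le> S n" by (simp_all add: S_def)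
    have e2: "0 < e / 2" "e / 2 < 1" using e by auto
    show ?thesis
      by (rule spectral_block_of_no_kernel[OF fin[of n] d e2 less_imp_le[OF R] RS(1) N1 N RS(2) none'])
         (unfold P_def k2_def k0_def, blast)
  qed
  then obtain u b where P: "\<And>n. P n (u n) (b n)" by metis
  have orth: "\<And>n. orthonormal_basis_on (F n) (u n)"
    and b: "\<And>n i. i \<in> F n \<Longrightarrow> 0 \<le> b n i \<and> b n i \<le> 1"
    and supp: "\<And>n x y. x \<in> F n \<Longrightarrow> y \<in> F n \<Longrightarrow> (\<Sum>i\<in>F n. b n i * u n i x * u n i y) \<noteq> 0 \<Longrightarrow> d x y \<le> ereal R"
    and top: "\<And>n. \<exists>i\<in>F n. k2 \<le> b n i"
    and tail: "\<And>n x s. x \<in> F n \<Longrightarrow> 0 < s \<Longrightarrow>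
      (\<Sum>i | i \<in> F n \<and> s \<le> b n i. (u n i x)\<^sup>2) \<le> (k0 / s) ^ (2 * n)"
    using P unfolding P_def by blast+
  interpret spectral_block_family F u b
    by unfold_locales (use fin disj orth b in auto)
  have k0: "0 < k0" using N1 by (simp add: k0_def)
  have k02: "k0 < k2"
  proof -
    have "1 < 1 / (1 - e / 2 / 2)" using e by simp
    then show ?thesis unfolding k0_def k2_def using N1 by (intro divide_strict_right_mono) auto
  qed
  define k1 where "k1 = (k0 + k2) / 2"
  have k1: "k0 < k1" "k1 < k2" using k02 by (auto simp: k1_def)
  \<comment> \<open>Linear between \<open>k1\<close> and \<open>k2\<close>. Cutting off at
    \<open>k1\<close> rather than at \<open>k0\<close> leaves the ratio \<open>k0 / k1 < 1\<close>,
    which drives the decay of the entries.\<close>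
  define \<phi> where "\<phi> t = max 0 (min 1 ((t - k1) / (k2 - k1)))" for t
  have \<phi>1: "\<bar>\<phi> t\<bar> \<le> 1" for t by (simp add: \<phi>_def)
  have \<phi>0: "\<phi> t = 0" if "t < k1" for t
  proof -
    have "(t - k1) / (k2 - k1) \<le> 0" using that k1 by (simp add: divide_le_0_iff)
    then show ?thesis by (simp add: \<phi>_def)
  qed
  have \<phi>top: "\<phi> t = 1" if "k2 \<le> t" for t
  proof -
    have "1 \<le> (t - k1) / (k2 - k1)" using that k1 by simp
    then show ?thesis by (simp add: \<phi>_def)
  qed
  have cont: "continuous_on {0..1} \<phi>"
    unfolding \<phi>_def using k1 by (intro continuous_intros) auto
  let ?T = "block_op F (calc \<phi>)"
  have roe: "uniform_roe d ?T"
    by (rule uniform_roe_calc[OF d less_imp_le[OF R] supp cont \<phi>1])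
  define q where "q = (k0 / k1)\<^sup>2"
  have q: "0 \<le> q" "q < 1" 
    using k0 k1 power_strict_mono[of "k0 / k1" 1 2] by (auto simp: q_def)
  have entry: "\<bar>calc \<phi> x y\<bar> \<le> q ^ n" if "x \<in> F n" "y \<in> F n" for x y n
  proof (rule calc_entry_bound[OF that \<phi>1 \<phi>0])
    show "(\<Sum>i | i \<in> F n \<and> k1 \<le> b n i. (u n i x)\<^sup>2) \<le> q ^ n" if "x \<in> F n" for x
      using tail[OF that, of k1] k0 k1 by (simp add: q_def power_mult)
  qed
  have "\<exists>G. finite G \<and> (\<forall>x y. (x \<notin> G \<or> y \<notin> G) \<longrightarrow> cmod (matrix_coeff ?T x y) < \<epsilon>)" if \<epsilon>: "0 < \<epsilon>" for \<epsilon>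
  proof -
    obtain m where m: "q ^ m < \<epsilon>" using real_arch_pow_inv[OF \<epsilon> q(2)] by blast
    have "cmod (matrix_coeff ?T x y) < \<epsilon>" if xy: "x \<notin> (\<Union>n<m. F n) \<or> y \<notin> (\<Union>n<m. F n)" for x y
    proof (cases "\<exists>n. x \<in> F n \<and> y \<in> F n")
      case True
      then obtain n where n: "x \<in> F n" "y \<in> F n" by blast
      then have "m \<le> n" using xy by (meson UN_I lessThan_iff not_le)
      then have "q ^ n \<le> q ^ m" using q by (intro power_decreasing) auto
      then show ?thesis using entry[OF n] m True by (simp add: matrix_coeff_block_op)
    next
      case False
      then show ?thesis using \<epsilon> by (simp only: matrix_coeff_block_op if_False norm_zero)
    qed
    moreover have "finite (\<Union>n<m. F n)" using fin by simp
    ultimately show ?thesis by blast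
  qed
  then have "ghost d ?T" using roe by (simp add: ghost_def)
  moreover have "\<not> compact_op ?T"
    using top \<phi>top by (intro not_compact_calc) blast
  ultimately show ?thesis by blast
qed

subsection \<open>Ghosts are compact under property A\<close>

text \<open>The operator norm of a bare matrix, stated this way because Schur products are first met
  as matrices and not as operators. Conjugating \<open>v\<close> changes no norm, so a bilinear form
  does as well as a sesquilinear one.\<close>

definition form_bounded :: "('a \<Rightarrow> 'a \<Rightarrow> complex) \<Rightarrow> real \<Rightarrow> bool" where
  "form_bounded t c \<longleftrightarrow> (\<forall>G u v. finite G \<longrightarrow>
     cmod (\<Sum>x\<in>G. \<Sum>y\<in>G. t x y * u y * v x)
     \<le> c * L2_set (\<lambda>x. cmod (u x)) G * L2_set (\<lambda>x. cmod (v x)) G)"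

lemma form_boundedD:
  "form_bounded t c \<Longrightarrow> finite G \<Longrightarrow>
    cmod (\<Sum>x\<in>G. \<Sum>y\<in>G. t x y * u y * v x)
     \<le> c * L2_set (\<lambda>x. cmod (u x)) G * L2_set (\<lambda>x. cmod (v x)) G"
  unfolding form_bounded_def by blast

lemma form_bounded_add:
  assumes s: "form_bounded s a" and t: "form_bounded t b"
  shows "form_bounded (\<lambda>x y. s x y + t x y) (a + b)"
  unfolding form_bounded_def
proof (intro allI impI)
  fix G :: "'a set" and u v :: "'a \<Rightarrow> complex"
  assume G: "finite G"
  have "(\<Sum>x\<in>G. \<Sum>y\<in>G. (s x y + t x y) * u y * v x)
    = (\<Sum>x\<in>G. \<Sum>y\<in>G. s x y * u y * v x) + (\<Sum>x\<in>G. \<Sum>y\<in>G. t x y * u y * v x)"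
    by (simp add: distrib_right sum.distrib)
  also have "cmod \<dots> \<le> cmod (\<Sum>x\<in>G. \<Sum>y\<in>G. s x y * u y * v x) + cmod (\<Sum>x\<in>G. \<Sum>y\<in>G. t x y * u y * v x)"
    by (rule norm_triangle_ineq)
  also have "\<dots> \<le> a * L2_set (\<lambda>x. cmod (u x)) G * L2_set (\<lambda>x. cmod (v x)) G
      + b * L2_set (\<lambda>x. cmod (u x)) G * L2_set (\<lambda>x. cmod (v x)) G"
    by (intro add_mono form_boundedD s t G)
  finally show "cmod (\<Sum>x\<in>G. \<Sum>y\<in>G. (s x y + t x y) * u y * v x)
      \<le> (a + b) * L2_set (\<lambda>x. cmod (u x)) G * L2_set (\<lambda>x. cmod (v x)) G"
    by (simp add: distrib_right)
qed

lemma form_bounded_uminus: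
  assumes "form_bounded t b"
  shows "form_bounded (\<lambda>x y. - t x y) b"
  using assms unfolding form_bounded_def by (simp add: sum_negf)

lemma form_bounded_mono: "form_bounded t a \<Longrightarrow> a \<le> b \<Longrightarrow> form_bounded t b"
  unfolding form_bounded_def
  by (meson L2_set_nonneg mult_right_mono order_trans)

lemma form_bounded_operator:
  assumes T: "bounded_op T" and C: "0 \<le> C" "\<And>f. f \<in> l2 \<Longrightarrow> l2norm (T f) \<le> C * l2norm f"
  shows "form_bounded (matrix_coeff T) C"
  unfolding form_bounded_def
proof (intro allI impI)
  fix G :: "'a set" and u v :: "'a \<Rightarrow> complex"
  assume G: "finite G"
  let ?u = "\<lambda>x. if x \<in> G then u x else 0"
  have u: "?u \<in> l2" using G by (intro l2_finite_support) auto
  have un: "l2norm ?u = L2_set (\<lambda>x. cmod (u x)) G"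
    using l2norm_finite_support[OF G, of ?u] by (simp add: L2_set_def)
  have Tu: "T ?u = (\<lambda>x. \<Sum>y\<in>G. matrix_coeff T x y * u y)"
    using bounded_op_finite_support[OF T G, of ?u] by simp
  have "(\<Sum>x\<in>G. \<Sum>y\<in>G. matrix_coeff T x y * u y * v x) = (\<Sum>x\<in>G. T ?u x * v x)"
    by (subst Tu) (simp only: sum_distrib_right)
  also have "cmod \<dots> \<le> (\<Sum>x\<in>G. \<bar>cmod (T ?u x)\<bar> * \<bar>cmod (v x)\<bar>)"
    by (rule order_trans[OF norm_sum]) (simp add: norm_mult)
  also have "\<dots> \<le> L2_set (\<lambda>x. cmod (T ?u x)) G * L2_set (\<lambda>x. cmod (v x)) G"
    by (rule L2_set_mult_ineq)
  also have "\<dots> \<le> C * L2_set (\<lambda>x. cmod (u x)) G * L2_set (\<lambda>x. cmod (v x)) G"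
  proof (rule mult_right_mono)
    have "L2_set (\<lambda>x. cmod (T ?u x)) G \<le> l2norm (T ?u)"
      by (rule L2_set_cmod_le_l2norm[OF bounded_op_l2[OF T u] G])
    also have "\<dots> \<le> C * l2norm ?u" by (rule C(2)[OF u])
    finally show "L2_set (\<lambda>x. cmod (T ?u x)) G \<le> C * L2_set (\<lambda>x. cmod (u x)) G" by (simp only: un)
  qed simp
  finally show "cmod (\<Sum>x\<in>G. \<Sum>y\<in>G. matrix_coeff T x y * u y * v x)
      \<le> C * L2_set (\<lambda>x. cmod (u x)) G * L2_set (\<lambda>x. cmod (v x)) G" .
qed

text \<open>Cauchy-Schwarz over the pairs at distance at most \<open>R\<close>: each point is the
  first, and by symmetry the second, member of at most \<open>N\<close> of them.\<close>

lemma form_bounded_banded: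
  assumes D: "\<And>x y. cmod (t x y) \<le> c" "\<And>x y. t x y \<noteq> 0 \<Longrightarrow> d x y \<le> ereal R" and d: "ext_metric d"
    and N: "\<And>x. finite {y. d x y \<le> ereal R} \<and> card {y. d x y \<le> ereal R} \<le> N" and c: "0 \<le> c"
  shows "form_bounded t (c * real N)"
  unfolding form_bounded_def
proof (intro allI impI)
  fix G :: "'a set" and u v :: "'a \<Rightarrow> complex"
  assume G: "finite G"
  let ?P = "{p \<in> G \<times> G. d (fst p) (snd p) \<le> ereal R}"
  have P: "finite ?P" using G by simp
  have row: "card {y \<in> G. d x y \<le> ereal R} \<le> N" for x
  proof -
    have "card {y \<in> G. d x y \<le> ereal R} \<le> card {y. d x y \<le> ereal R}"
      using N[of x] by (intro card_mono) auto
    then show ?thesis using N[of x] by linarith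
  qed
  have one: "(\<Sum>x\<in>G. \<Sum>y\<in>G. if d x y \<le> ereal R then (h x)\<^sup>2 else 0) \<le> real N * (\<Sum>x\<in>G. (h x)\<^sup>2)" for h :: "'a \<Rightarrow> real"
    unfolding sum_distrib_left
  proof (rule sum_mono)
    fix x assume "x \<in> G"
    have "(\<Sum>y\<in>G. if d x y \<le> ereal R then (h x)\<^sup>2 else 0) = real (card {y \<in> G. d x y \<le> ereal R}) * (h x)\<^sup>2"
      using G by (simp add: sum.If_cases Int_def)
    also have "\<dots> \<le> real N * (h x)\<^sup>2" using row[of x] by (intro mult_right_mono) auto
    finally show "(\<Sum>y\<in>G. if d x y \<le> ereal R then (h x)\<^sup>2 else 0) \<le> real N * (h x)\<^sup>2" .
  qed
  have Psum: "(\<Sum>p\<in>?P. h (fst p) (snd p)) = (\<Sum>x\<in>G. \<Sum>y\<in>G. if d x y \<le> ereal R then h x y else 0)"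
    for h :: "'a \<Rightarrow> 'a \<Rightarrow> real"
  proof -
    have "(\<Sum>p\<in>?P. h (fst p) (snd p)) = (\<Sum>p\<in>G \<times> G. if d (fst p) (snd p) \<le> ereal R then h (fst p) (snd p) else 0)"
      using G by (intro sum.mono_neutral_cong_left) auto
    then show ?thesis by (simp add: sum.cartesian_product case_prod_beta)
  qed
  have v: "L2_set (\<lambda>p. cmod (v (fst p))) ?P \<le> sqrt (real N) * L2_set (\<lambda>x. cmod (v x)) G"
    unfolding L2_set_def real_sqrt_mult[symmetric] Psum[of "\<lambda>x y. (cmod (v x))\<^sup>2"]
    by (intro real_sqrt_le_mono one)
  have u: "L2_set (\<lambda>p. cmod (u (snd p))) ?P \<le> sqrt (real N) * L2_set (\<lambda>x. cmod (u x)) G"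
  proof -
    have "(\<Sum>x\<in>G. \<Sum>y\<in>G. if d x y \<le> ereal R then (cmod (u y))\<^sup>2 else 0)
        = (\<Sum>x\<in>G. \<Sum>y\<in>G. if d x y \<le> ereal R then (cmod (u x))\<^sup>2 else 0)"
      by (subst sum.swap) (simp only: ext_metric_sym[OF d])
    then show ?thesis
      unfolding L2_set_def real_sqrt_mult[symmetric] Psum[of "\<lambda>x y. (cmod (u y))\<^sup>2"]
      using one[of "\<lambda>x. cmod (u x)"] by (intro real_sqrt_le_mono) simp
  qed
  have "cmod (\<Sum>x\<in>G. \<Sum>y\<in>G. t x y * u y * v x) \<le> (\<Sum>x\<in>G. \<Sum>y\<in>G. cmod (t x y * u y * v x))"
    by (rule order_trans[OF norm_sum]) (intro sum_mono norm_sum)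
  also have "\<dots> \<le> (\<Sum>x\<in>G. \<Sum>y\<in>G. if d x y \<le> ereal R then c * (cmod (u y) * cmod (v x)) else 0)"
  proof (intro sum_mono)
    fix x y
    have "cmod (t x y) * (cmod (u y) * cmod (v x)) \<le> c * (cmod (u y) * cmod (v x))"
      by (intro mult_right_mono D) simp
    then show "cmod (t x y * u y * v x) \<le> (if d x y \<le> ereal R then c * (cmod (u y) * cmod (v x)) else 0)"
      using D(2)[of x y] c by (cases "t x y = 0") (auto simp: norm_mult mult.assoc)
  qed
  also have "\<dots> = c * (\<Sum>p\<in>?P. cmod (u (snd p)) * cmod (v (fst p)))"
    unfolding sum_distrib_left Psum[of "\<lambda>x y. c * (cmod (u y) * cmod (v x))"] ..
  also have "\<dots> = c * (\<Sum>p\<in>?P. \<bar>cmod (u (snd p))\<bar> * \<bar>cmod (v (fst p))\<bar>)"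
    by simp
  also have "\<dots> \<le> c * ((sqrt (real N) * L2_set (\<lambda>x. cmod (u x)) G) * (sqrt (real N) * L2_set (\<lambda>x. cmod (v x)) G))"
    by (intro mult_left_mono c order_trans[OF L2_set_mult_ineq] mult_mono u v) simp_all
  also have "\<dots> = c * real N * L2_set (\<lambda>x. cmod (u x)) G * L2_set (\<lambda>x. cmod (v x)) G"
  proof -
    have "c * ((s * a) * (s * b)) = c * (s * s) * a * b" for s a b :: real by (simp only: mult_ac)
    then show ?thesis by simp
  qed
  finally show "cmod (\<Sum>x\<in>G. \<Sum>y\<in>G. t x y * u y * v x)
      \<le> c * real N * L2_set (\<lambda>x. cmod (u x)) G * L2_set (\<lambda>x. cmod (v x)) G" .
qed

text \<open>The eigenvalues are values of the form and hence nonnegative; their square roots are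
  absorbed into the eigenvectors.\<close>

lemma pos_def_kernel_gram:
  assumes G: "finite G" and k: "pos_def_kernel k"
  obtains w where "\<And>x y. x \<in> G \<Longrightarrow> y \<in> G \<Longrightarrow> k x y = (\<Sum>i\<in>G. w i x * w i y)"
proof -
  obtain u b where u: "orthonormal_basis_on G u"
    and k_eq: "\<And>x y. x \<in> G \<Longrightarrow> y \<in> G \<Longrightarrow> k x y = (\<Sum>i\<in>G. b i * u i x * u i y)"
    by (rule symmetric_diagonalization[OF G, of k]) (use pos_def_kernel_sym[OF k] in blast)+
  have b: "0 \<le> b i" if i: "i \<in> G" for i
  proof -
    have "0 \<le> (\<Sum>x\<in>G. \<Sum>y\<in>G. u i x * u i y * k x y)" by (rule pos_def_kernel_form_nonneg[OF k G])
    also have "\<dots> = (\<Sum>x\<in>G. \<Sum>y\<in>G. k x y * u i x * u i y)" by (simp only: mult_ac)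
    also have "\<dots> = (\<Sum>j\<in>G. b j * (\<Sum>x\<in>G. u j x * u i x)\<^sup>2)" by (rule spectral_quadratic_form[OF k_eq])
    also have "\<dots> = (\<Sum>j\<in>G. if i = j then b j else 0)"
      using orthonormal_basis_on_row[OF u _ i] by (intro sum.cong) auto
    finally show ?thesis using G i by simp
  qed
  have "k x y = (\<Sum>i\<in>G. (sqrt (b i) * u i x) * (sqrt (b i) * u i y))" if "x \<in> G" "y \<in> G" for x y
    unfolding k_eq[OF that]
  proof (rule sum.cong[OF refl])
    fix i assume "i \<in> G"
    have "(sqrt (b i) * u i x) * (sqrt (b i) * u i y) = (sqrt (b i) * sqrt (b i)) * u i x * u i y"
      by (simp only: mult_ac)
    then show "b i * u i x * u i y = (sqrt (b i) * u i x) * (sqrt (b i) * u i y)"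
      using b[OF \<open>i \<in> G\<close>] by simp
  qed
  then show ?thesis by (rule that)
qed

text \<open>A Gram decomposition of \<open>k\<close> splits the form into forms of \<open>t\<close>
  at the vectors \<open>w i * u\<close> and \<open>w i * v\<close>. As \<open>k x x\<close> is at
  most 1, their squared norms add up to at most those of \<open>u\<close> and
  \<open>v\<close>.\<close>

lemma form_bounded_schur_multiplier:
  assumes k: "pos_def_kernel k" and k1: "\<And>x. k x x \<le> 1" and t: "form_bounded t c" and c: "0 \<le> c"
  shows "form_bounded (\<lambda>x y. complex_of_real (k x y) * t x y) c"
  unfolding form_bounded_def
proof (intro allI impI)
  fix G :: "'a set" and u v :: "'a \<Rightarrow> complex"
  assume G: "finite G"
  obtain w where w: "\<And>x y. x \<in> G \<Longrightarrow> y \<in> G \<Longrightarrow> k x y = (\<Sum>i\<in>G. w i x * w i y)"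
    using pos_def_kernel_gram[OF G k] by blast
  let ?n = "\<lambda>u i. L2_set (\<lambda>x. cmod (complex_of_real (w i x) * u x)) G"
  have L2: "L2_set (?n u) G \<le> L2_set (\<lambda>x. cmod (u x)) G" for u
  proof -
    have "(\<Sum>i\<in>G. (?n u i)\<^sup>2) = (\<Sum>i\<in>G. \<Sum>x\<in>G. (w i x * w i x) * (cmod (u x))\<^sup>2)"
      by (simp add: L2_set_def sum_nonneg norm_mult power_mult_distrib flip: power2_eq_square)
    also have "\<dots> = (\<Sum>x\<in>G. \<Sum>i\<in>G. (w i x * w i x) * (cmod (u x))\<^sup>2)" by (rule sum.swap)
    also have "\<dots> = (\<Sum>x\<in>G. k x x * (cmod (u x))\<^sup>2)"
      by (intro sum.cong refl) (simp add: w sum_distrib_right)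
    also have "\<dots> \<le> (\<Sum>x\<in>G. 1 * (cmod (u x))\<^sup>2)" by (intro sum_mono mult_right_mono k1) simp
    finally show ?thesis unfolding L2_set_def[of "?n u"] L2_set_def[of "\<lambda>x. cmod (u x)"] by simp
  qed
  have "(\<Sum>x\<in>G. \<Sum>y\<in>G. complex_of_real (k x y) * t x y * u y * v x)
      = (\<Sum>x\<in>G. \<Sum>y\<in>G. \<Sum>i\<in>G. t x y * (complex_of_real (w i y) * u y) * (complex_of_real (w i x) * v x))"
    by (intro sum.cong refl) (simp add: w sum_distrib_left sum_distrib_right mult_ac)
  also have "\<dots> = (\<Sum>x\<in>G. \<Sum>i\<in>G. \<Sum>y\<in>G. t x y * (complex_of_real (w i y) * u y) * (complex_of_real (w i x) * v x))"
    by (rule sum.cong[OF refl], rule sum.swap)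
  also have "\<dots> = (\<Sum>i\<in>G. \<Sum>x\<in>G. \<Sum>y\<in>G. t x y * (complex_of_real (w i y) * u y) * (complex_of_real (w i x) * v x))"
    by (rule sum.swap)
  also have "cmod \<dots> \<le> (\<Sum>i\<in>G. c * ?n u i * ?n v i)"
    by (rule order_trans[OF norm_sum]) (intro sum_mono form_boundedD[OF t G])
  also have "\<dots> = c * (\<Sum>i\<in>G. \<bar>?n u i\<bar> * \<bar>?n v i\<bar>)"
    by (simp add: sum_distrib_left mult.assoc)
  also have "\<dots> \<le> c * (L2_set (\<lambda>x. cmod (u x)) G * L2_set (\<lambda>x. cmod (v x)) G)"
    by (intro mult_left_mono c order_trans[OF L2_set_mult_ineq] mult_mono L2) simp_all
  finally show "cmod (\<Sum>x\<in>G. \<Sum>y\<in>G. complex_of_real (k x y) * t x y * u y * v x)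
      \<le> c * L2_set (\<lambda>x. cmod (u x)) G * L2_set (\<lambda>x. cmod (v x)) G" by (simp add: mult.assoc)
qed

section \<open>Finite matrices and finite nets\<close>

lemma cmod_le_l2norm: "f \<in> l2 \<Longrightarrow> cmod (f x) \<le> l2norm f"
  using L2_set_cmod_le_l2norm[of f "{x}"] by simp

lemma matrix_coeff_bound:
  assumes T: "bounded_op T" and C: "\<And>f. f \<in> l2 \<Longrightarrow> l2norm (T f) \<le> C * l2norm f"
  shows "cmod (matrix_coeff T x y) \<le> C"
proof -
  have "l2norm (delta y) = 1"
    using l2norm_finite_support[of "{y}" "delta y"] by (simp add: delta_def)
  then show ?thesis
    using cmod_le_l2norm[OF bounded_op_l2[OF T l2_delta], of y x] C[OF l2_delta, of y]
    by (simp add: matrix_coeff_def)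
qed

definition finite_matrix_op :: "'a set \<Rightarrow> ('a \<Rightarrow> 'a \<Rightarrow> complex) \<Rightarrow> ('a \<Rightarrow> complex) \<Rightarrow> 'a \<Rightarrow> complex" where
  "finite_matrix_op F t f = (\<lambda>x. if x \<in> F then \<Sum>y\<in>F. t x y * f y else 0)"

lemma
  assumes F: "finite F" and f: "f \<in> l2"
  shows finite_matrix_op_l2: "finite_matrix_op F t f \<in> l2"
    and l2norm_finite_matrix_op:
      "l2norm (finite_matrix_op F t f) \<le> (\<Sum>x\<in>F. \<Sum>y\<in>F. cmod (t x y)) * l2norm f"
proof -
  show "finite_matrix_op F t f \<in> l2"
    by (rule l2_finite_support[OF F]) (simp add: finite_matrix_op_def)
  have "l2norm (finite_matrix_op F t f) = L2_set (\<lambda>x. cmod (finite_matrix_op F t f x)) F"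
    by (rule l2norm_finite_support[OF F]) (simp add: finite_matrix_op_def)
  also have "\<dots> \<le> (\<Sum>x\<in>F. cmod (finite_matrix_op F t f x))"
    by (rule L2_set_le_sum) simp
  also have "\<dots> \<le> (\<Sum>x\<in>F. \<Sum>y\<in>F. cmod (t x y) * l2norm f)"
  proof (rule sum_mono)
    fix x assume "x \<in> F"
    then have "cmod (finite_matrix_op F t f x) \<le> (\<Sum>y\<in>F. cmod (t x y * f y))"
      by (simp add: finite_matrix_op_def norm_sum)
    also have "\<dots> \<le> (\<Sum>y\<in>F. cmod (t x y) * l2norm f)"
      unfolding norm_mult by (intro sum_mono mult_left_mono cmod_le_l2norm[OF f]) simp
    finally show "cmod (finite_matrix_op F t f x) \<le> (\<Sum>y\<in>F. cmod (t x y) * l2norm f)" .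
  qed
  finally show "l2norm (finite_matrix_op F t f) \<le> (\<Sum>x\<in>F. \<Sum>y\<in>F. cmod (t x y)) * l2norm f"
    by (simp add: sum_distrib_right)
qed

lemma bounded_op_finite_matrix_op:
  assumes F: "finite F"
  shows "bounded_op (finite_matrix_op F t)"
  unfolding bounded_op_def
proof (intro conjI ballI allI)
  fix f h :: "'a \<Rightarrow> complex" and c
  show "finite_matrix_op F t (\<lambda>x. f x + h x) = (\<lambda>x. finite_matrix_op F t f x + finite_matrix_op F t h x)"
    by (auto simp: finite_matrix_op_def distrib_left sum.distrib)
  show "finite_matrix_op F t (\<lambda>x. c * f x) = (\<lambda>x. c * finite_matrix_op F t f x)"
    by (auto simp: finite_matrix_op_def sum_distrib_left mult_ac)
  show "f \<in> l2 \<Longrightarrow> finite_matrix_op F t f \<in> l2" by (rule finite_matrix_op_l2[OF F])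
  show "\<exists>C. \<forall>f\<in>l2. l2norm (finite_matrix_op F t f) \<le> C * l2norm f"
    using l2norm_finite_matrix_op[OF F] by blast
qed

lemma matrix_coeff_finite_matrix_op:
  assumes F: "finite F"
  shows "matrix_coeff (finite_matrix_op F t) x y = (if x \<in> F \<and> y \<in> F then t x y else 0)"
proof -
  have "(\<Sum>z\<in>F. t x z * delta y z) = (\<Sum>z\<in>F. if z = y then t x y else 0)"
    by (intro sum.cong) (auto simp: delta_def)
  then show ?thesis using F by (simp add: matrix_coeff_def finite_matrix_op_def)
qed

lemma finite_net_of_finite_support:
  assumes F: "finite F" and e: "0 < e"
  shows "\<exists>G. finite G \<and> G \<subseteq> l2 \<and>
    (\<forall>h. (\<forall>x. x \<notin> F \<longrightarrow> h x = 0) \<longrightarrow> (\<forall>x. cmod (h x) \<le> M) \<longrightarrow> (\<exists>g\<in>G. l2norm (\<lambda>x. h x - g x) < e))"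
proof -
  \<comment> \<open>Coordinatewise errors below \<open>\<delta>\<close> sum to less than
    \<open>e\<close> over \<open>F\<close>; the added 1 also covers the empty set.\<close>
  define \<delta> where "\<delta> = e / (real (card F) + 1)"
  have \<delta>: "0 < \<delta>" using e by (simp add: \<delta>_def)
  obtain Q where Q: "finite Q" "cball (0::complex) M \<subseteq> (\<Union>q\<in>Q. ball q \<delta>)"
    using compact_eq_totally_bounded[of "cball (0::complex) M"] \<delta> by auto
  define ext where "ext p x = (if x \<in> F then p x else 0)" for p :: "'a \<Rightarrow> complex" and x
  define G where "G = ext ` (PiE F (\<lambda>_. Q))"
  have "finite G" unfolding G_def using F Q by (simp add: finite_PiE)
  moreover have "G \<subseteq> l2"
    unfolding G_def ext_def using F by (auto intro!: l2_finite_support)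
  moreover have "\<exists>g\<in>G. l2norm (\<lambda>x. h x - g x) < e"
    if h0: "\<And>x. x \<notin> F \<Longrightarrow> h x = 0" and hM: "\<And>x. cmod (h x) \<le> M" for h
  proof -
    have "\<exists>q\<in>Q. cmod (h x - q) < \<delta>" for x
    proof -
      have "h x \<in> cball 0 M" using hM[of x] by simp
      then have "h x \<in> (\<Union>q\<in>Q. ball q \<delta>)" by (rule subsetD[OF Q(2)])
      then show ?thesis by (auto simp: dist_norm norm_minus_commute)
    qed
    then obtain p where p: "\<And>x. p x \<in> Q" "\<And>x. cmod (h x - p x) < \<delta>" by metis
    have "ext p = ext (restrict p F)" by (auto simp: ext_def)
    then have "ext p \<in> G" unfolding G_def using p(1) by auto
    moreover have "l2norm (\<lambda>x. h x - ext p x) < e"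
    proof -
      have "l2norm (\<lambda>x. h x - ext p x) = L2_set (\<lambda>x. cmod (h x - ext p x)) F"
        using h0 by (intro l2norm_finite_support[OF F]) (simp add: ext_def)
      also have "\<dots> \<le> (\<Sum>x\<in>F. cmod (h x - ext p x))" by (rule L2_set_le_sum) simp
      also have "\<dots> \<le> (\<Sum>x\<in>F. \<delta>)" using p(2) by (intro sum_mono) (simp add: ext_def less_imp_le)
      also have "\<dots> < e" using e by (simp add: \<delta>_def field_simps)
      finally show ?thesis .
    qed
    ultimately show ?thesis by blast
  qed
  ultimately show ?thesis by blast
qed

text \<open>A ghost is approximated in norm by the finite matrix obtained from its Schur product with
  an almost unit kernel: that product has finite propagation, so its small entries have small norm.\<close>

lemma compact_of_ghost:
  assumes d: "ext_metric d" and bg: "bounded_geometry d" and A: "property_A d" and ghost: "ghost d T"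
  shows "compact_op T"
proof -
  have T: "bounded_op T" and roe: "uniform_roe d T" using ghost by (auto simp: ghost_def uniform_roe_def)
  obtain k where kpd: "\<And>n. pos_def_kernel (k n)"
    and kprop: "\<And>n. \<exists>r::real. \<forall>x y. d x y > ereal r \<longrightarrow> k n x y = 0"
    and kone: "\<And>s \<epsilon> :: real. s > 0 \<Longrightarrow> \<epsilon> > 0 \<Longrightarrow> \<exists>N::nat. \<forall>n>N. \<forall>x y.
        d x y < ereal s \<longrightarrow> 1 - \<epsilon> \<le> k n x y \<and> k n x y \<le> 1"
    using A unfolding property_A_def by blast
  \<comment> \<open>The factor 4 counts the errors: \<open>T - S\<close>, its Schur product with
    \<open>l\<close>, the Schur product of \<open>S\<close> with \<open>1 - l\<close>, and the part
    of the Schur product of \<open>T\<close> with \<open>l\<close> that lies outside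
    \<open>F\<close>.\<close>
  have approx: "\<exists>F t. finite F \<and> (\<forall>f\<in>l2. l2norm (\<lambda>x. T f x - finite_matrix_op F t f x) \<le> 4 * \<eta> * l2norm f)"
    if \<eta>: "0 < \<eta>" for \<eta>
  proof -
    obtain S where S: "finite_prop_op d S" and TS: "op_norm (\<lambda>f x. T f x - S f x) < \<eta>"
      using roe \<eta> unfolding uniform_roe_def by blast
    obtain R where R: "0 \<le> R" "prop_le d R S" and Sb: "bounded_op S"
      using S unfolding finite_prop_op_def by blast
    obtain C where C: "0 \<le> C" "\<And>f. f \<in> l2 \<Longrightarrow> l2norm (S f) \<le> C * l2norm f"
      using bounded_opE[OF Sb] by blast
    have "0 < R + 1" using R by simp
    then obtain N1 :: nat where N1: "\<And>x. finite {y. d x y \<le> ereal (R + 1)} \<and> card {y. d x y \<le> ereal (R + 1)} \<le> N1"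
      using bg unfolding bounded_geometry_def by blast
    \<comment> \<open>Chosen after \<open>S\<close>, since it must beat both the norm bound of
      \<open>S\<close> and the ball size at its propagation. Likewise \<open>e2\<close> below is
      chosen after the propagation of \<open>l\<close>. The radius is \<open>R + 1\<close> because
      property A controls only pairs at distance strictly below its scale.\<close>
    define e1 where "e1 = \<eta> / (C * real N1 + 1)"
    have pos: "0 < C * real N1 + 1" using C(1) by (intro add_nonneg_pos mult_nonneg_nonneg) auto
    have e1: "0 < e1" using \<eta> pos by (simp add: e1_def)
    have e1': "e1 * C * real N1 \<le> \<eta>"
    proof -
      have "C * real N1 / (C * real N1 + 1) \<le> 1" using pos by simp
      then have "\<eta> * (C * real N1 / (C * real N1 + 1)) \<le> \<eta> * 1" using \<eta> by (intro mult_left_mono) auto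
      then show ?thesis by (simp add: e1_def mult.assoc)
    qed
    obtain n0 where n0: "\<And>n x y. n > n0 \<Longrightarrow> d x y < ereal (R + 1) \<Longrightarrow> 1 - e1 \<le> k n x y \<and> k n x y \<le> 1"
      using kone[OF \<open>0 < R + 1\<close> e1] by blast
    define l where "l = k (Suc n0)"
    have l: "1 - e1 \<le> l x y \<and> l x y \<le> 1" if "d x y < ereal (R + 1)" for x y
      unfolding l_def using n0[OF _ that, of "Suc n0"] by simp
    have lpd: "pos_def_kernel l" unfolding l_def by (rule kpd)
    have ldiag: "l x x \<le> 1" for x
      using l[of x x] R by (simp add: ext_metric_refl[OF d])
    have labs: "\<bar>l x y\<bar> \<le> 1" for x y
      using pos_def_kernel_le_diag[OF lpd, of x y] ldiag[of x] ldiag[of y] by linarith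
    obtain r0 where r0: "\<And>x y. d x y > ereal r0 \<Longrightarrow> l x y = 0"
      using kprop[of "Suc n0"] unfolding l_def by blast
    define r where "r = max r0 1"
    have r: "0 < r" by (simp add: r_def)
    have lsupp: "d x y \<le> ereal r" if "l x y \<noteq> 0" for x y
    proof -
      have "d x y \<le> ereal r0" using r0[of x y] that by (meson not_le)
      also have "\<dots> \<le> ereal r" by (simp add: r_def)
      finally show ?thesis .
    qed
    obtain N2 :: nat where N2: "\<And>x. finite {y. d x y \<le> ereal r} \<and> card {y. d x y \<le> ereal r} \<le> N2"
      using bg r unfolding bounded_geometry_def by blast
    define e2 where "e2 = \<eta> / (real N2 + 1)"
    have e2: "0 < e2" "e2 * real N2 \<le> \<eta>" using \<eta> by (simp_all add: e2_def field_simps)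
    obtain F where F: "finite F" and small: "\<And>x y. x \<notin> F \<or> y \<notin> F \<Longrightarrow> cmod (matrix_coeff T x y) < e2"
      using ghost e2(1) unfolding ghost_def by blast
    let ?t = "\<lambda>x y. complex_of_real (l x y) * matrix_coeff T x y"
    let ?K = "finite_matrix_op F ?t"
    let ?D = "\<lambda>f x. T f x - S f x"
    have Db: "bounded_op ?D" by (rule bounded_op_diff[OF T Sb])
    have mD: "matrix_coeff ?D x y = matrix_coeff T x y - matrix_coeff S x y" for x y
      by (simp add: matrix_coeff_def)
    have mK: "matrix_coeff (\<lambda>f x. T f x - ?K f x) x y = matrix_coeff T x y - matrix_coeff ?K x y" for x y
      by (simp add: matrix_coeff_def)
    have D: "form_bounded (matrix_coeff ?D) \<eta>"
    proof (rule form_bounded_operator[OF Db])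
      show "l2norm (?D f) \<le> \<eta> * l2norm f" if "f \<in> l2" for f
        using op_norm_bound[OF Db that] TS l2norm_nonneg[of f]
        by (meson less_imp_le mult_right_mono order_trans)
    qed (use \<eta> in simp)
    have lD: "form_bounded (\<lambda>x y. complex_of_real (l x y) * matrix_coeff ?D x y) \<eta>"
      using \<eta> by (intro form_bounded_schur_multiplier[OF lpd ldiag D]) simp
    have lS: "form_bounded (\<lambda>x y. complex_of_real (1 - l x y) * matrix_coeff S x y) \<eta>"
    proof (rule form_bounded_mono[OF _ e1'], rule form_bounded_banded[OF _ _ d N1])
      fix x y
      have near: "d x y < ereal (R + 1)" if "matrix_coeff S x y \<noteq> 0"
        using R(2) that unfolding prop_le_def by (rule_tac le_less_trans[of _ "ereal R"]) auto
      show "cmod (complex_of_real (1 - l x y) * matrix_coeff S x y) \<le> e1 * C"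
      proof (cases "matrix_coeff S x y = 0")
        case False
        then have "\<bar>1 - l x y\<bar> \<le> e1" using l[OF near] e1 by linarith
        moreover have "cmod (matrix_coeff S x y) \<le> C" by (rule matrix_coeff_bound[OF Sb C(2)])
        ultimately show ?thesis unfolding norm_mult norm_of_real using e1 by (intro mult_mono) auto
      qed (use e1 C in simp)
      show "d x y \<le> ereal (R + 1)" if "complex_of_real (1 - l x y) * matrix_coeff S x y \<noteq> 0"
      proof -
        have "matrix_coeff S x y \<noteq> 0" using that by auto
        from near[OF this] show ?thesis by (rule less_imp_le)
      qed
    qed (use e1 C in simp)
    have lT: "form_bounded (\<lambda>x y. ?t x y - matrix_coeff ?K x y) \<eta>"
    proof (rule form_bounded_mono[OF _ e2(2)], rule form_bounded_banded[OF _ _ d N2])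
      fix x y
      show "cmod (?t x y - matrix_coeff ?K x y) \<le> e2"
      proof (cases "x \<in> F \<and> y \<in> F")
        case True
        then show ?thesis using e2(1) by (simp add: matrix_coeff_finite_matrix_op[OF F])
      next
        case False
        then have "cmod (matrix_coeff T x y) \<le> e2" using small[of x y] by auto
        then have "\<bar>l x y\<bar> * cmod (matrix_coeff T x y) \<le> 1 * e2" using labs by (intro mult_mono) auto
        then show ?thesis using False by (auto simp: matrix_coeff_finite_matrix_op[OF F] norm_mult)
      qed
      show "d x y \<le> ereal r" if "?t x y - matrix_coeff ?K x y \<noteq> 0"
        using lsupp[of x y] that by (auto simp: matrix_coeff_finite_matrix_op[OF F] split: if_splits)
    qed (use e2 in simp)
    let ?L = "\<lambda>f x. T f x - ?K f x"
    have L: "bounded_op ?L" by (rule bounded_op_diff[OF T bounded_op_finite_matrix_op[OF F]])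
    have mL: "matrix_coeff ?L = (\<lambda>x y. ((matrix_coeff ?D x y + - (complex_of_real (l x y) * matrix_coeff ?D x y))
        + complex_of_real (1 - l x y) * matrix_coeff S x y) + (?t x y - matrix_coeff ?K x y))"
    proof (intro ext)
      fix x y
      have "a - z = ((a - s) + - (c * (a - s)) + (1 - c) * s) + (c * a - z)" for a s c z :: complex
        by (simp add: algebra_simps)
      then show "matrix_coeff ?L x y = ((matrix_coeff ?D x y + - (complex_of_real (l x y) * matrix_coeff ?D x y))
        + complex_of_real (1 - l x y) * matrix_coeff S x y) + (?t x y - matrix_coeff ?K x y)"
        unfolding mD mK of_real_diff of_real_1 .
    qed
    have "form_bounded (matrix_coeff ?L) (((\<eta> + \<eta>) + \<eta>) + \<eta>)"
      unfolding mL by (intro form_bounded_add form_bounded_uminus D lD lS lT)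
    then have Lf: "form_bounded (matrix_coeff ?L) (4 * \<eta>)" by simp
    have "l2norm (?L f) \<le> 4 * \<eta> * l2norm f" if "f \<in> l2" for f
      by (rule bounded_op_norm_le_of_finite_forms[OF L _ form_boundedD[OF Lf] that]) (use \<eta> in simp)
    then show ?thesis using F by blast
  qed
  show ?thesis
    unfolding compact_op_def
  proof (intro conjI allI impI)
    show "bounded_op T" by (rule T)
    fix \<epsilon> :: real assume \<epsilon>: "0 < \<epsilon>"
    \<comment> \<open>The approximation then costs \<open>\<epsilon> / 4\<close> on the unit ball
      and the net \<open>\<epsilon> / 2\<close>.\<close>
    then have "0 < \<epsilon> / 16" by simp
    from approx[OF this] obtain F t where F: "finite F"
      and near: "\<And>f. f \<in> l2 \<Longrightarrow> l2norm (\<lambda>x. T f x - finite_matrix_op F t f x) \<le> 4 * (\<epsilon> / 16) * l2norm f"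
      by blast
    let ?K = "finite_matrix_op F t" and ?M = "\<Sum>x\<in>F. \<Sum>y\<in>F. cmod (t x y)"
    have M0: "0 \<le> ?M" by (intro sum_nonneg) simp
    obtain G where G: "finite G" "G \<subseteq> l2" and net: "\<forall>h. (\<forall>x. x \<notin> F \<longrightarrow> h x = 0) \<longrightarrow>
        (\<forall>x. cmod (h x) \<le> ?M) \<longrightarrow> (\<exists>g\<in>G. l2norm (\<lambda>x. h x - g x) < \<epsilon> / 2)"
      using finite_net_of_finite_support[OF F half_gt_zero[OF \<epsilon>], of ?M] by (elim exE conjE) (rule that)
    have "\<exists>g\<in>G. l2norm (\<lambda>x. T f x - g x) < \<epsilon>" if f: "f \<in> l2" "l2norm f \<le> 1" for f
    proof -
      have K: "?K f \<in> l2" by (rule finite_matrix_op_l2[OF F f(1)])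
      have "cmod (?K f x) \<le> ?M" for x
      proof -
        have "cmod (?K f x) \<le> l2norm (?K f)" by (rule cmod_le_l2norm[OF K])
        also have "\<dots> \<le> ?M * l2norm f" by (rule l2norm_finite_matrix_op[OF F f(1)])
        also have "\<dots> \<le> ?M * 1" by (rule mult_left_mono[OF f(2) M0])
        finally show ?thesis by simp
      qed
      then obtain g where g: "g \<in> G" "l2norm (\<lambda>x. ?K f x - g x) < \<epsilon> / 2"
        using net[rule_format, of "?K f"] by (auto simp: finite_matrix_op_def)
      have gl: "g \<in> l2" using g(1) G(2) by blast
      have "l2norm (\<lambda>x. (T f x - ?K f x) + (?K f x - g x))
          \<le> l2norm (\<lambda>x. T f x - ?K f x) + l2norm (\<lambda>x. ?K f x - g x)"
        by (intro l2norm_triangle l2_diff bounded_op_l2[OF T] f K gl)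
      moreover have "4 * (\<epsilon> / 16) * l2norm f \<le> 4 * (\<epsilon> / 16) * 1" using \<epsilon> f(2) by (intro mult_left_mono) auto
      ultimately have "l2norm (\<lambda>x. (T f x - ?K f x) + (?K f x - g x)) < \<epsilon>"
        using near[OF f(1)] g(2) \<epsilon> by linarith
      then show ?thesis using g(1) by auto
    qed
    then show "\<exists>G. finite G \<and> G \<subseteq> l2 \<and> (\<forall>f\<in>l2. l2norm f \<le> 1 \<longrightarrow> (\<exists>g\<in>G. l2norm (\<lambda>x. T f x - g x) < \<epsilon>))"
      using G by blast
  qed
qed

theorem theorem1p3:
  fixes d :: "'a \<Rightarrow> 'a \<Rightarrow> ereal"
  assumes "ext_metric d" and "bounded_geometry d"
  shows "(\<not> property_A d \<longrightarrow> (\<exists>T. ghost d T \<and> \<not> compact_op T)) \<and>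
         (property_A d \<longleftrightarrow> (\<forall>T. ghost d T \<longrightarrow> compact_op T))"
  using ghost_not_compact_of_not_property_A[OF assms] compact_of_ghost[OF assms] by blast

end
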